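(* There are infinitely many connected simple bridgeless cubic graphs with no Petersen coloring. Moreover, the family $\mathcal H_3$ is infinite.
   Context: Graphs are finite; cubic graphs may have parallel edges but no loops unless called simple; graphs are counted up to isomorphism. For cubic graphs $G$ and $H$, an $H$-coloring of $G$ is a map $\varphi:E(G)\to E(H)$ such that at every vertex of $G$ the three incident edges are mapped bijectively onto the three edges incident with some vertex of $H$; in this case one says that $H$ colors $G$. A Petersen coloring is an $H$-coloring with $H$ the Petersen graph. A cubic graph is a 3-graph if every vertex set of odd cardinality has at least three edges to its complement. A set of connected 3-graphs is 3-complete if every connected 3-graph is colored by some member of the set. By a result of Ma, Mattiolo, Steffen and Wolf there is a unique inclusion-wise minimal 3-complete set (up to isomorphism of its members); it is denoted $\mathcal H_3$. *)

theory Defs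
  imports Main
begin

text \<open>Undirected multigraphs: the edges are abstract objects and \<open>ends\<close> gives the set of end
  vertices of an edge, so parallel edges are distinct edges with the same ends. The values of
  \<open>ends\<close> outside \<open>edges\<close> carry no information.\<close>

record ('v, 'e) mgraph =
  verts :: "'v set"
  edges :: "'e set"
  ends :: "'e \<Rightarrow> 'v set"

definition loopless_graph :: "('v, 'e) mgraph \<Rightarrow> bool" where
  "loopless_graph G \<longleftrightarrow> finite (verts G) \<and> finite (edges G) \<and>
     (\<forall>e\<in>edges G. ends G e \<subseteq> verts G \<and> card (ends G e) = 2)"

definition incident_edges :: "('v, 'e) mgraph \<Rightarrow> 'v \<Rightarrow> 'e set" where
  "incident_edges G v = {e \<in> edges G. v \<in> ends G e}"

definition cubic :: "('v, 'e) mgraph \<Rightarrow> bool" where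
  "cubic G \<longleftrightarrow> loopless_graph G \<and> (\<forall>v\<in>verts G. card (incident_edges G v) = 3)"

definition simple_graph :: "('v, 'e) mgraph \<Rightarrow> bool" where
  "simple_graph G \<longleftrightarrow> loopless_graph G \<and> inj_on (ends G) (edges G)"

definition adj_rel :: "('v, 'e) mgraph \<Rightarrow> ('v \<times> 'v) set" where
  "adj_rel G = {(u, v). \<exists>e\<in>edges G. ends G e = {u, v}}"

text \<open>The graph without vertices is not connected.\<close>

definition connected_graph :: "('v, 'e) mgraph \<Rightarrow> bool" where
  "connected_graph G \<longleftrightarrow> verts G \<noteq> {} \<and> (\<forall>u\<in>verts G. \<forall>v\<in>verts G. (u, v) \<in> (adj_rel G)\<^sup>*)"

definition delete_edge :: "('v, 'e) mgraph \<Rightarrow> 'e \<Rightarrow> ('v, 'e) mgraph" where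
  "delete_edge G e = G\<lparr>edges := edges G - {e}\<rparr>"

text \<open>A bridge is an edge whose deletion separates its ends.\<close>

definition bridge :: "('v, 'e) mgraph \<Rightarrow> 'e \<Rightarrow> bool" where
  "bridge G e \<longleftrightarrow> e \<in> edges G \<and>
     (\<exists>u\<in>ends G e. \<exists>v\<in>ends G e. (u, v) \<notin> (adj_rel (delete_edge G e))\<^sup>*)"

definition bridgeless :: "('v, 'e) mgraph \<Rightarrow> bool" where
  "bridgeless G \<longleftrightarrow> (\<forall>e. \<not> bridge G e)"

definition edge_cut :: "('v, 'e) mgraph \<Rightarrow> 'v set \<Rightarrow> 'e set" where
  "edge_cut G X = {e \<in> edges G. ends G e \<inter> X \<noteq> {} \<and> ends G e \<inter> (verts G - X) \<noteq> {}}"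

definition three_graph :: "('v, 'e) mgraph \<Rightarrow> bool" where
  "three_graph G \<longleftrightarrow> cubic G \<and> (\<forall>X\<subseteq>verts G. odd (card X) \<longrightarrow> 3 \<le> card (edge_cut G X))"

definition H_coloring :: "('w, 'f) mgraph \<Rightarrow> ('v, 'e) mgraph \<Rightarrow> ('e \<Rightarrow> 'f) \<Rightarrow> bool" where
  "H_coloring H G \<phi> \<longleftrightarrow> \<phi> ` edges G \<subseteq> edges H \<and>
     (\<forall>v\<in>verts G. \<exists>u\<in>verts H. bij_betw \<phi> (incident_edges G v) (incident_edges H u))"

definition colors :: "('w, 'f) mgraph \<Rightarrow> ('v, 'e) mgraph \<Rightarrow> bool" where
  "colors H G \<longleftrightarrow> (\<exists>\<phi>. H_coloring H G \<phi>)"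

text \<open>The Petersen graph as the Kneser graph of the 2-subsets of a 5-element set.\<close>

definition petersen :: "(nat set, nat set set) mgraph" where
  "petersen = \<lparr>verts = {A. A \<subseteq> {..<5} \<and> card A = 2},
     edges = {{A, B} | A B. A \<subseteq> {..<5} \<and> card A = 2 \<and> B \<subseteq> {..<5} \<and> card B = 2 \<and> A \<inter> B = {}},
     ends = id\<rparr>"

definition petersen_coloring :: "('v, 'e) mgraph \<Rightarrow> ('e \<Rightarrow> nat set set) \<Rightarrow> bool" where
  "petersen_coloring G \<phi> \<longleftrightarrow> H_coloring petersen G \<phi>"

definition isomorphic :: "('v, 'e) mgraph \<Rightarrow> ('w, 'f) mgraph \<Rightarrow> bool" where
  "isomorphic G H \<longleftrightarrow> (\<exists>f g. bij_betw f (verts G) (verts H) \<and> bij_betw g (edges G) (edges H) \<and>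
     (\<forall>e\<in>edges G. ends H (g e) = f ` ends G e))"

text \<open>Every finite graph is isomorphic to one whose vertices and edges are natural numbers, so
  families of graphs up to isomorphism are taken inside the following type.\<close>

type_synonym nat_graph = "(nat, nat) mgraph"

definition iso_class :: "nat_graph \<Rightarrow> nat_graph set" where
  "iso_class G = {H. isomorphic G H}"

definition three_complete :: "nat_graph set \<Rightarrow> bool" where
  "three_complete S \<longleftrightarrow> (\<forall>H\<in>S. connected_graph H \<and> three_graph H) \<and>
     (\<forall>G :: nat_graph. connected_graph G \<and> three_graph G \<longrightarrow> (\<exists>H\<in>S. colors H G))"

definition minimal_three_complete :: "nat_graph set \<Rightarrow> bool" where
  "minimal_three_complete S \<longleftrightarrow> three_complete S \<and> (\<forall>T. T \<subset> S \<longrightarrow> \<not> three_complete T)"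

text \<open>The minimal 3-complete set is unique only up to isomorphism of its members; what is uniquely
  determined, and taken as \<open>\<H>\<^sub>3\<close>, is the set of isomorphism classes of its members.\<close>

definition H3 :: "nat_graph set set" where
  "H3 = (THE C. \<exists>S. minimal_three_complete S \<and> C = iso_class ` S)"

end

theory Submission imports Defs begin

text \<open>A graph with 60 vertices, assembled from seven copies of the Petersen graph minus two adjacent
  vertices and four further vertices, has no Petersen colouring: a colouring of such a copy
  restricts the colours of its four outgoing edges to a small relation, so a short search over
  the outgoing edges suffices.

  Call a connected 3-graph rigid if every connected 3-graph that colours it is isomorphic to it. A
  colouring of a graph of class 2 (not 3-edge-colourable) by \<open>K\<close> that misses a vertex of \<open>K\<close> can be
  replaced by a colouring by a smaller graph. So among the connected 3-graphs that colour a given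
  class 2 graph a smallest one is rigid, and \<open>\<H>\<^sub>3\<close> consists of the classes of the rigid graphs. The
  Petersen graph \<open>P\<close> is rigid because every class 2 graph has at least ten vertices.

  Now insert \<open>P\<close> minus an edge into every edge of \<open>K\<close>. If \<open>P\<close> does not colour \<open>K\<close>, then it does not
  colour the new graph \<open>B\<close>, since \<open>P\<close> has no cut with two edges; this gives infinitely many
  uncolourable simple graphs. If \<open>K\<close> is rigid and a rigid \<open>L\<close> colours \<open>B\<close> while \<open>P\<close> does not colour
  \<open>L\<close>, then every inserted copy produces a ten-vertex side of a 2-cut of \<open>L\<close>; these blocks are
  disjoint, and removing them leaves a graph that colours \<open>K\<close>, so \<open>L\<close> is larger than \<open>K\<close>.\<close>


section \<open>Cuts and double counting\<close>

text \<open>Why a colouring that misses a vertex can be improved: for an edge \<open>d\<close> of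
  \<open>K\<close>, the fibres of the vertex map over the two ends of \<open>d\<close> have even
  total size, because every edge coloured \<open>d\<close> has two ends. By connectedness all fibres
  have the same parity. If it is odd, the map is onto and \<open>K\<close> is no larger than the
  coloured graph. The same count, applied to an inserted copy whose two outgoing edges have
  different colours, produces a 2-edge-cut of the colouring graph. The obstacle for
  \<open>H3\<close> is that large uncolourable graphs alone prove nothing: one rigid graph might
  colour all of them. So the rigid graph itself has to grow. The number ten makes this work: it is
  both the least order of a class 2 graph and the order of the inserted graph, so the sides that
  arise have exactly ten vertices and cannot cross.\<close>

definition inner_edges :: "('v, 'e) mgraph \<Rightarrow> 'v set \<Rightarrow> 'e set" where
  "inner_edges G X = {e \<in> edges G. ends G e \<subseteq> X}"

text \<open>In a cubic graph a cut has the parity of its side, so a bound of two on all proper cuts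
  already gives three on odd sides. This one condition stands for "connected 3-graph" throughout;
  \<open>conn3_iff\<close> translates.\<close>

definition conn3 :: "('v, 'e) mgraph \<Rightarrow> bool" where
  "conn3 G \<longleftrightarrow> cubic G \<and> verts G \<noteq> {} \<and>
     (\<forall>X \<subseteq> verts G. X \<noteq> {} \<longrightarrow> X \<noteq> verts G \<longrightarrow> 2 \<le> card (edge_cut G X))"

lemma loopless_ends:
  assumes "loopless_graph G" "e \<in> edges G"
  obtains u v where "ends G e = {u, v}" "u \<noteq> v" "u \<in> verts G" "v \<in> verts G"
  using assms unfolding loopless_graph_def by (metis card_2_iff insert_subset)

lemma loopless_ends_eq:
  assumes "loopless_graph G" "e \<in> edges G" "a \<in> ends G e" "b \<in> ends G e" "a \<noteq> b"
  shows "ends G e = {a, b}"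
  by (rule loopless_ends[OF assms(1,2)]) (use assms in auto)

lemma loopless_finite:
  assumes "loopless_graph G"
  shows "finite (verts G)" "finite (edges G)"
  using assms by (auto simp: loopless_graph_def)

lemma finite_incident [simp]: "loopless_graph G \<Longrightarrow> finite (incident_edges G v)"
  by (simp add: incident_edges_def loopless_graph_def)

lemma finite_edge_cut [simp]: "loopless_graph G \<Longrightarrow> finite (edge_cut G X)"
  by (simp add: edge_cut_def loopless_graph_def)

lemma finite_inner_edges [simp]: "loopless_graph G \<Longrightarrow> finite (inner_edges G X)"
  by (simp add: inner_edges_def loopless_graph_def)

lemma cubic_loopless: "cubic G \<Longrightarrow> loopless_graph G"
  by (simp add: cubic_def)

lemma conn3_cubic: "conn3 G \<Longrightarrow> cubic G"
  by (simp add: conn3_def)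

lemma conn3_loopless: "conn3 G \<Longrightarrow> loopless_graph G"
  by (simp add: conn3_def cubic_def)

lemma conn3_cut:
  "conn3 G \<Longrightarrow> X \<subseteq> verts G \<Longrightarrow> X \<noteq> {} \<Longrightarrow> X \<noteq> verts G \<Longrightarrow> 2 \<le> card (edge_cut G X)"
  by (simp add: conn3_def)

lemma edge_cut_compl:
  assumes "X \<subseteq> verts G"
  shows "edge_cut G (verts G - X) = edge_cut G X"
proof -
  have "verts G - (verts G - X) = X" using assms by auto
  then show ?thesis unfolding edge_cut_def by auto
qed

lemma edge_cut_trivial:
  assumes "loopless_graph G"
  shows "edge_cut G {} = {}" "edge_cut G (verts G) = {}"
  by (auto simp: edge_cut_def)

lemma edge_cut_single:
  assumes "loopless_graph G" "v \<in> verts G"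
  shows "edge_cut G {v} = incident_edges G v"
proof -
  have "ends G e \<inter> {v} \<noteq> {} \<and> ends G e \<inter> (verts G - {v}) \<noteq> {} \<longleftrightarrow> v \<in> ends G e" if "e \<in> edges G" for e
    by (rule loopless_ends[OF assms(1) that]) auto
  then show ?thesis by (auto simp: edge_cut_def incident_edges_def)
qed

text \<open>Each edge is counted once for every end in \<open>X\<close>. The predicate
  \<open>Q\<close> lets one count serve for all edges (\<open>degree_sum\<close>), for the edges of
  one colour (\<open>vcol_count\<close>) and for the edges outside a matching
  (\<open>conn3_list_graph\<close>).\<close>

lemma handshake:
  assumes G: "loopless_graph G" and X: "X \<subseteq> verts G"
  shows "(\<Sum>v\<in>X. card {e \<in> incident_edges G v. Q e}) =
    2 * card {e \<in> inner_edges G X. Q e} + card {e \<in> edge_cut G X. Q e}"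
proof -
  have fX: "finite X" using X G finite_subset loopless_finite by blast
  have fE: "finite (edges G)" using G loopless_finite by blast
  have "(\<Sum>v\<in>X. card {e \<in> incident_edges G v. Q e}) =
      (\<Sum>v\<in>X. \<Sum>e\<in>edges G. of_bool (v \<in> ends G e \<and> Q e))"
  proof (rule sum.cong[OF refl])
    fix v
    have "{e \<in> incident_edges G v. Q e} = edges G \<inter> {e. v \<in> ends G e \<and> Q e}"
      by (auto simp: incident_edges_def)
    then show "card {e \<in> incident_edges G v. Q e} = (\<Sum>e\<in>edges G. of_bool (v \<in> ends G e \<and> Q e))"
      by (simp add: sum_of_bool_eq fE)
  qed
  also have "\<dots> = (\<Sum>e\<in>edges G. \<Sum>v\<in>X. of_bool (v \<in> ends G e \<and> Q e))"
    by (rule sum.swap)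
  also have "\<dots> = (\<Sum>e\<in>edges G. 2 * of_bool (e \<in> inner_edges G X \<and> Q e) + of_bool (e \<in> edge_cut G X \<and> Q e))"
  proof (rule sum.cong[OF refl])
    fix e assume e: "e \<in> edges G"
    obtain u v where uv: "ends G e = {u, v}" "u \<noteq> v" "u \<in> verts G" "v \<in> verts G"
      using loopless_ends[OF G e] by metis
    have "(\<Sum>w\<in>X. of_bool (w \<in> ends G e \<and> Q e)) = (\<Sum>w\<in>X \<inter> {u, v}. of_bool (Q e) :: nat)"
      unfolding uv(1) by (rule sum.mono_neutral_cong_right) (auto simp: fX)
    also have "\<dots> = card (X \<inter> {u, v}) * of_bool (Q e)" by simp
    also have "\<dots> = 2 * of_bool (e \<in> inner_edges G X \<and> Q e) + of_bool (e \<in> edge_cut G X \<and> Q e)"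
      using uv e by (cases "u \<in> X"; cases "v \<in> X") (auto simp: inner_edges_def edge_cut_def)
    finally show "(\<Sum>w\<in>X. of_bool (w \<in> ends G e \<and> Q e)) =
      2 * of_bool (e \<in> inner_edges G X \<and> Q e) + (of_bool (e \<in> edge_cut G X \<and> Q e) :: nat)" .
  qed
  also have "\<dots> = 2 * card {e \<in> inner_edges G X. Q e} + card {e \<in> edge_cut G X. Q e}"
  proof -
    have "{e \<in> inner_edges G X. Q e} = {e \<in> edges G. e \<in> inner_edges G X \<and> Q e}"
      "{e \<in> edge_cut G X. Q e} = {e \<in> edges G. e \<in> edge_cut G X \<and> Q e}"
      by (auto simp: inner_edges_def edge_cut_def)
    then show ?thesis
      by (simp add: sum.distrib sum_distrib_left[symmetric] fE Int_def)
  qed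
  finally show ?thesis .
qed

lemma degree_sum:
  assumes "cubic G" "X \<subseteq> verts G"
  shows "3 * card X = 2 * card (inner_edges G X) + card (edge_cut G X)"
proof -
  have "(\<Sum>v\<in>X. card {e \<in> incident_edges G v. True}) = 3 * card X"
    using assms by (simp add: cubic_def subset_iff)
  then show ?thesis
    using handshake[OF cubic_loopless[OF assms(1)] assms(2), of "\<lambda>_. True"] by simp
qed

lemma cubic_even_verts: "cubic G \<Longrightarrow> even (card (verts G))"
  using degree_sum[of G "verts G"] edge_cut_trivial(2)[OF cubic_loopless, of G] by simp presburger

lemma adj_rel_closed:
  assumes G: "loopless_graph G" and r: "(u, v) \<in> (adj_rel G)\<^sup>*" and u: "u \<in> X"
    and cut: "edge_cut G X = {}"
  shows "v \<in> X"
  using r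
proof (induction rule: rtrancl_induct)
  case base show ?case by (fact u)
next
  case (step y z)
  then obtain e where e: "e \<in> edges G" "ends G e = {y, z}" by (auto simp: adj_rel_def)
  then have "z \<in> verts G" using G by (auto simp: loopless_graph_def)
  then show ?case using cut e step(3) by (auto simp: edge_cut_def)
qed

lemma conn3_iff: "conn3 G \<longleftrightarrow> connected_graph G \<and> three_graph G"
proof
  assume G: "conn3 G"
  note l = conn3_loopless[OF G]
  have c: "cubic G" using G by (simp add: conn3_def)
  have "(u, v) \<in> (adj_rel G)\<^sup>*" if "u \<in> verts G" "v \<in> verts G" for u v
  proof -
    let ?X = "{w \<in> verts G. (u, w) \<in> (adj_rel G)\<^sup>*}"
    have "edge_cut G ?X = {}"
    proof (rule ccontr)
      assume "edge_cut G ?X \<noteq> {}"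
      then obtain e where e: "e \<in> edges G" "ends G e \<inter> ?X \<noteq> {}" "ends G e \<inter> (verts G - ?X) \<noteq> {}"
        by (auto simp: edge_cut_def)
      then obtain a b where ab: "a \<in> ends G e" "a \<in> ?X" "b \<in> ends G e" "b \<in> verts G - ?X" by blast
      then have "a \<noteq> b" by blast
      then have "ends G e = {a, b}" using loopless_ends_eq[OF l e(1)] ab by blast
      then have "(a, b) \<in> adj_rel G" using e by (auto simp: adj_rel_def)
      then show False using ab by (auto dest: rtrancl_into_rtrancl)
    qed
    then have "?X = verts G" using conn3_cut[OF G, of ?X] that(1) by fastforce
    then show ?thesis using that(2) by blast
  qed
  moreover have "3 \<le> card (edge_cut G X)" if "X \<subseteq> verts G" "odd (card X)" for X
  proof -
    have "odd (card (edge_cut G X))" using degree_sum[OF c that(1)] that(2) by presburger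
    moreover have "X \<noteq> {}" "X \<noteq> verts G" using that(2) cubic_even_verts[OF c] by auto
    then have "2 \<le> card (edge_cut G X)" using conn3_cut[OF G that(1)] by simp
    ultimately show ?thesis by presburger
  qed
  ultimately show "connected_graph G \<and> three_graph G"
    using G by (auto simp: connected_graph_def three_graph_def conn3_def)
next
  assume G: "connected_graph G \<and> three_graph G"
  then have c: "cubic G" by (simp add: three_graph_def)
  note l = cubic_loopless[OF c]
  have "2 \<le> card (edge_cut G X)" if X: "X \<subseteq> verts G" "X \<noteq> {}" "X \<noteq> verts G" for X
  proof (cases "even (card X)")
    case False
    have "X \<subseteq> verts G \<longrightarrow> odd (card X) \<longrightarrow> 3 \<le> card (edge_cut G X)" using G by (simp add: three_graph_def)
    then show ?thesis using False X(1) by simp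
  next
    case True
    then have "even (card (edge_cut G X))" using degree_sum[OF c X(1)] by presburger
    moreover have "edge_cut G X \<noteq> {}"
    proof
      assume "edge_cut G X = {}"
      moreover obtain u w where "u \<in> X" "w \<in> verts G" "w \<notin> X" using X by blast
      moreover have "(u, w) \<in> (adj_rel G)\<^sup>*" using G X calculation by (auto simp: connected_graph_def)
      ultimately show False using adj_rel_closed[OF l, of u w X] by blast
    qed
    then have "card (edge_cut G X) \<noteq> 0" using l by simp
    ultimately show ?thesis by presburger
  qed
  moreover have "verts G \<noteq> {}" using G by (simp add: connected_graph_def)
  ultimately show "conn3 G" using c by (simp add: conn3_def)
qed

text \<open>What can be reached from one end of a bridge \<open>e\<close> after its deletion has no
  edge but \<open>e\<close> in its cut.\<close>

lemma conn3_bridgeless: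
  assumes G: "conn3 G"
  shows "bridgeless G"
proof -
  note l = conn3_loopless[OF G]
  have False if b: "bridge G e" for e
  proof -
    let ?R = "(adj_rel (delete_edge G e))\<^sup>*"
    obtain u v where uv: "e \<in> edges G" "u \<in> ends G e" "v \<in> ends G e" "(u, v) \<notin> ?R"
      using b by (auto simp: bridge_def)
    let ?X = "{w \<in> verts G. (u, w) \<in> ?R}"
    have V: "u \<in> verts G" "v \<in> verts G" using uv l by (auto simp: loopless_graph_def)
    have "edge_cut G ?X \<subseteq> {e}"
    proof
      fix f assume f: "f \<in> edge_cut G ?X"
      then obtain a b where ab: "a \<in> ends G f" "a \<in> ?X" "b \<in> ends G f" "b \<in> verts G - ?X" "f \<in> edges G"
        by (auto simp: edge_cut_def)
      then have "a \<noteq> b" by blast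
      then have fe: "ends G f = {a, b}" using loopless_ends_eq[OF l ab(5)] ab by blast
      show "f \<in> {e}"
      proof (rule ccontr)
        assume "f \<notin> {e}"
        then have "(a, b) \<in> adj_rel (delete_edge G e)"
          using fe ab by (auto simp: adj_rel_def delete_edge_def)
        then show False using ab by (auto dest: rtrancl_into_rtrancl)
      qed
    qed
    then have "card (edge_cut G ?X) \<le> 1" using card_mono[of "{e}"] by fastforce
    moreover have "2 \<le> card (edge_cut G ?X)" using conn3_cut[OF G, of ?X] V uv(4) by auto
    ultimately show False by simp
  qed
  then show ?thesis by (auto simp: bridgeless_def)
qed

section \<open>Isomorphism and composition of colorings\<close>

lemma bij_betw_preimage:
  assumes "bij_betw g A B" "d \<in> B"
  obtains e where "e \<in> A" "d = g e"
  using assms by (metis bij_betw_imp_surj_on imageE)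

lemma isomorphicI:
  assumes "bij_betw f (verts G) (verts H)" "bij_betw g (edges G) (edges H)"
    "\<And>e. e \<in> edges G \<Longrightarrow> ends H (g e) = f ` ends G e"
  shows "isomorphic G H"
  unfolding isomorphic_def using assms by (intro exI[of _ f] exI[of _ g]) simp

lemma isomorphic_refl: "isomorphic G G"
  by (rule isomorphicI[of id _ _ id]) auto

lemma isomorphic_sym:
  assumes G: "loopless_graph G" and i: "isomorphic G H"
  shows "isomorphic H G"
proof -
  obtain f g where f: "bij_betw f (verts G) (verts H)" and g: "bij_betw g (edges G) (edges H)"
    and e: "\<forall>e\<in>edges G. ends H (g e) = f ` ends G e" using i by (auto simp: isomorphic_def)
  let ?f = "inv_into (verts G) f" and ?g = "inv_into (edges G) g"
  have "ends G (?g d) = ?f ` ends H d" if "d \<in> edges H" for d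
  proof -
    have gd: "?g d \<in> edges G" "g (?g d) = d"
      using g that by (auto simp: bij_betw_def inv_into_into f_inv_into_f)
    then have "ends G (?g d) \<subseteq> verts G" using G by (auto simp: loopless_graph_def)
    moreover have "ends H d = f ` ends G (?g d)" using e gd by metis
    ultimately show ?thesis using f by (auto simp: bij_betw_def inv_into_image_cancel)
  qed
  with bij_betw_inv_into[OF f] bij_betw_inv_into[OF g] show ?thesis by (rule isomorphicI)
qed

lemma isomorphic_trans:
  assumes "isomorphic G H" "isomorphic H K"
  shows "isomorphic G K"
proof -
  obtain f g where fg: "bij_betw f (verts G) (verts H)" "bij_betw g (edges G) (edges H)"
    "\<forall>e\<in>edges G. ends H (g e) = f ` ends G e" using assms(1) by (auto simp: isomorphic_def)
  obtain f' g' where fg': "bij_betw f' (verts H) (verts K)" "bij_betw g' (edges H) (edges K)"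
    "\<forall>e\<in>edges H. ends K (g' e) = f' ` ends H e" using assms(2) by (auto simp: isomorphic_def)
  have "ends K ((g' \<circ> g) e) = (f' \<circ> f) ` ends G e" if e: "e \<in> edges G" for e
  proof -
    have "g e \<in> edges H" using fg(2) e by (auto simp: bij_betw_def)
    then have "ends K (g' (g e)) = f' ` ends H (g e)" using fg'(3) by blast
    then show ?thesis using fg(3) e by (simp add: image_comp)
  qed
  with bij_betw_trans[OF fg(1) fg'(1)] bij_betw_trans[OF fg(2) fg'(2)] show ?thesis
    by (rule isomorphicI)
qed

lemma isomorphic_card:
  "isomorphic G H \<Longrightarrow> card (verts G) = card (verts H)"
  by (auto simp: isomorphic_def dest: bij_betw_same_card)

lemma iso_incident:
  assumes "loopless_graph G" "bij_betw f (verts G) (verts H)" "bij_betw g (edges G) (edges H)"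
    "\<forall>e\<in>edges G. ends H (g e) = f ` ends G e" "v \<in> verts G"
  shows "incident_edges H (f v) = g ` incident_edges G v"
proof -
  have *: "f v \<in> ends H (g e) \<longleftrightarrow> v \<in> ends G e" if e: "e \<in> edges G" for e
  proof -
    have "ends G e \<subseteq> verts G" using assms(1) e by (simp add: loopless_graph_def)
    then have "f v \<in> f ` ends G e \<longleftrightarrow> v \<in> ends G e"
      using assms(2,5) inj_on_image_mem_iff[of f "verts G" v "ends G e"] by (simp add: bij_betw_def)
    then show ?thesis using assms(4) e by simp
  qed
  have "edges H = g ` edges G" using assms(3) by (simp add: bij_betw_def)
  then show ?thesis using * unfolding incident_edges_def by auto
qed

lemma iso_bij_incident:
  assumes "loopless_graph G" "bij_betw f (verts G) (verts H)" "bij_betw g (edges G) (edges H)"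
    "\<forall>e\<in>edges G. ends H (g e) = f ` ends G e" "v \<in> verts G"
  shows "bij_betw g (incident_edges G v) (incident_edges H (f v))"
  unfolding iso_incident[OF assms]
  using assms(3) by (auto simp: bij_betw_def incident_edges_def intro: inj_on_subset)

lemma isomorphic_colors:
  assumes "loopless_graph G" "isomorphic G H"
  shows "colors H G"
proof -
  obtain f g where fg: "bij_betw f (verts G) (verts H)" "bij_betw g (edges G) (edges H)"
    "\<forall>e\<in>edges G. ends H (g e) = f ` ends G e" using assms(2) by (auto simp: isomorphic_def)
  then have "H_coloring H G g" unfolding H_coloring_def
    using iso_bij_incident[OF assms(1) fg] by (auto simp: bij_betw_def)
  then show ?thesis by (auto simp: colors_def)
qed

lemma isomorphic_loopless:
  assumes G: "loopless_graph G" and i: "isomorphic G H"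
  shows "loopless_graph H"
proof -
  obtain f g where fg: "bij_betw f (verts G) (verts H)" "bij_betw g (edges G) (edges H)"
    "\<forall>e\<in>edges G. ends H (g e) = f ` ends G e" using i by (auto simp: isomorphic_def)
  have "ends H d \<subseteq> verts H \<and> card (ends H d) = 2" if d: "d \<in> edges H" for d
  proof -
    obtain e where e: "e \<in> edges G" "d = g e" by (rule bij_betw_preimage[OF fg(2) d])
    have sub: "ends G e \<subseteq> verts G" "card (ends G e) = 2" using G e by (auto simp: loopless_graph_def)
    then have "inj_on f (ends G e)" using fg(1) by (auto simp: bij_betw_def intro: inj_on_subset)
    moreover have "f ` ends G e \<subseteq> verts H" using fg(1) sub(1) unfolding bij_betw_def by blast
    ultimately show ?thesis using e fg(3) sub(2) by (simp add: card_image)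
  qed
  moreover have "finite (verts H)" "finite (edges H)"
    using bij_betw_finite[OF fg(1)] bij_betw_finite[OF fg(2)] loopless_finite[OF G] by auto
  ultimately show ?thesis by (simp add: loopless_graph_def)
qed

lemma isomorphic_conn3:
  assumes G: "conn3 G" and i: "isomorphic G H"
  shows "conn3 H"
proof -
  note l = conn3_loopless[OF G]
  obtain f g where fg: "bij_betw f (verts G) (verts H)" "bij_betw g (edges G) (edges H)"
    "\<forall>e\<in>edges G. ends H (g e) = f ` ends G e" using i by (auto simp: isomorphic_def)
  have lH: "loopless_graph H" using isomorphic_loopless[OF l i] .
  have "card (incident_edges H w) = 3" if w: "w \<in> verts H" for w
  proof -
    obtain v where v: "v \<in> verts G" "w = f v" by (rule bij_betw_preimage[OF fg(1) w])
    then show ?thesis using bij_betw_same_card[OF iso_bij_incident[OF l fg v(1)]] G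
      by (simp add: conn3_def cubic_def)
  qed
  then have cH: "cubic H" using lH by (simp add: cubic_def)
  have "2 \<le> card (edge_cut H Y)" if Y: "Y \<subseteq> verts H" "Y \<noteq> {}" "Y \<noteq> verts H" for Y
  proof -
    let ?X = "{v \<in> verts G. f v \<in> Y}"
    have YX: "Y = f ` ?X" using fg(1) Y(1) by (auto simp: bij_betw_def)
    have "g ` edge_cut G ?X \<subseteq> edge_cut H Y"
    proof
      fix d assume "d \<in> g ` edge_cut G ?X"
      then obtain e where e: "e \<in> edge_cut G ?X" "d = g e" by blast
      then show "d \<in> edge_cut H Y"
        using fg unfolding edge_cut_def bij_betw_def by blast
    qed
    moreover have "inj_on g (edge_cut G ?X)"
      using fg(2) by (auto simp: bij_betw_def edge_cut_def intro: inj_on_subset)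
    ultimately have "card (edge_cut G ?X) \<le> card (edge_cut H Y)"
      using lH by (metis card_image card_mono finite_edge_cut)
    moreover have "?X \<noteq> {}" "?X \<noteq> verts G" using YX Y fg(1) by (auto simp: bij_betw_def)
    then have "2 \<le> card (edge_cut G ?X)" using conn3_cut[OF G, of ?X] by auto
    ultimately show ?thesis by simp
  qed
  moreover have "verts H \<noteq> {}" using fg(1) G by (auto simp: conn3_def bij_betw_def)
  ultimately show ?thesis using cH by (simp add: conn3_def)
qed

lemma isomorphic_simple:
  assumes G: "simple_graph G" and i: "isomorphic G H"
  shows "simple_graph H"
proof -
  have l: "loopless_graph G" using G by (simp add: simple_graph_def)
  obtain f g where fg: "bij_betw f (verts G) (verts H)" "bij_betw g (edges G) (edges H)"
    "\<forall>e\<in>edges G. ends H (g e) = f ` ends G e" using i by (auto simp: isomorphic_def)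
  have "inj_on (ends H) (edges H)"
  proof (rule inj_onI)
    fix c d assume cd: "c \<in> edges H" "d \<in> edges H" "ends H c = ends H d"
    obtain a where a: "a \<in> edges G" "c = g a" by (rule bij_betw_preimage[OF fg(2) cd(1)])
    obtain b where b: "b \<in> edges G" "d = g b" by (rule bij_betw_preimage[OF fg(2) cd(2)])
    note ab = a(1) b(1) a(2) b(2)
    then have "f ` ends G a = f ` ends G b" using cd fg(3) by auto
    moreover have "ends G a \<subseteq> verts G" "ends G b \<subseteq> verts G" using l ab by (auto simp: loopless_graph_def)
    ultimately have "ends G a = ends G b" using fg(1) by (metis bij_betw_def inj_on_image_eq_iff)
    then show "c = d" using G ab by (auto simp: simple_graph_def inj_on_def)
  qed
  then show ?thesis using isomorphic_loopless[OF l i] by (simp add: simple_graph_def)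
qed

lemma nat_graph_exists:
  assumes "loopless_graph G"
  shows "\<exists>H :: nat_graph. isomorphic G H"
proof -
  obtain f :: "'a \<Rightarrow> nat" where f: "inj_on f (verts G)"
    using assms finite_imp_inj_to_nat_seg loopless_finite(1) by metis
  obtain g :: "'b \<Rightarrow> nat" where g: "inj_on g (edges G)"
    using assms finite_imp_inj_to_nat_seg loopless_finite(2) by metis
  let ?H = "\<lparr>verts = f ` verts G, edges = g ` edges G, ends = \<lambda>d. f ` ends G (inv_into (edges G) g d)\<rparr>"
  have "isomorphic G ?H"
    by (rule isomorphicI[of f _ _ g]) (use f g in \<open>auto simp: bij_betw_def\<close>)
  then show ?thesis by blast
qed

lemma colors_trans:
  assumes "colors K H" "colors H G"
  shows "colors K G"
proof -
  obtain \<phi> \<psi> where a: "H_coloring K H \<phi>" "H_coloring H G \<psi>" using assms by (auto simp: colors_def)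
  have "H_coloring K G (\<phi> \<circ> \<psi>)" unfolding H_coloring_def
  proof (intro conjI ballI)
    show "(\<phi> \<circ> \<psi>) ` edges G \<subseteq> edges K" using a unfolding H_coloring_def image_comp[symmetric] by blast
    fix v assume "v \<in> verts G"
    then obtain u where u: "u \<in> verts H" "bij_betw \<psi> (incident_edges G v) (incident_edges H u)"
      using a by (auto simp: H_coloring_def)
    then obtain w where "w \<in> verts K" "bij_betw \<phi> (incident_edges H u) (incident_edges K w)"
      using a by (auto simp: H_coloring_def)
    then show "\<exists>w\<in>verts K. bij_betw (\<phi> \<circ> \<psi>) (incident_edges G v) (incident_edges K w)"
      using u bij_betw_trans by blast
  qed
  then show ?thesis by (auto simp: colors_def)
qed

section \<open>Three-edge-colourability, and colourings with an explicit vertex map\<close>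

definition class1 :: "('v, 'e) mgraph \<Rightarrow> bool" where
  "class1 G \<longleftrightarrow> (\<exists>c :: 'e \<Rightarrow> nat. \<forall>v\<in>verts G. bij_betw c (incident_edges G v) {0, 1, 2})"

text \<open>\<open>H_coloring\<close> only asserts that an image vertex exists. Here the choice
  \<open>f\<close> is kept as data, because the arguments below count its fibres.\<close>

definition vcol :: "('w, 'f) mgraph \<Rightarrow> ('v, 'e) mgraph \<Rightarrow> ('e \<Rightarrow> 'f) \<Rightarrow> ('v \<Rightarrow> 'w) \<Rightarrow> bool" where
  "vcol H G \<phi> f \<longleftrightarrow> (\<forall>v\<in>verts G. f v \<in> verts H \<and> bij_betw \<phi> (incident_edges G v) (incident_edges H (f v)))"

lemma vcol_edge:
  assumes "vcol H G \<phi> f" "v \<in> verts G" "e \<in> edges G" "v \<in> ends G e"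
  shows "\<phi> e \<in> edges H" "f v \<in> ends H (\<phi> e)"
proof -
  have "e \<in> incident_edges G v" using assms by (simp add: incident_edges_def)
  then have "\<phi> e \<in> incident_edges H (f v)" using assms by (auto simp: vcol_def bij_betw_def)
  then show "\<phi> e \<in> edges H" "f v \<in> ends H (\<phi> e)" by (auto simp: incident_edges_def)
qed

lemma colors_iff_vcol:
  assumes "loopless_graph G"
  shows "colors H G \<longleftrightarrow> (\<exists>\<phi> f. vcol H G \<phi> f)"
proof
  assume "colors H G"
  then obtain \<phi> where p: "H_coloring H G \<phi>" unfolding colors_def by blast
  have "\<forall>v\<in>verts G. \<exists>u. u \<in> verts H \<and> bij_betw \<phi> (incident_edges G v) (incident_edges H u)"
    using p unfolding H_coloring_def by blast
  from bchoice[OF this] show "\<exists>\<phi> f. vcol H G \<phi> f" unfolding vcol_def by blast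
next
  assume "\<exists>\<phi> f. vcol H G \<phi> f"
  then obtain \<phi> f where c: "vcol H G \<phi> f" by blast
  have "\<phi> e \<in> edges H" if e: "e \<in> edges G" for e
    using loopless_ends[OF assms e] vcol_edge[OF c _ e] by (metis insertI1)
  then have "H_coloring H G \<phi>" using c unfolding H_coloring_def vcol_def by blast
  then show "colors H G" by (auto simp: colors_def)
qed

text \<open>All vertices go to one vertex of \<open>K\<close>, and the three colours become the
  three edges of its star.\<close>

lemma class1_colors:
  assumes G: "loopless_graph G" "class1 G" and K: "cubic K" "verts K \<noteq> {}"
  shows "colors K G"
proof -
  obtain w where w: "w \<in> verts K" using K by blast
  then have "card (incident_edges K w) = card {0, 1, 2 :: nat}" using K by (simp add: cubic_def)
  then obtain h where h: "bij_betw h {0, 1, 2 :: nat} (incident_edges K w)"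
    by (metis finite_same_card_bij card_gt_0_iff finite.emptyI finite.insertI K(1) cubic_loopless finite_incident)
  obtain c where c: "\<forall>v\<in>verts G. bij_betw c (incident_edges G v) {0, 1, 2 :: nat}"
    using G by (auto simp: class1_def)
  have "bij_betw (h \<circ> c) (incident_edges G v) (incident_edges K w)" if "v \<in> verts G" for v
    using bij_betw_trans[OF _ h] c that by blast
  then have "vcol K G (h \<circ> c) (\<lambda>_. w)" using w unfolding vcol_def by blast
  then show ?thesis using colors_iff_vcol[OF G(1)] by blast
qed

lemma colors_class1:
  assumes "colors K G" "class1 K"
  shows "class1 G"
proof -
  obtain \<phi> where p: "H_coloring K G \<phi>" using assms(1) by (auto simp: colors_def)
  obtain c where "\<forall>v\<in>verts K. bij_betw c (incident_edges K v) {0, 1, 2 :: nat}"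
    using assms(2) by (auto simp: class1_def)
  note c = this
  have "bij_betw (c \<circ> \<phi>) (incident_edges G v) {0, 1, 2 :: nat}" if v: "v \<in> verts G" for v
  proof -
    obtain u where u: "u \<in> verts K" "bij_betw \<phi> (incident_edges G v) (incident_edges K u)"
      using p v unfolding H_coloring_def by blast
    then show ?thesis using bij_betw_trans[OF u(2)] c by blast
  qed
  then show ?thesis unfolding class1_def by blast
qed

section \<open>Preimages of cuts\<close>

text \<open>Both sides count the pairs of a vertex \<open>v\<close> of \<open>X\<close> and an edge
  of colour \<open>d\<close> at \<open>v\<close>: there is exactly one such edge if
  \<open>f v\<close> is an end of \<open>d\<close>, and none otherwise.\<close>

lemma vcol_count:
  assumes H: "loopless_graph H" and G: "loopless_graph G" and c: "vcol H G \<phi> f"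
    and X: "X \<subseteq> verts G" and d: "d \<in> edges H"
  shows "(\<Sum>w\<in>ends H d. card {v \<in> X. f v = w}) =
    2 * card {e \<in> inner_edges G X. \<phi> e = d} + card {e \<in> edge_cut G X. \<phi> e = d}"
proof -
  have fX: "finite X" using X G finite_subset loopless_finite by blast
  have fd: "finite (ends H d)" using loopless_ends[OF H d] by (metis finite.simps)
  have one: "card {e \<in> incident_edges G v. \<phi> e = d} = of_bool (f v \<in> ends H d)" if "v \<in> X" for v
  proof -
    have b: "bij_betw \<phi> (incident_edges G v) (incident_edges H (f v))" using c X that by (auto simp: vcol_def)
    show ?thesis
    proof (cases "f v \<in> ends H d")
      case True
      have "d \<in> incident_edges H (f v)" using True d by (simp add: incident_edges_def)
      obtain e where e: "e \<in> incident_edges G v" "\<phi> e = d"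
        using bij_betw_preimage[OF b \<open>d \<in> incident_edges H (f v)\<close>] by metis
      then have "{e \<in> incident_edges G v. \<phi> e = d} = {e}" using b by (auto simp: bij_betw_def inj_on_def)
      then show ?thesis unfolding \<open>{e \<in> incident_edges G v. \<phi> e = d} = {e}\<close> using True by simp
    next
      case False
      then have "d \<notin> incident_edges H (f v)" by (simp add: incident_edges_def)
      then have "{e \<in> incident_edges G v. \<phi> e = d} = {}" using b by (auto simp: bij_betw_def)
      then show ?thesis unfolding \<open>{e \<in> incident_edges G v. \<phi> e = d} = {}\<close> using False by simp
    qed
  qed
  have "(\<Sum>w\<in>ends H d. card {v \<in> X. f v = w}) = (\<Sum>w\<in>ends H d. \<Sum>v\<in>X. of_bool (f v = w))"
    using fX by (simp add: Int_def)
  also have "\<dots> = (\<Sum>v\<in>X. \<Sum>w\<in>ends H d. of_bool (f v = w))" by (rule sum.swap)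
  also have "\<dots> = (\<Sum>v\<in>X. of_bool (f v \<in> ends H d))"
    by (rule sum.cong) (use fd in \<open>auto simp: if_distrib sum.delta of_bool_def\<close>)
  also have "\<dots> = (\<Sum>v\<in>X. card {e \<in> incident_edges G v. \<phi> e = d})" using one by simp
  finally show ?thesis using handshake[OF G X, of "\<lambda>e. \<phi> e = d"] by simp
qed

definition odd_set :: "('w, 'f) mgraph \<Rightarrow> ('v \<Rightarrow> 'w) \<Rightarrow> 'v set \<Rightarrow> 'w set" where
  "odd_set H f X = {w \<in> verts H. odd (card {v \<in> X. f v = w})}"

text \<open>This is \<open>vcol_count\<close> modulo 2: the inner edges drop out, and an odd total
  means that exactly one end of \<open>d\<close> has an odd fibre. A small cut of \<open>G\<close>
  thus yields a cut of \<open>H\<close> that is no larger.\<close>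

lemma odd_set_cut:
  assumes H: "loopless_graph H" and G: "loopless_graph G" and c: "vcol H G \<phi> f"
    and X: "X \<subseteq> verts G" and d: "d \<in> edges H"
  shows "d \<in> edge_cut H (odd_set H f X) \<longleftrightarrow> odd (card {e \<in> edge_cut G X. \<phi> e = d})"
proof -
  obtain u v where uv: "ends H d = {u, v}" "u \<noteq> v" "u \<in> verts H" "v \<in> verts H"
    using loopless_ends[OF H d] by metis
  have "odd (card {e \<in> edge_cut G X. \<phi> e = d}) \<longleftrightarrow> odd (card {x \<in> X. f x = u} + card {x \<in> X. f x = v})"
    using vcol_count[OF assms] uv by simp
  also have "\<dots> \<longleftrightarrow> (u \<in> odd_set H f X) \<noteq> (v \<in> odd_set H f X)"
    using uv by (auto simp: odd_set_def)
  also have "\<dots> \<longleftrightarrow> d \<in> edge_cut H (odd_set H f X)"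
    using uv d by (auto simp: edge_cut_def)
  finally show ?thesis by simp
qed

section \<open>Deleting vertices and merging edges\<close>

text \<open>The vertices outside \<open>W\<close> are deleted and every remaining edge \<open>e\<close> is renamed to
  \<open>\<rho> e\<close>. Two edges that lose one end each and get the same name are thereby merged.\<close>

definition reduct :: "('v, 'e) mgraph \<Rightarrow> 'v set \<Rightarrow> ('e \<Rightarrow> 'e) \<Rightarrow> ('v, 'e) mgraph" where
  "reduct K W \<rho> = \<lparr>verts = W, edges = \<rho> ` {e \<in> edges K. ends K e \<inter> W \<noteq> {}},
     ends = \<lambda>e. W \<inter> \<Union> (ends K ` {d \<in> edges K. \<rho> d = e})\<rparr>"

lemma reduct_verts [simp]: "verts (reduct K W \<rho>) = W"
  by (simp add: reduct_def)

lemma reduct_ends: "ends (reduct K W \<rho>) e = W \<inter> \<Union> (ends K ` {d \<in> edges K. \<rho> d = e})"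
  by (simp add: reduct_def)

lemma reduct_edges: "edges (reduct K W \<rho>) = \<rho> ` {e \<in> edges K. ends K e \<inter> W \<noteq> {}}"
  by (simp add: reduct_def)

lemma reduct_incident:
  assumes "w \<in> W"
  shows "incident_edges (reduct K W \<rho>) w = \<rho> ` incident_edges K w"
proof
  show "incident_edges (reduct K W \<rho>) w \<subseteq> \<rho> ` incident_edges K w"
  proof
    fix e assume "e \<in> incident_edges (reduct K W \<rho>) w"
    then obtain d where "d \<in> edges K" "\<rho> d = e" "w \<in> ends K d"
      by (auto simp: incident_edges_def reduct_ends)
    then show "e \<in> \<rho> ` incident_edges K w" by (auto simp: incident_edges_def)
  qed
  show "\<rho> ` incident_edges K w \<subseteq> incident_edges (reduct K W \<rho>) w"
    using assms by (auto simp: incident_edges_def reduct_edges reduct_ends)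
qed

lemma reduct_cubic:
  assumes K: "cubic K" and W: "W \<subseteq> verts K"
    and inj: "\<And>w. w \<in> W \<Longrightarrow> inj_on \<rho> (incident_edges K w)"
    and two: "\<And>e. e \<in> edges K \<Longrightarrow> ends K e \<inter> W \<noteq> {} \<Longrightarrow> card (ends (reduct K W \<rho>) (\<rho> e)) = 2"
  shows "cubic (reduct K W \<rho>)"
proof -
  note l = loopless_finite[OF cubic_loopless[OF K]]
  have "finite W" using W l finite_subset by blast
  then have "loopless_graph (reduct K W \<rho>)"
    using two l by (auto simp: loopless_graph_def reduct_edges reduct_ends)
  moreover have "card (incident_edges (reduct K W \<rho>) w) = 3" if "w \<in> W" for w
    using that W K inj by (auto simp: reduct_incident card_image cubic_def)
  ultimately show ?thesis by (simp add: cubic_def)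
qed

lemma reduct_vcol:
  assumes c: "vcol K H \<phi> f" and f: "f ` verts H \<subseteq> W"
    and inj: "\<And>w. w \<in> W \<Longrightarrow> inj_on \<rho> (incident_edges K w)"
  shows "vcol (reduct K W \<rho>) H (\<rho> \<circ> \<phi>) f"
  unfolding vcol_def
proof (intro ballI conjI)
  fix v assume v: "v \<in> verts H"
  then have fv: "f v \<in> W" using f by blast
  then show "f v \<in> verts (reduct K W \<rho>)" by simp
  have "bij_betw \<phi> (incident_edges H v) (incident_edges K (f v))" using c v by (simp add: vcol_def)
  moreover have "bij_betw \<rho> (incident_edges K (f v)) (incident_edges (reduct K W \<rho>) (f v))"
    unfolding bij_betw_def reduct_incident[OF fv] using inj[OF fv] by simp
  ultimately show "bij_betw (\<rho> \<circ> \<phi>) (incident_edges H v) (incident_edges (reduct K W \<rho>) (f v))"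
    by (rule bij_betw_trans)
qed

lemma reduct_cutI:
  assumes e: "e \<in> edges K" "d \<in> edges K" "\<rho> d = \<rho> e" and Y: "Y \<subseteq> W"
    and x: "x \<in> ends K e" "x \<in> Y" and y: "y \<in> ends K d" "y \<in> W" "y \<notin> Y"
  shows "\<rho> e \<in> edge_cut (reduct K W \<rho>) Y"
  using assms unfolding edge_cut_def reduct_edges reduct_ends by auto

text \<open>Cuts of a reduct are bounded by lifting the side \<open>Y\<close> to a side
  \<open>Z\<close> of \<open>K\<close> whose cut survives the renaming without collapsing.\<close>

lemma reduct_cut_ge:
  assumes K: "conn3 K" and W: "W \<subseteq> verts K" and Z: "Z \<subseteq> verts K" "Z \<noteq> {}" "Z \<noteq> verts K"
    and inj: "inj_on \<rho> (edge_cut K Z)"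
    and sub: "\<And>e. e \<in> edge_cut K Z \<Longrightarrow> \<rho> e \<in> edge_cut (reduct K W \<rho>) Y"
  shows "2 \<le> card (edge_cut (reduct K W \<rho>) Y)"
proof -
  have "finite (edge_cut (reduct K W \<rho>) Y)"
    using loopless_finite[OF conn3_loopless[OF K]] by (auto simp: edge_cut_def reduct_edges)
  then have "card (\<rho> ` edge_cut K Z) \<le> card (edge_cut (reduct K W \<rho>) Y)"
    using sub by (intro card_mono) auto
  then show ?thesis using conn3_cut[OF K Z] card_image[OF inj] by simp
qed

lemma edge_cutE:
  assumes "loopless_graph G" "X \<subseteq> verts G" "e \<in> edge_cut G X"
  obtains x y where "e \<in> edges G" "ends G e = {x, y}" "x \<in> X" "y \<in> verts G" "y \<notin> X"
proof -
  obtain x y where xy: "x \<in> ends G e" "x \<in> X" "y \<in> ends G e" "y \<in> verts G" "y \<notin> X" "e \<in> edges G"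
    using assms(3) unfolding edge_cut_def by blast
  moreover have "x \<noteq> y" using xy by blast
  ultimately show ?thesis using that loopless_ends_eq[OF assms(1)] by blast
qed

lemma edge_cutI:
  assumes "e \<in> edges G" "x \<in> ends G e" "x \<in> X" "y \<in> ends G e" "y \<in> verts G" "y \<notin> X"
  shows "e \<in> edge_cut G X"
  using assms unfolding edge_cut_def by blast

definition merge :: "'e \<Rightarrow> 'e \<Rightarrow> 'e \<Rightarrow> 'e" where
  "merge c d = (\<lambda>e. if e = d then c else e)"

lemma inj_on_merge: "\<not> (c \<in> S \<and> d \<in> S) \<Longrightarrow> inj_on (merge c d) S"
  by (auto simp: merge_def inj_on_def)

section \<open>Closing one side of a 2-edge-cut\<close>

locale two_cut =
  fixes K :: "('v, 'e) mgraph" and W :: "'v set" and c d :: 'e and x y s t :: 'v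
  assumes K: "conn3 K" and W: "W \<subseteq> verts K" and cut: "edge_cut K W = {c, d}" and cd: "c \<noteq> d"
    and c: "ends K c = {x, s}" "x \<in> W" "s \<in> verts K" "s \<notin> W"
    and d: "ends K d = {y, t}" "y \<in> W" "t \<in> verts K" "t \<notin> W"
begin

abbreviation "R \<equiv> reduct K W (merge c d)"

lemma cE: "c \<in> edges K" and dE: "d \<in> edges K"
  using cut by (auto simp: edge_cut_def)

lemma other_edges:
  assumes "e \<in> edges K" "e \<noteq> c" "e \<noteq> d" "ends K e \<inter> W \<noteq> {}"
  shows "ends K e \<subseteq> W"
proof -
  have "e \<notin> edge_cut K W" using assms cut by auto
  then show ?thesis using assms conn3_loopless[OF K] unfolding edge_cut_def loopless_graph_def by blast
qed

text \<open>Merging creates no loop: if both cut edges met at \<open>x\<close>, moving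
  \<open>x\<close> to the other side would leave only its third edge in the cut, and for
  \<open>W = {x}\<close> the cut would have three edges.\<close>

lemma xy: "x \<noteq> y"
proof
  assume eq: "x = y"
  let ?X = "(verts K - W) \<union> {x}"
  have l: "loopless_graph K" using conn3_loopless[OF K] .
  have xV: "x \<in> verts K" using c W by blast
  have sub: "edge_cut K ?X \<subseteq> incident_edges K x - {c, d}"
  proof
    fix e assume e: "e \<in> edge_cut K ?X"
    obtain p q where pq: "e \<in> edges K" "ends K e = {p, q}" "p \<in> ?X" "q \<in> verts K" "q \<notin> ?X"
      using edge_cutE[OF l _ e] xV by blast
    then have q: "q \<in> W" "q \<noteq> x" by auto
    have ecd: "e \<noteq> c" "e \<noteq> d" using pq q c d eq by (auto simp: doubleton_eq_iff)
    then have "ends K e \<subseteq> W" using other_edges[OF pq(1)] pq(2) q by auto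
    then have "p = x" using pq by auto
    then show "e \<in> incident_edges K x - {c, d}" using pq ecd by (simp add: incident_edges_def)
  qed
  have inc: "{c, d} \<subseteq> incident_edges K x" using c d eq cE dE by (auto simp: incident_edges_def)
  have "card (incident_edges K x) = 3" using K xV by (simp add: conn3_def cubic_def)
  then have "card (incident_edges K x - {c, d}) = 1" using inc cd l by (simp add: card_Diff_subset)
  then have le: "card (edge_cut K ?X) \<le> 1" using sub l by (metis card_mono finite_Diff finite_incident)
  have "?X = verts K"
  proof (rule ccontr)
    assume "?X \<noteq> verts K"
    then have "2 \<le> card (edge_cut K ?X)" using conn3_cut[OF K, of ?X] xV by auto
    then show False using le by simp
  qed
  then have "W \<subseteq> {x}" using W by blast
  then have "W = {x}" using c by blast
  then have "edge_cut K W = incident_edges K x" using edge_cut_single[OF l xV] by simp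
  then have "card (incident_edges K x) = card {c, d}" using cut by simp
  then show False using cd \<open>card (incident_edges K x) = 3\<close> by simp
qed

lemma inj_inc: "w \<in> W \<Longrightarrow> inj_on (merge c d) (incident_edges K w)"
  by (rule inj_on_merge) (use c d xy in \<open>auto simp: incident_edges_def\<close>)

lemma R_ends:
  assumes "e \<in> edges K" "ends K e \<inter> W \<noteq> {}"
  shows "ends R (merge c d e) = (if e = c \<or> e = d then {x, y} else ends K e)"
proof (cases "e = c \<or> e = d")
  case True
  then have "{f \<in> edges K. merge c d f = merge c d e} = {c, d}"
    using cE dE cd by (auto simp: merge_def)
  then have "ends R (merge c d e) = W \<inter> (ends K c \<union> ends K d)" unfolding reduct_ends by simp
  then show ?thesis using True c d by auto
next
  case False
  then have "{f \<in> edges K. merge c d f = merge c d e} = {e}"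
    using assms by (auto simp: merge_def)
  then have "ends R (merge c d e) = W \<inter> ends K e" unfolding reduct_ends by simp
  then show ?thesis using False other_edges[OF assms(1)] assms(2) by auto
qed

lemma conn3_R: "conn3 R"
proof -
  have l: "loopless_graph K" using conn3_loopless[OF K] .
  have "cubic R"
  proof (rule reduct_cubic[OF conn3_cubic[OF K] W inj_inc])
    fix e assume e: "e \<in> edges K" "ends K e \<inter> W \<noteq> {}"
    then show "card (ends R (merge c d e)) = 2"
      using R_ends[OF e] xy l by (auto simp: loopless_graph_def)
  qed
  moreover have "2 \<le> card (edge_cut R Y)" if Y: "Y \<subseteq> W" "Y \<noteq> {}" "Y \<noteq> W" for Y
  proof -
    \<comment> \<open>When both ends of the merged edge lie in \<open>Y\<close>, the deleted side is
      added, and then neither \<open>c\<close> nor \<open>d\<close> crosses. Otherwise at most one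
      of them does.\<close>
    let ?Z = "if x \<in> Y \<and> y \<in> Y then Y \<union> (verts K - W) else Y"
    have ZV: "?Z \<subseteq> verts K" using Y W by auto
    have notboth: "\<not> (c \<in> edge_cut K ?Z \<and> d \<in> edge_cut K ?Z)"
      using c d Y by (auto simp: edge_cut_def)
    show ?thesis
    proof (rule reduct_cut_ge[OF K W ZV])
      show "?Z \<noteq> {}" "?Z \<noteq> verts K" using Y W by auto
      show "inj_on (merge c d) (edge_cut K ?Z)" by (rule inj_on_merge[OF notboth])
      fix e assume e: "e \<in> edge_cut K ?Z"
      obtain p q where pq: "e \<in> edges K" "ends K e = {p, q}" "p \<in> ?Z" "q \<in> verts K" "q \<notin> ?Z"
        using edge_cutE[OF l ZV e] by blast
      show "merge c d e \<in> edge_cut R Y"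
      proof (cases "e = c \<or> e = d")
        case True
        then have "(x \<in> Y) \<noteq> (y \<in> Y)" using pq c d Y by (auto simp: doubleton_eq_iff split: if_splits)
        then show ?thesis
          using True cE dE c d cd
            reduct_cutI[of c K d "merge c d" Y W x y] reduct_cutI[of d K c "merge c d" Y W y x] Y(1)
          by (auto simp: merge_def)
      next
        case False
        have "ends K e \<inter> W \<noteq> {}" using pq Y by (auto split: if_splits)
        then have "ends K e \<subseteq> W" using other_edges pq(1) False by blast
        then have "p \<in> Y" "q \<in> W" "q \<notin> Y" using pq by (auto split: if_splits)
        then show ?thesis using reduct_cutI[of e K e "merge c d" Y W p q] pq Y(1) by auto
      qed
    qed
  qed
  moreover have "W \<noteq> {}" using c by blast
  ultimately show ?thesis by (simp add: conn3_def)
qed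

end

lemma two_cutI:
  assumes K: "conn3 K" and W: "W \<subseteq> verts K" and cut: "edge_cut K W = {c, d}" and cd: "c \<noteq> d"
  obtains x y s t where "two_cut K W c d x y s t" "two_cut K (verts K - W) c d s t x y"
proof -
  have l: "loopless_graph K" using conn3_loopless[OF K] .
  obtain x s where xs: "ends K c = {x, s}" "x \<in> W" "s \<in> verts K" "s \<notin> W"
    using edge_cutE[OF l W, of c] cut by (metis insertI1)
  obtain y t where yt: "ends K d = {y, t}" "y \<in> W" "t \<in> verts K" "t \<notin> W"
    using edge_cutE[OF l W, of d] cut by (metis insertI1 insertI2)
  have "two_cut K W c d x y s t" using assms xs yt by unfold_locales
  moreover have "two_cut K (verts K - W) c d s t x y"
    using assms xs yt edge_cut_compl[OF W] by unfold_locales auto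
  ultimately show ?thesis using that by blast
qed

lemma bij_betw_eqI:
  assumes "bij_betw f A B" "\<And>a. a \<in> A \<Longrightarrow> f a = g a"
  shows "bij_betw g A B"
  using assms bij_betw_cong[of A f g B] by simp

lemma cubic_star_enum:
  assumes "cubic K" "w \<in> verts K"
  obtains g where "bij_betw g {0, 1, 2 :: nat} (incident_edges K w)"
proof -
  have "card (incident_edges K w) = card {0, 1, 2 :: nat}" using assms by (simp add: cubic_def)
  then show ?thesis using that finite_same_card_bij[of "{0, 1, 2 :: nat}" "incident_edges K w"]
    finite_incident[OF cubic_loopless[OF assms(1)]] by auto
qed

text \<open>The class 1 side is sent to the star of an end of the merged edge.\<close>

lemma two_cut_colors:
  assumes K: "conn3 K" and W: "W \<subseteq> verts K" and cut: "edge_cut K W = {c, d}" and cd: "c \<noteq> d"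
    and one: "class1 (reduct K W (merge c d))"
  shows "colors (reduct K (verts K - W) (merge c d)) K"
proof -
  let ?r = "merge c d"
  let ?B = "reduct K (verts K - W) ?r"
  obtain x y s t where A: "two_cut K W c d x y s t" and B: "two_cut K (verts K - W) c d s t x y"
    using two_cutI[OF K W cut cd] .
  interpret A: two_cut K W c d x y s t by (fact A)
  interpret B: two_cut K "verts K - W" c d s t x y by (fact B)
  obtain col where col: "\<And>v. v \<in> W \<Longrightarrow> bij_betw col (incident_edges A.R v) {0, 1, 2 :: nat}"
    using one by (auto simp: class1_def)
  have cx: "c \<in> incident_edges K x" "c \<in> incident_edges K s"
    using A.cE A.c by (auto simp: incident_edges_def)
  have rc: "?r c = c" by (simp add: merge_def)
  have sV: "s \<in> verts K - W" using B.c by simp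
  obtain g where g: "bij_betw g {0, 1, 2 :: nat} (incident_edges ?B s)"
    using cubic_star_enum[OF conn3_cubic[OF B.conn3_R]] sV by auto
  have cB: "c \<in> incident_edges ?B s" using reduct_incident[OF sV, of K ?r] cx rc by force
  have "c \<in> incident_edges A.R x" using reduct_incident[OF A.c(2), of K ?r] cx rc by force
  then have cc: "col c \<in> {0, 1, 2}" by (rule bij_betw_apply[OF col[OF A.c(2)]])
  obtain k where k: "k \<in> {0, 1, 2}" "c = g k" by (rule bij_betw_preimage[OF g cB])
  \<comment> \<open>The colour of the merged edge is exchanged with \<open>k\<close> before
    \<open>g\<close> is applied, so that its image is the edge \<open>c\<close> itself and the two
    halves of the colouring agree on the cut.\<close>
  let ?h = "g \<circ> (\<lambda>i. if i = col c then k else if i = k then col c else i)"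
  have "bij_betw (\<lambda>i. if i = col c then k else if i = k then col c else i) {0, 1, 2} {0, 1, 2 :: nat}"
    using k(1) cc by (auto simp: bij_betw_def inj_on_def)
  then have h: "bij_betw ?h {0, 1, 2} (incident_edges ?B s)" using g by (rule bij_betw_trans)
  have hc: "?h (col c) = c" using k by simp
  let ?p = "\<lambda>e. if ends K e \<subseteq> W then ?h (col e) else ?r e"
  have "vcol ?B K ?p (\<lambda>v. if v \<in> W then s else v)"
    unfolding vcol_def
  proof (intro ballI)
    fix v assume v: "v \<in> verts K"
    show "(if v \<in> W then s else v) \<in> verts ?B \<and>
      bij_betw ?p (incident_edges K v) (incident_edges ?B (if v \<in> W then s else v))"
    proof (cases "v \<in> W")
      case True
      have "bij_betw ?r (incident_edges K v) (incident_edges A.R v)"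
        unfolding bij_betw_def reduct_incident[OF True] using A.inj_inc[OF True] by simp
      from bij_betw_trans[OF bij_betw_trans[OF this col[OF True]] h]
      have b: "bij_betw (?h \<circ> (col \<circ> ?r)) (incident_edges K v) (incident_edges ?B s)" .
      have eq: "(?h \<circ> (col \<circ> ?r)) e = ?p e" if e: "e \<in> incident_edges K v" for e
      proof (cases "e = c \<or> e = d")
        case True
        then have "\<not> ends K e \<subseteq> W" using A.c A.d by auto
        then show ?thesis using True hc by (auto simp: merge_def)
      next
        case False
        have "e \<in> edges K" "ends K e \<inter> W \<noteq> {}" using e \<open>v \<in> W\<close> by (auto simp: incident_edges_def)
        then have "ends K e \<subseteq> W" using A.other_edges False by blast
        then show ?thesis using False by (simp add: merge_def)
      qed
      have "bij_betw ?p (incident_edges K v) (incident_edges ?B s)"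
        by (rule bij_betw_eqI[OF b eq])
      then show ?thesis using True sV by simp
    next
      case False
      then have vB: "v \<in> verts K - W" using v by simp
      have "bij_betw ?r (incident_edges K v) (incident_edges ?B v)"
        unfolding bij_betw_def reduct_incident[OF vB] using B.inj_inc[OF vB] by simp
      moreover have "?r e = ?p e" if "e \<in> incident_edges K v" for e
        using that False by (auto simp: incident_edges_def)
      ultimately have "bij_betw ?p (incident_edges K v) (incident_edges ?B v)"
        by (rule bij_betw_eqI)
      then show ?thesis using False vB by simp
    qed
  qed
  then show ?thesis using colors_iff_vcol[OF conn3_loopless[OF K]] by blast
qed

section \<open>Splitting off two adjacent vertices\<close>

lemma card_le_1_unique:
  assumes "card S \<le> 1" "finite S" "a \<in> S" "b \<in> S"
  shows "a = b"
  using assms by (metis card_le_Suc0_iff_eq One_nat_def)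

text \<open>The two ends of the edge \<open>g\<close> are deleted, and their remaining edges \<open>a1, a2\<close> and
  \<open>b1, b2\<close> are merged in the two pairs \<open>a1, b1\<close> and \<open>a2, b2\<close>.\<close>

locale split_edge =
  fixes K :: "('v, 'e) mgraph" and g a1 a2 b1 b2 :: 'e and u v x1 x2 y1 y2 :: 'v
  assumes K: "conn3 K" and uv: "u \<in> verts K" "v \<in> verts K" "u \<noteq> v"
    and incu: "incident_edges K u = {g, a1, a2}" and incv: "incident_edges K v = {g, b1, b2}"
    and dist: "distinct [g, a1, a2, b1, b2]"
    and ends: "ends K g = {u, v}" "ends K a1 = {u, x1}" "ends K a2 = {u, x2}"
      "ends K b1 = {v, y1}" "ends K b2 = {v, y2}"
    and W: "x1 \<in> verts K - {u, v}" "x2 \<in> verts K - {u, v}" "y1 \<in> verts K - {u, v}" "y2 \<in> verts K - {u, v}"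
begin

abbreviation "W \<equiv> verts K - {u, v}"
definition "\<rho> = (\<lambda>e. if e = b1 then a1 else if e = b2 then a2 else e)"
abbreviation "R \<equiv> reduct K W \<rho>"
text \<open>The part of the cut of \<open>Y\<close> that avoids the edges at \<open>u\<close> and
  \<open>v\<close>; it does not depend on the pairing, which allows two pairings to be
  compared.\<close>

definition "I Y = {e \<in> edges K. ends K e \<subseteq> W \<and> ends K e \<inter> Y \<noteq> {} \<and> ends K e \<inter> (W - Y) \<noteq> {}}"

lemma l: "loopless_graph K" using conn3_loopless[OF K] .

lemma E: "g \<in> edges K" "a1 \<in> edges K" "a2 \<in> edges K" "b1 \<in> edges K" "b2 \<in> edges K"
proof -
  have "{g, a1, a2} \<subseteq> edges K" "{g, b1, b2} \<subseteq> edges K"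
    unfolding incu[symmetric] incv[symmetric] by (auto simp: incident_edges_def)
  then show "g \<in> edges K" "a1 \<in> edges K" "a2 \<in> edges K" "b1 \<in> edges K" "b2 \<in> edges K" by auto
qed

lemma finite_I: "finite (I Y)"
  using loopless_finite[OF l] by (simp add: I_def)

lemma I_compl: "Y \<subseteq> W \<Longrightarrow> I (W - Y) = I Y"
  unfolding I_def by (auto simp: double_diff)

lemma edge_cases:
  assumes "e \<in> edges K"
  shows "e \<in> {g, a1, a2, b1, b2} \<or> ends K e \<subseteq> W"
proof (cases "u \<in> ends K e \<or> v \<in> ends K e")
  case True
  then have "e \<in> incident_edges K u \<or> e \<in> incident_edges K v" using assms by (simp add: incident_edges_def)
  then show ?thesis using incu incv by auto
next
  case False
  moreover have "ends K e \<subseteq> verts K" using l assms by (simp add: loopless_graph_def)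
  ultimately show ?thesis by auto
qed

lemma cut_K:
  assumes Y: "Y \<subseteq> W"
  shows "edge_cut K Y = I Y \<union> ((if x1 \<in> Y then {a1} else {}) \<union> (if x2 \<in> Y then {a2} else {})
    \<union> (if y1 \<in> Y then {b1} else {}) \<union> (if y2 \<in> Y then {b2} else {}))" (is "_ = I Y \<union> ?B")
proof (rule set_eqI)
  fix e
  show "e \<in> edge_cut K Y \<longleftrightarrow> e \<in> I Y \<union> ?B"
  proof (cases "e \<in> edges K")
    case True
    from edge_cases[OF True] show ?thesis
    proof
      assume e: "e \<in> {g, a1, a2, b1, b2}"
      have uvY: "u \<notin> Y" "v \<notin> Y" using Y by auto
      have cut: "d \<in> edge_cut K Y \<longleftrightarrow> q \<in> Y" if "d \<in> edges K" "ends K d = {p, q}" "p \<in> verts K" "p \<notin> Y" for d p q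
        using that Y by (auto simp: edge_cut_def)
      have "g \<notin> edge_cut K Y" "a1 \<in> edge_cut K Y \<longleftrightarrow> x1 \<in> Y" "a2 \<in> edge_cut K Y \<longleftrightarrow> x2 \<in> Y"
        "b1 \<in> edge_cut K Y \<longleftrightarrow> y1 \<in> Y" "b2 \<in> edge_cut K Y \<longleftrightarrow> y2 \<in> Y"
        using cut E ends uv(1,2) uvY by blast+
      moreover have "u \<in> ends K e \<or> v \<in> ends K e" using e ends by (elim insertE) simp_all
      then have "e \<notin> I Y" by (auto simp: I_def)
      moreover have "e \<in> ?B \<longleftrightarrow> (e = a1 \<and> x1 \<in> Y) \<or> (e = a2 \<and> x2 \<in> Y) \<or> (e = b1 \<and> y1 \<in> Y) \<or> (e = b2 \<and> y2 \<in> Y)"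
        by simp
      moreover have "g \<noteq> a1" "g \<noteq> a2" "g \<noteq> b1" "g \<noteq> b2" "a1 \<noteq> a2" "a1 \<noteq> b1" "a1 \<noteq> b2"
        "a2 \<noteq> b1" "a2 \<noteq> b2" "b1 \<noteq> b2" using dist by auto
      ultimately show ?thesis using e unfolding Un_iff by (elim insertE) blast+
    next
      assume eW: "ends K e \<subseteq> W"
      then have "e \<notin> {g, a1, a2, b1, b2}" using ends by auto
      then have "e \<notin> ?B" by auto
      moreover have "e \<in> edge_cut K Y \<longleftrightarrow> e \<in> I Y" using eW Y unfolding edge_cut_def I_def by blast
      ultimately show ?thesis by blast
    qed
  next
    case False
    then show ?thesis using E by (auto simp: edge_cut_def I_def)
  qed
qed

lemma card_cut_K:
  assumes "Y \<subseteq> W"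
  shows "card (edge_cut K Y) = card (I Y) + of_bool (x1 \<in> Y) + of_bool (x2 \<in> Y) + of_bool (y1 \<in> Y) + of_bool (y2 \<in> Y)"
proof -
  have "a1 \<notin> I Y" "a2 \<notin> I Y" "b1 \<notin> I Y" "b2 \<notin> I Y" by (simp_all add: I_def ends)
  then show ?thesis unfolding cut_K[OF assms] using dist finite_I[of Y] by auto
qed

lemma cut_ge:
  assumes "Y \<subseteq> W" "Y \<noteq> {}" "Y \<noteq> W"
  shows "2 \<le> card (I Y) + of_bool (x1 \<in> Y) + of_bool (x2 \<in> Y) + of_bool (y1 \<in> Y) + of_bool (y2 \<in> Y)"
    "2 \<le> card (I Y) + of_bool (x1 \<notin> Y) + of_bool (x2 \<notin> Y) + of_bool (y1 \<notin> Y) + of_bool (y2 \<notin> Y)"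
proof -
  have "2 \<le> card (edge_cut K Y)" using conn3_cut[OF K, of Y] assms by blast
  then show "2 \<le> card (I Y) + of_bool (x1 \<in> Y) + of_bool (x2 \<in> Y) + of_bool (y1 \<in> Y) + of_bool (y2 \<in> Y)"
    using card_cut_K[OF assms(1)] by simp
  have "2 \<le> card (edge_cut K (W - Y))" using conn3_cut[OF K, of "W - Y"] assms uv by blast
  then show "2 \<le> card (I Y) + of_bool (x1 \<notin> Y) + of_bool (x2 \<notin> Y) + of_bool (y1 \<notin> Y) + of_bool (y2 \<notin> Y)"
    using card_cut_K[of "W - Y"] I_compl[OF assms(1)] W by simp
qed

lemma single:
  assumes z: "z \<in> W"
  shows "card (I {z}) + of_bool (x1 = z) + of_bool (x2 = z) + of_bool (y1 = z) + of_bool (y2 = z) = 3"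
proof -
  have "card (edge_cut K {z}) = 3" using edge_cut_single[OF l, of z] z K by (simp add: conn3_def cubic_def)
  then show ?thesis using card_cut_K[of "{z}"] z by simp
qed

lemma single_ne_W:
  assumes z: "z \<in> W"
  shows "W \<noteq> {z}"
proof
  assume "W = {z}"
  then have "verts K = {u, v, z}" using uv by auto
  then have "card (verts K) = 3" using uv z by auto
  then show False using cubic_even_verts[OF conn3_cubic[OF K]] by simp
qed

lemma rho_fiber:
  assumes "e \<in> edges K"
  shows "{d \<in> edges K. \<rho> d = \<rho> e} = (if e \<in> {a1, b1} then {a1, b1} else if e \<in> {a2, b2} then {a2, b2} else {e})"
  using assms dist E by (auto simp: \<rho>_def split: if_splits)

lemma R_ends:
  assumes e: "e \<in> edges K" "ends K e \<inter> W \<noteq> {}"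
  shows "ends R (\<rho> e) = (if e \<in> {a1, b1} then {x1, y1} else if e \<in> {a2, b2} then {x2, y2} else ends K e)"
proof -
  have *: "ends R (\<rho> e) = W \<inter> \<Union> (ends K ` {d \<in> edges K. \<rho> d = \<rho> e})" by (simp add: reduct_ends)
  consider "e \<in> {a1, b1}" | "e \<notin> {a1, b1}" "e \<in> {a2, b2}" | "e \<notin> {a1, b1}" "e \<notin> {a2, b2}" by blast
  then show ?thesis
  proof cases
    case 1
    then have "ends R (\<rho> e) = W \<inter> (ends K a1 \<union> ends K b1)" unfolding * rho_fiber[OF e(1)] by auto
    also have "\<dots> = {x1, y1}" using ends W by auto
    finally show ?thesis using 1 by simp
  next
    case 2
    then have "ends R (\<rho> e) = W \<inter> (ends K a2 \<union> ends K b2)" unfolding * rho_fiber[OF e(1)] by auto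
    also have "\<dots> = {x2, y2}" using ends W by auto
    finally show ?thesis using 2 by simp
  next
    case 3
    then have "ends R (\<rho> e) = W \<inter> ends K e" unfolding * rho_fiber[OF e(1)] by auto
    moreover have "e \<noteq> g" using e(2) ends by auto
    ultimately show ?thesis using 3 edge_cases[OF e(1)] by auto
  qed
qed

lemma inj_inc:
  assumes "x1 \<noteq> y1" "x2 \<noteq> y2" "w \<in> W"
  shows "inj_on \<rho> (incident_edges K w)"
  using assms dist ends W by (auto simp: inj_on_def \<rho>_def incident_edges_def split: if_splits)

lemma R_cut:
  assumes Y: "Y \<subseteq> W" and xy: "x1 \<noteq> y1" "x2 \<noteq> y2"
  shows "card (I Y) + of_bool ((x1 \<in> Y) \<noteq> (y1 \<in> Y)) + of_bool ((x2 \<in> Y) \<noteq> (y2 \<in> Y)) \<le> card (edge_cut R Y)"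
proof -
  have fin: "finite (edge_cut R Y)"
    using loopless_finite[OF l] by (auto simp: edge_cut_def reduct_edges)
  have sub: "I Y \<union> ((if (x1 \<in> Y) \<noteq> (y1 \<in> Y) then {a1} else {}) \<union> (if (x2 \<in> Y) \<noteq> (y2 \<in> Y) then {a2} else {}))
    \<subseteq> edge_cut R Y" (is "_ \<union> (?A \<union> ?B) \<subseteq> _")
  proof -
    have mem: "\<rho> e \<in> edges R" if "e \<in> edges K" "ends K e \<inter> W \<noteq> {}" for e
      using that by (auto simp: reduct_edges)
    have "e \<in> edge_cut R Y" if e: "e \<in> I Y" for e
    proof -
      have ee: "e \<in> edges K" "ends K e \<inter> W \<noteq> {}" "e \<notin> {a1, b1, a2, b2}" using e ends by (auto simp: I_def)
      then have "\<rho> e = e" by (simp add: \<rho>_def)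
      then show ?thesis using R_ends[OF ee(1,2)] mem[OF ee(1,2)] ee(3) e by (auto simp: edge_cut_def I_def)
    qed
    moreover have "a1 \<in> edge_cut R Y" if "(x1 \<in> Y) \<noteq> (y1 \<in> Y)"
    proof -
      have "ends K a1 \<inter> W \<noteq> {}" using ends W by auto
      moreover have "\<rho> a1 = a1" using dist by (auto simp: \<rho>_def)
      ultimately show ?thesis using R_ends[OF E(2)] mem[OF E(2)] that W by (auto simp: edge_cut_def)
    qed
    moreover have "a2 \<in> edge_cut R Y" if "(x2 \<in> Y) \<noteq> (y2 \<in> Y)"
    proof -
      have "ends K a2 \<inter> W \<noteq> {}" using ends W by auto
      moreover have "\<rho> a2 = a2" using dist by (auto simp: \<rho>_def)
      ultimately show ?thesis using R_ends[OF E(3)] mem[OF E(3)] dist that W by (auto simp: edge_cut_def)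
    qed
    ultimately show ?thesis by (auto split: if_splits)
  qed
  have "a1 \<notin> I Y" "a2 \<notin> I Y" by (simp_all add: I_def ends)
  then have "card (I Y \<union> (?A \<union> ?B)) = card (I Y) + of_bool ((x1 \<in> Y) \<noteq> (y1 \<in> Y)) + of_bool ((x2 \<in> Y) \<noteq> (y2 \<in> Y))"
    using finite_I[of Y] dist by auto
  then show ?thesis using card_mono[OF fin sub] by simp
qed

text \<open>A loop is witnessed by its vertex or, for the second merged edge, by the complement of
  its vertex. Otherwise a cut of \<open>R\<close> has at most one edge, while in \<open>K\<close>
  both \<open>Y\<close> and its complement in \<open>W\<close> have cuts of at least two edges; this
  is possible only if the two merged edges lie on different sides.\<close>

lemma bad_set:
  assumes bad: "\<not> (x1 \<noteq> y1 \<and> x2 \<noteq> y2 \<and> conn3 R)"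
  shows "\<exists>Y\<subseteq>W. x1 \<in> Y \<and> y1 \<in> Y \<and> x2 \<notin> Y \<and> y2 \<notin> Y \<and> card (I Y) \<le> 1"
proof (cases "x1 = y1")
  case True
  have s: "card (I {x1}) + 2 + of_bool (x2 = x1) + of_bool (y2 = x1) = 3"
    using single[OF W(1)] True by simp
  have "2 \<le> card (I {x1}) + of_bool (x2 \<noteq> x1) + of_bool (y2 \<noteq> x1)"
    using cut_ge(2)[of "{x1}"] W(1) single_ne_W[OF W(1)] True by auto
  then have "x2 \<noteq> x1" "y2 \<noteq> x1" using s by (auto simp: of_bool_def split: if_splits)
  then show ?thesis using True W(1) s by (intro exI[of _ "{x1}"]) auto
next
  case n1: False
  show ?thesis
  proof (cases "x2 = y2")
    case True
    have s: "card (I {x2}) + 2 + of_bool (x1 = x2) + of_bool (y1 = x2) = 3"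
      using single[OF W(2)] True by simp
    have "2 \<le> card (I {x2}) + of_bool (x1 \<noteq> x2) + of_bool (y1 \<noteq> x2)"
      using cut_ge(2)[of "{x2}"] W(2) single_ne_W[OF W(2)] True by auto
    then have "x1 \<noteq> x2" "y1 \<noteq> x2" using s by (auto simp: of_bool_def split: if_splits)
    moreover have "I (W - {x2}) = I {x2}" using I_compl[of "{x2}"] W(2) by simp
    ultimately show ?thesis using True W s by (intro exI[of _ "W - {x2}"]) auto
  next
    case n2: False
    have "cubic R"
    proof (rule reduct_cubic[OF conn3_cubic[OF K]])
      show "W \<subseteq> verts K" by auto
      show "\<And>w. w \<in> W \<Longrightarrow> inj_on \<rho> (incident_edges K w)" using inj_inc n1 n2 by blast
      fix e assume e: "e \<in> edges K" "ends K e \<inter> W \<noteq> {}"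
      show "card (ends R (\<rho> e)) = 2"
        using R_ends[OF e] n1 n2 l e(1) by (auto simp: loopless_graph_def)
    qed
    moreover have "verts R \<noteq> {}" using W(1) by auto
    moreover have "\<not> conn3 R" using bad n1 n2 by blast
    ultimately obtain Y where Y: "Y \<subseteq> W" "Y \<noteq> {}" "Y \<noteq> W" "\<not> 2 \<le> card (edge_cut R Y)"
      unfolding conn3_def reduct_verts by blast
    have le: "card (I Y) + of_bool ((x1 \<in> Y) \<noteq> (y1 \<in> Y)) + of_bool ((x2 \<in> Y) \<noteq> (y2 \<in> Y)) \<le> 1"
      using R_cut[OF Y(1) n1 n2] Y(4) by simp
    note ge = cut_ge[OF Y(1-3)]
    show ?thesis
    proof (cases "x1 \<in> Y")
      case True
      then have "y1 \<in> Y" "x2 \<notin> Y" "y2 \<notin> Y" "card (I Y) \<le> 1"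
        using le ge by (auto simp: of_bool_def split: if_splits)
      then show ?thesis using True Y(1) by blast
    next
      case False
      then have "y1 \<notin> Y" "x2 \<in> Y" "y2 \<in> Y" "card (I Y) \<le> 1"
        using le ge by (auto simp: of_bool_def split: if_splits)
      then show ?thesis using False Y(1) W I_compl[OF Y(1)] by (intro exI[of _ "W - Y"]) auto
    qed
  qed
qed

lemma I_ends:
  assumes "e \<in> I Y" "z \<in> ends K e"
  obtains z' where "ends K e = {z, z'}" "z \<in> W" "z' \<in> W" "z \<in> Y \<longleftrightarrow> z' \<notin> Y"
proof -
  obtain p q where pq: "p \<in> ends K e" "p \<in> Y" "q \<in> ends K e" "q \<in> W - Y" "e \<in> edges K" "ends K e \<subseteq> W"
    using assms(1) unfolding I_def by blast
  then have "p \<noteq> q" by blast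
  then have "ends K e = {p, q}" using loopless_ends_eq[OF l] pq by blast
  then show ?thesis using that[of q] that[of p] assms(2) pq by auto
qed

lemma I_mem:
  assumes "e \<in> edges K" "ends K e = {z, z'}" "z \<in> W" "z' \<in> W"
  shows "e \<in> I Y \<longleftrightarrow> (z \<in> Y \<longleftrightarrow> z' \<notin> Y)"
  using assms by (auto simp: I_def)

end

text \<open>At most one of the pairings of the four edges is bad: a bad set of each pairing would give four
  corners that can be joined to each other by at most two edges.\<close>

lemma split_edge_good:
  assumes s: "split_edge K g a1 a2 b1 b2 u v x1 x2 y1 y2"
    and t: "split_edge K g a1 a2 b2 b1 u v x1 x2 y2 y1"
  shows "(x1 \<noteq> y1 \<and> x2 \<noteq> y2 \<and> conn3 (reduct K (verts K - {u, v}) (split_edge.\<rho> a1 a2 b1 b2))) \<or>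
    (x1 \<noteq> y2 \<and> x2 \<noteq> y1 \<and> conn3 (reduct K (verts K - {u, v}) (split_edge.\<rho> a1 a2 b2 b1)))"
proof (rule ccontr)
  assume neg: "\<not> ?thesis"
  interpret S: split_edge K g a1 a2 b1 b2 u v x1 x2 y1 y2 by (fact s)
  interpret T: split_edge K g a1 a2 b2 b1 u v x1 x2 y2 y1 by (fact t)
  obtain Y where Y: "Y \<subseteq> S.W" "x1 \<in> Y" "y1 \<in> Y" "x2 \<notin> Y" "y2 \<notin> Y" "card (S.I Y) \<le> 1"
    using S.bad_set neg by blast
  obtain Z where Z: "Z \<subseteq> S.W" "x1 \<in> Z" "y2 \<in> Z" "x2 \<notin> Z" "y1 \<notin> Z" "card (S.I Z) \<le> 1"
    using T.bad_set neg by blast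
  have uY: "a = b" if "a \<in> S.I Y" "b \<in> S.I Y" for a b
    using card_le_1_unique[OF Y(6) S.finite_I that] .
  have uZ: "a = b" if "a \<in> S.I Z" "b \<in> S.I Z" for a b
    using card_le_1_unique[OF Z(6) S.finite_I that] .
  \<comment> \<open>Exactly one edge of the cut of \<open>Q\<close> leads to \<open>u\<close> or
    \<open>v\<close>, so \<open>cut_ge\<close> demands another one inside \<open>W\<close>.\<close>
  have corner: "\<exists>e z z'. e \<in> edges K \<and> ends K e = {z, z'} \<and> z \<in> Q \<and> z' \<notin> Q \<and> z \<in> S.W \<and> z' \<in> S.W"
    if Q: "Q \<subseteq> S.W" "of_bool (x1 \<in> Q) + of_bool (x2 \<in> Q) + of_bool (y1 \<in> Q) + of_bool (y2 \<in> Q) = (1::nat)" for Q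
  proof -
    have "Q \<noteq> {}" "Q \<noteq> S.W" using Q(2) S.W by auto
    then have "2 \<le> card (S.I Q) + 1" using S.cut_ge(1)[OF Q(1)] Q(2) by linarith
    then obtain e where "e \<in> S.I Q" by (metis One_nat_def Suc_1 add_le_cancel_right card.empty ex_in_conv not_one_le_zero one_add_one)
    then obtain z where "e \<in> edges K" "z \<in> ends K e" "z \<in> Q" "e \<in> S.I Q" by (auto simp: S.I_def)
    then show ?thesis using S.I_ends[OF \<open>e \<in> S.I Q\<close> \<open>z \<in> ends K e\<close>] by metis
  qed
  \<comment> \<open>The corners \<open>Y \<inter> Z\<close>, \<open>Y - Z\<close>,
    \<open>Z - Y\<close> and the outside contain \<open>x1\<close>, \<open>y1\<close>,
    \<open>y2\<close> and \<open>x2\<close>, respectively.\<close>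
  have Q1: "Y \<inter> Z \<subseteq> S.W" using Y(1) Z(1) by blast
  have s1: "of_bool (x1 \<in> Y \<inter> Z) + of_bool (x2 \<in> Y \<inter> Z) + of_bool (y1 \<in> Y \<inter> Z) + of_bool (y2 \<in> Y \<inter> Z) = (1::nat)"
    using Y(2-5) Z(2-5) S.W by simp
  obtain e1 p1 q1 where e1: "e1 \<in> edges K" "ends K e1 = {p1, q1}" "p1 \<in> Y \<inter> Z" "q1 \<notin> Y \<inter> Z" "p1 \<in> S.W" "q1 \<in> S.W"
    using corner[OF Q1 s1] by (elim exE conjE)
  have Q2: "Y - Z \<subseteq> S.W" using Y(1) Z(1) by blast
  have s2: "of_bool (x1 \<in> Y - Z) + of_bool (x2 \<in> Y - Z) + of_bool (y1 \<in> Y - Z) + of_bool (y2 \<in> Y - Z) = (1::nat)"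
    using Y(2-5) Z(2-5) S.W by simp
  obtain e2 p2 q2 where e2: "e2 \<in> edges K" "ends K e2 = {p2, q2}" "p2 \<in> Y - Z" "q2 \<notin> Y - Z" "p2 \<in> S.W" "q2 \<in> S.W"
    using corner[OF Q2 s2] by (elim exE conjE)
  have Q3: "Z - Y \<subseteq> S.W" using Y(1) Z(1) by blast
  have s3: "of_bool (x1 \<in> Z - Y) + of_bool (x2 \<in> Z - Y) + of_bool (y1 \<in> Z - Y) + of_bool (y2 \<in> Z - Y) = (1::nat)"
    using Y(2-5) Z(2-5) S.W by simp
  obtain e3 p3 q3 where e3: "e3 \<in> edges K" "ends K e3 = {p3, q3}" "p3 \<in> Z - Y" "q3 \<notin> Z - Y" "p3 \<in> S.W" "q3 \<in> S.W"
    using corner[OF Q3 s3] by (elim exE conjE)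
  have Q4: "S.W - (Y \<union> Z) \<subseteq> S.W" using Y(1) Z(1) by blast
  have s4: "of_bool (x1 \<in> S.W - (Y \<union> Z)) + of_bool (x2 \<in> S.W - (Y \<union> Z)) + of_bool (y1 \<in> S.W - (Y \<union> Z)) + of_bool (y2 \<in> S.W - (Y \<union> Z)) = (1::nat)"
    using Y(2-5) Z(2-5) S.W by simp
  obtain e4 p4 q4 where e4: "e4 \<in> edges K" "ends K e4 = {p4, q4}" "p4 \<in> S.W - (Y \<union> Z)" "q4 \<notin> S.W - (Y \<union> Z)" "p4 \<in> S.W" "q4 \<in> S.W"
    using corner[OF Q4 s4] by (elim exE conjE)
  note m = S.I_mem[OF e1(1,2,5,6)] S.I_mem[OF e2(1,2,5,6)] S.I_mem[OF e3(1,2,5,6)] S.I_mem[OF e4(1,2,5,6)]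
  have some: "e1 \<in> S.I Y \<or> e1 \<in> S.I Z" "e2 \<in> S.I Y \<or> e2 \<in> S.I Z"
    "e3 \<in> S.I Y \<or> e3 \<in> S.I Z" "e4 \<in> S.I Y \<or> e4 \<in> S.I Z"
    using m e1 e2 e3 e4 by blast+
  have q: "q = p'" if "{p, q} = {p', q'}" "p \<noteq> p'" for p q p' q' :: 'v
    using that by (auto simp: doubleton_eq_iff)
  \<comment> \<open>An edge shared by two neighbouring corners crosses only one of \<open>Y\<close>
    and \<open>Z\<close>, and one shared by opposite corners crosses both. As \<open>I Y\<close> and
    \<open>I Z\<close> have at most one edge each, no arrangement serves all four corners.\<close>
  have n12: "e1 \<notin> S.I Y" if "e1 = e2"
  proof -
    have "q1 = p2" using q[of p1 q1 p2 q2] e1(2,3) e2(2,3) that by auto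
    then show ?thesis using m(1) e1(3) e2(3) by simp
  qed
  have n34: "e3 \<notin> S.I Y" if "e3 = e4"
  proof -
    have "q3 = p4" using q[of p3 q3 p4 q4] e3(2,3) e4(2,3) that by auto
    then show ?thesis using m(3) e3(3) e4(3) by simp
  qed
  have n13: "e1 \<notin> S.I Z" if "e1 = e3"
  proof -
    have "q1 = p3" using q[of p1 q1 p3 q3] e1(2,3) e3(2,3) that by auto
    then show ?thesis using m(2) m e1(3) e3(3) by simp
  qed
  have n24: "e2 \<notin> S.I Z" if "e2 = e4"
  proof -
    have "q2 = p4" using q[of p2 q2 p4 q4] e2(2,3) e4(2,3) that by auto
    then show ?thesis using m e2(3) e4(3) by simp
  qed
  have n14: "e1 \<in> S.I Y" "e1 \<in> S.I Z" if "e1 = e4"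
  proof -
    have "q1 = p4" using q[of p1 q1 p4 q4] e1(2,3) e4(2,3) that by auto
    then show "e1 \<in> S.I Y" "e1 \<in> S.I Z" using m e1(3) e4(3) by simp_all
  qed
  show False using some n12 n34 n13 n24 n14 uY uZ by metis
qed

section \<open>Colorings of graphs of class 2\<close>

lemma edge_splits:
  assumes s: "loopless_graph K" "cubic K" "u \<in> verts K" "g \<in> edges K" "ends K g = {u, v}"
  obtains a1 a2 x1 x2 where "incident_edges K u = {g, a1, a2}" "g \<noteq> a1" "g \<noteq> a2" "a1 \<noteq> a2"
    "ends K a1 = {u, x1}" "ends K a2 = {u, x2}" "x1 \<in> verts K" "x2 \<in> verts K" "x1 \<noteq> u" "x2 \<noteq> u"
proof -
  have g: "g \<in> incident_edges K u" using s by (simp add: incident_edges_def)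
  have "card (incident_edges K u - {g}) = 2" using s g by (simp add: cubic_def)
  then obtain a1 a2 where a: "incident_edges K u - {g} = {a1, a2}" "a1 \<noteq> a2" by (metis card_2_iff)
  then have inc: "incident_edges K u = {g, a1, a2}" and ne: "g \<noteq> a1" "g \<noteq> a2" using g by auto
  have other: "\<exists>x. ends K a = {u, x} \<and> x \<in> verts K \<and> x \<noteq> u" if "a \<in> incident_edges K u" for a
  proof -
    have a: "a \<in> edges K" "u \<in> ends K a" using that by (auto simp: incident_edges_def)
    obtain p q where "ends K a = {p, q}" "p \<noteq> q" "p \<in> verts K" "q \<in> verts K"
      by (rule loopless_ends[OF s(1) a(1)])
    then show ?thesis using a(2) by (auto simp: insert_commute)
  qed
  obtain x1 where x1: "ends K a1 = {u, x1}" "x1 \<in> verts K" "x1 \<noteq> u" using other[of a1] inc by auto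
  obtain x2 where x2: "ends K a2 = {u, x2}" "x2 \<in> verts K" "x2 \<noteq> u" using other[of a2] inc by auto
  show ?thesis using that[OF inc ne a(2) x1(1) x2(1) x1(2) x2(2) x1(3) x2(3)] .
qed

text \<open>No vertex of \<open>H\<close> is mapped to \<open>u\<close> or \<open>v\<close>, so
  every star in use survives up to renaming, and \<open>f\<close> itself remains the vertex
  map.\<close>

lemma delete_adjacent:
  fixes K :: "('w, 'f) mgraph"
  assumes K: "conn3 K" and g: "g \<in> edges K" "ends K g = {u, v}"
    and c: "vcol K H \<phi> f" and f: "f ` verts H \<subseteq> verts K - {u, v}" and H: "verts H \<noteq> {}"
  shows "\<exists>(K' :: ('w, 'f) mgraph) \<psi>. conn3 K' \<and> vcol K' H \<psi> f \<and> verts K' = verts K - {u, v}"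
proof -
  have l: "loopless_graph K" using conn3_loopless[OF K] .
  note cub = conn3_cubic[OF K]
  have uv: "u \<in> verts K" "v \<in> verts K" "u \<noteq> v"
    using l g by (auto simp: loopless_graph_def)
  obtain a1 a2 x1 x2 where a: "incident_edges K u = {g, a1, a2}" "g \<noteq> a1" "g \<noteq> a2" "a1 \<noteq> a2"
    "ends K a1 = {u, x1}" "ends K a2 = {u, x2}" "x1 \<in> verts K" "x2 \<in> verts K" "x1 \<noteq> u" "x2 \<noteq> u"
    by (rule edge_splits[OF l cub uv(1) g])
  have g': "ends K g = {v, u}" using g(2) by auto
  obtain b1 b2 y1 y2 where b: "incident_edges K v = {g, b1, b2}" "g \<noteq> b1" "g \<noteq> b2" "b1 \<noteq> b2"
    "ends K b1 = {v, y1}" "ends K b2 = {v, y2}" "y1 \<in> verts K" "y2 \<in> verts K" "y1 \<noteq> v" "y2 \<noteq> v"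
    by (rule edge_splits[OF l cub uv(2) g(1) g'])
  have aE: "a1 \<in> edges K" "a2 \<in> edges K"
  proof -
    have "{g, a1, a2} \<subseteq> edges K" unfolding a(1)[symmetric] by (auto simp: incident_edges_def)
    then show "a1 \<in> edges K" "a2 \<in> edges K" by auto
  qed
  show ?thesis
  proof (cases "x1 = v \<or> x2 = v")
    case False
    have "v \<notin> ends K a1" "v \<notin> ends K a2" using False a uv by auto
    then have av: "a1 \<notin> incident_edges K v" "a2 \<notin> incident_edges K v" by (simp_all add: incident_edges_def)
    then have ab: "a1 \<noteq> b1" "a1 \<noteq> b2" "a2 \<noteq> b1" "a2 \<noteq> b2" using b(1) by auto
    then have "b1 \<notin> incident_edges K u" "b2 \<notin> incident_edges K u" using a(1) b(2,3) by auto
    then have "u \<notin> ends K b1" "u \<notin> ends K b2"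
      using b(1) unfolding incident_edges_def by blast+
    then have yu: "y1 \<noteq> u" "y2 \<noteq> u" using b(5,6) by auto
    have s: "split_edge K g a1 a2 b1 b2 u v x1 x2 y1 y2"
      using K uv a b ab yu False g by unfold_locales auto
    have t: "split_edge K g a1 a2 b2 b1 u v x1 x2 y2 y1"
      using K uv a b ab yu False g by unfold_locales auto
    interpret S: split_edge K g a1 a2 b1 b2 u v x1 x2 y1 y2 by (fact s)
    interpret T: split_edge K g a1 a2 b2 b1 u v x1 x2 y2 y1 by (fact t)
    from split_edge_good[OF s t] show ?thesis
    proof
      assume "x1 \<noteq> y1 \<and> x2 \<noteq> y2 \<and> conn3 S.R"
      note n = this
      have "vcol S.R H (S.\<rho> \<circ> \<phi>) f" by (rule reduct_vcol[OF c f]) (use S.inj_inc n in blast)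
      then show ?thesis using n reduct_verts by metis
    next
      assume "x1 \<noteq> y2 \<and> x2 \<noteq> y1 \<and> conn3 T.R"
      note n = this
      have "vcol T.R H (T.\<rho> \<circ> \<phi>) f" by (rule reduct_vcol[OF c f]) (use T.inj_inc n in blast)
      then show ?thesis using n reduct_verts by metis
    qed
  next
    \<comment> \<open>A second edge joins \<open>u\<close> and \<open>v\<close>. Then at most two
      edges leave the pair, and closing the other side of this 2-edge-cut takes the place of the
      split.\<close>
    case True
    let ?W = "verts K - {u, v}"
    have W: "?W \<noteq> {}" using f H by blast
    have "2 \<le> card (edge_cut K {u, v})" using conn3_cut[OF K, of "{u, v}"] uv W by auto
    moreover have "card (edge_cut K {u, v}) \<le> 2"
    proof -
      have eq: "edge_cut K {u, v} = (incident_edges K u \<union> incident_edges K v) - {e \<in> edges K. ends K e = {u, v}}"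
      proof (rule set_eqI)
        fix e
        show "e \<in> edge_cut K {u, v} \<longleftrightarrow> e \<in> (incident_edges K u \<union> incident_edges K v) - {e \<in> edges K. ends K e = {u, v}}"
        proof (cases "e \<in> edges K")
          case eK: True
          obtain p q where "ends K e = {p, q}" "p \<noteq> q" "p \<in> verts K" "q \<in> verts K"
            by (rule loopless_ends[OF l eK])
          then show ?thesis using eK uv by (auto simp: edge_cut_def incident_edges_def doubleton_eq_iff)
        next
          case False
          then show ?thesis by (auto simp: edge_cut_def incident_edges_def)
        qed
      qed
      obtain h where h: "h \<in> {a1, a2}" "ends K h = {u, v}" using True a by auto
      have hb: "h \<in> {b1, b2}"
      proof -
        have "h \<in> incident_edges K v" using h aE by (auto simp: incident_edges_def)
        then show ?thesis using b(1) h(1) a(2,3) by auto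
      qed
      have "edge_cut K {u, v} \<subseteq> ({a1, a2} - {h}) \<union> ({b1, b2} - {h})"
        unfolding eq a(1) b(1) using g h aE by auto
      moreover have "card (({a1, a2} - {h}) \<union> ({b1, b2} - {h})) \<le> 2"
      proof -
        have "card ({a1, a2} - {h}) = 1" "card ({b1, b2} - {h}) = 1"
          using h(1) hb a(4) b(4) by auto
        then show ?thesis using card_Un_le[of "{a1, a2} - {h}" "{b1, b2} - {h}"] by simp
      qed
      ultimately show ?thesis
        by (meson card_mono finite.emptyI finite.insertI finite_Diff finite_UnI le_trans)
    qed
    ultimately have "card (edge_cut K {u, v}) = 2" by simp
    then have "card (edge_cut K ?W) = 2" using edge_cut_compl[of "{u, v}" K] uv by simp
    then obtain c' d' where cd: "edge_cut K ?W = {c', d'}" "c' \<noteq> d'" by (metis card_2_iff)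
    obtain x y s t where "two_cut K ?W c' d' x y s t"
      by (rule two_cutI[OF K Diff_subset cd])
    then interpret C: two_cut K ?W c' d' x y s t .
    show ?thesis using C.conn3_R reduct_vcol[OF c f C.inj_inc] reduct_verts by metis
  qed
qed

lemma single_vertex_class1:
  assumes H: "conn3 H" and c: "vcol K H \<phi> f" and K: "cubic K" and w: "w \<in> verts K"
    and f: "\<And>v. v \<in> verts H \<Longrightarrow> f v = w"
  shows "class1 H"
proof -
  obtain g where g: "bij_betw g {0, 1, 2 :: nat} (incident_edges K w)"
    by (rule cubic_star_enum[OF K w])
  have "bij_betw (inv_into {0, 1, 2} g \<circ> \<phi>) (incident_edges H v) {0, 1, 2}" if "v \<in> verts H" for v
    using c f[OF that] that bij_betw_trans[OF _ bij_betw_inv_into[OF g]] unfolding vcol_def by metis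
  then show ?thesis unfolding class1_def by blast
qed

text \<open>Since the graph is connected, all its vertices have their image on one side if the unused
  vertices and the used ones form a bipartition.\<close>

lemma unused_independent:
  assumes H: "conn3 H" "\<not> class1 H" and K: "conn3 K" and c: "vcol K H \<phi> f"
    and ev: "\<And>w. w \<in> verts K \<Longrightarrow> even (card {v \<in> verts H. f v = w})"
    and ind: "\<And>g u v. g \<in> edges K \<Longrightarrow> ends K g = {u, v} \<Longrightarrow> u \<in> f ` verts H \<or> v \<in> f ` verts H"
  shows "card (verts K) < card (verts H)"
proof -
  let ?U = "f ` verts H"
  let ?Z = "verts K - ?U"
  note lK = conn3_loopless[OF K] and lH = conn3_loopless[OF H(1)]
  note fin = loopless_finite[OF lK] loopless_finite[OF lH]
  have U: "?U \<subseteq> verts K" using c by (auto simp: vcol_def)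
  have "inner_edges K ?Z = {}"
  proof (rule ccontr)
    assume "inner_edges K ?Z \<noteq> {}"
    then obtain e where e: "e \<in> edges K" "ends K e \<subseteq> ?Z" by (auto simp: inner_edges_def)
    obtain p q where "ends K e = {p, q}" by (rule loopless_ends[OF lK e(1)])
    then show False using ind[OF e(1)] e(2) by auto
  qed
  then have Z3: "3 * card ?Z = card (edge_cut K ?U)"
    using degree_sum[OF conn3_cubic[OF K], of ?Z] edge_cut_compl[OF U] by simp
  have "inner_edges K ?U \<noteq> {}"
  proof
    assume none: "inner_edges K ?U = {}"
    obtain v0 where v0: "v0 \<in> verts H" using H by (auto simp: conn3_def)
    have step: "f b = f a" if "e \<in> edges H" "ends H e = {a, b}" for e a b
    proof -
      have ab: "a \<in> verts H" "b \<in> verts H" using lH that by (auto simp: loopless_graph_def)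
      have e: "\<phi> e \<in> edges K" "f a \<in> ends K (\<phi> e)" "f b \<in> ends K (\<phi> e)"
        using vcol_edge[OF c _ that(1)] ab that(2) by auto
      show ?thesis
      proof (rule ccontr)
        assume "f b \<noteq> f a"
        then have "ends K (\<phi> e) = {f b, f a}" using loopless_ends_eq[OF lK] e by blast
        then have "\<phi> e \<in> inner_edges K ?U" using e ab by (auto simp: inner_edges_def)
        then show False using none by blast
      qed
    qed
    let ?X = "{v \<in> verts H. f v = f v0}"
    have "edge_cut H ?X = {}"
    proof (rule ccontr)
      assume "edge_cut H ?X \<noteq> {}"
      then obtain e where e: "e \<in> edge_cut H ?X" by blast
      obtain a b where "e \<in> edges H" "ends H e = {a, b}" "a \<in> ?X" "b \<in> verts H" "b \<notin> ?X"
        using edge_cutE[OF lH _ e] by blast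
      then show False using step by auto
    qed
    then have "?X = verts H" using conn3_cut[OF H(1), of ?X] v0 by fastforce
    then have "class1 H"
      using single_vertex_class1[OF H(1) c conn3_cubic[OF K], of "f v0"] v0 U by blast
    then show False using H(2) by blast
  qed
  then have "card (inner_edges K ?U) \<noteq> 0" using lK by simp
  then have lt: "card ?Z < card ?U"
    using degree_sum[OF conn3_cubic[OF K] U] Z3 by linarith
  \<comment> \<open>A nonempty fibre of even size has at least two elements, so the used vertices
    are at most half as many as the vertices of \<open>H\<close>.\<close>
  have "2 * card ?U = (\<Sum>w\<in>?U. 2)" by simp
  also have "\<dots> \<le> (\<Sum>w\<in>?U. card {v \<in> verts H. f v = w})"
  proof (rule sum_mono)
    fix w assume w: "w \<in> ?U"
    then have "{v \<in> verts H. f v = w} \<noteq> {}" by blast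
    then have "card {v \<in> verts H. f v = w} \<noteq> 0" using fin by simp
    then show "2 \<le> card {v \<in> verts H. f v = w}" using ev[of w] w U by (metis One_nat_def Suc_1 Suc_leI dvd_refl le_neq_implies_less less_one linorder_not_less odd_one subsetD)
  qed
  also have "\<dots> = card (verts H)"
    using sum.image_gen[of "verts H" "\<lambda>_. 1 :: nat" f] fin by simp
  finally have "2 * card ?U \<le> card (verts H)" .
  moreover have "card (verts K) = card ?U + card ?Z"
    using U fin by (metis card_Diff_subset card_mono finite_subset le_add_diff_inverse)
  ultimately show ?thesis using lt by linarith
qed

lemma even_coloring_reduces:
  fixes K :: "('w, 'f) mgraph" and H :: "('v, 'e) mgraph"
  assumes H: "conn3 H" "\<not> class1 H" and K: "conn3 K" and c: "vcol K H \<phi> f"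
    and ev: "\<And>w. w \<in> verts K \<Longrightarrow> even (card {v \<in> verts H. f v = w})"
  shows "\<exists>K' :: ('w, 'f) mgraph. conn3 K' \<and> colors K' H \<and> card (verts K') < card (verts H)"
  using K c ev
proof (induction "card (verts K)" arbitrary: K \<phi> rule: less_induct)
  case less
  show ?case
  proof (cases "\<exists>g u v. g \<in> edges K \<and> ends K g = {u, v} \<and> u \<notin> f ` verts H \<and> v \<notin> f ` verts H")
    case True
    then obtain g u v where g: "g \<in> edges K" "ends K g = {u, v}" "u \<notin> f ` verts H" "v \<notin> f ` verts H" by blast
    have "f ` verts H \<subseteq> verts K - {u, v}" using less.prems(2) g by (auto simp: vcol_def)
    moreover have "verts H \<noteq> {}" using H by (simp add: conn3_def)
    ultimately have "\<exists>(K' :: ('w, 'f) mgraph) \<psi>. conn3 K' \<and> vcol K' H \<psi> f \<and> verts K' = verts K - {u, v}"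
      by (rule delete_adjacent[OF less.prems(1) g(1,2) less.prems(2)])
    then obtain K' :: "('w, 'f) mgraph" and \<psi>
      where K': "conn3 K'" "vcol K' H \<psi> f" "verts K' = verts K - {u, v}" by (elim exE conjE)
    have "ends K g \<subseteq> verts K"
      using conn3_loopless[OF less.prems(1)] g(1) by (simp add: loopless_graph_def)
    then have "u \<in> verts K" using g(2) by simp
    then have "card (verts K') < card (verts K)"
      unfolding K'(3) using loopless_finite(1)[OF conn3_loopless[OF less.prems(1)]]
      by (intro psubset_card_mono) auto
    then show ?thesis using less.hyps[OF _ K'(1,2)] less.prems(3) K'(3) by simp
  next
    case False
    then have "card (verts K) < card (verts H)"
      using unused_independent[OF H less.prems(1,2,3)] by blast
    then show ?thesis using less.prems colors_iff_vcol[OF conn3_loopless[OF H(1)]] by blast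
  qed
qed

lemma bijective_vcol_isomorphic:
  assumes H: "conn3 H" and K: "conn3 K" and c: "vcol K H \<phi> f"
    and b: "bij_betw f (verts H) (verts K)"
  shows "isomorphic H K"
proof (rule isomorphicI[OF b])
  note lK = conn3_loopless[OF K] and lH = conn3_loopless[OF H]
  have img: "\<phi> e \<in> edges K" if e: "e \<in> edges H" for e
    using loopless_ends[OF lH e] vcol_edge[OF c _ e] by (metis insertI1)
  show ends: "ends K (\<phi> e) = f ` ends H e" if e: "e \<in> edges H" for e
  proof -
    obtain p q where pq: "ends H e = {p, q}" "p \<noteq> q" "p \<in> verts H" "q \<in> verts H"
      by (rule loopless_ends[OF lH e])
    have "f p \<noteq> f q" using b pq by (auto simp: bij_betw_def inj_on_def)
    then have "ends K (\<phi> e) = {f p, f q}"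
      using loopless_ends_eq[OF lK img[OF e]] vcol_edge[OF c _ e] pq by blast
    then show ?thesis using pq by simp
  qed
  have "inj_on \<phi> (edges H)"
  proof (rule inj_onI)
    fix d e assume de: "d \<in> edges H" "e \<in> edges H" "\<phi> d = \<phi> e"
    obtain p q where pq: "ends H d = {p, q}" "p \<noteq> q" "p \<in> verts H" "q \<in> verts H"
      by (rule loopless_ends[OF lH de(1)])
    have "f p \<in> f ` ends H e" using ends[OF de(1)] ends[OF de(2)] de(3) pq by auto
    moreover have "ends H e \<subseteq> verts H" using lH de by (simp add: loopless_graph_def)
    ultimately have "p \<in> ends H e" using b pq by (auto simp: bij_betw_def inj_on_def)
    then have "d \<in> incident_edges H p" "e \<in> incident_edges H p" using de pq by (auto simp: incident_edges_def)
    moreover have "inj_on \<phi> (incident_edges H p)" using c pq by (auto simp: vcol_def bij_betw_def)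
    ultimately show "d = e" using de(3) by (auto simp: inj_on_def)
  qed
  moreover have "edges K \<subseteq> \<phi> ` edges H"
  proof
    fix d assume d: "d \<in> edges K"
    obtain w w' where w: "ends K d = {w, w'}" "w \<in> verts K" by (rule loopless_ends[OF lK d])
    obtain v where v: "v \<in> verts H" "w = f v" by (rule bij_betw_preimage[OF b w(2)])
    have bb: "bij_betw \<phi> (incident_edges H v) (incident_edges K (f v))" using c v by (simp add: vcol_def)
    have "d \<in> incident_edges K (f v)" using d w v by (simp add: incident_edges_def)
    then obtain e where "e \<in> incident_edges H v" "d = \<phi> e" by (rule bij_betw_preimage[OF bb])
    then show "d \<in> \<phi> ` edges H" by (auto simp: incident_edges_def)
  qed
  ultimately show "bij_betw \<phi> (edges H) (edges K)" using img by (auto simp: bij_betw_def)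
qed

text \<open>This is \<open>odd_set_cut\<close> for the whole vertex set: nothing crosses, so no edge
  of \<open>K\<close> leaves the set of vertices with odd fibre, and \<open>K\<close> is
  connected.\<close>

lemma parity_constant:
  assumes H: "conn3 H" and K: "conn3 K" and c: "vcol K H \<phi> f"
  shows "odd_set K f (verts H) = {} \<or> odd_set K f (verts H) = verts K"
proof -
  note lK = conn3_loopless[OF K] and lH = conn3_loopless[OF H]
  have "edge_cut K (odd_set K f (verts H)) = {}"
  proof (rule ccontr)
    assume "edge_cut K (odd_set K f (verts H)) \<noteq> {}"
    then obtain d where d: "d \<in> edge_cut K (odd_set K f (verts H))" "d \<in> edges K" by (auto simp: edge_cut_def)
    then show False
      using odd_set_cut[OF lK lH c subset_refl d(2)] edge_cut_trivial(2)[OF lH] by simp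
  qed
  moreover have "odd_set K f (verts H) \<subseteq> verts K" by (auto simp: odd_set_def)
  ultimately show ?thesis using conn3_cut[OF K, of "odd_set K f (verts H)"] by force
qed

text \<open>Odd fibres make \<open>f\<close> onto; then either \<open>K\<close> itself is smaller,
  or equal orders make \<open>f\<close> bijective. Even fibres lead to
  \<open>even_coloring_reduces\<close>.\<close>

theorem coloring_iso_or_smaller:
  fixes K :: "('w, 'f) mgraph" and H :: "('v, 'e) mgraph"
  assumes H: "conn3 H" "\<not> class1 H" and K: "conn3 K" and c: "vcol K H \<phi> f"
  shows "(isomorphic H K \<and> bij_betw f (verts H) (verts K)) \<or>
    (\<exists>K' :: ('w, 'f) mgraph. conn3 K' \<and> colors K' H \<and> card (verts K') < card (verts H))"
proof -
  note lK = conn3_loopless[OF K] and lH = conn3_loopless[OF H(1)]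
  from parity_constant[OF H(1) K c] show ?thesis
  proof
    assume "odd_set K f (verts H) = {}"
    then have "even (card {v \<in> verts H. f v = w})" if "w \<in> verts K" for w
      using that by (auto simp: odd_set_def)
    then show ?thesis using even_coloring_reduces[OF H K c] by blast
  next
    assume odd: "odd_set K f (verts H) = verts K"
    have "verts K \<subseteq> f ` verts H"
    proof
      fix w assume "w \<in> verts K"
      then have "odd (card {v \<in> verts H. f v = w})" using odd by (auto simp: odd_set_def)
      then have "{v \<in> verts H. f v = w} \<noteq> {}" by (metis card.empty even_zero)
      then show "w \<in> f ` verts H" by blast
    qed
    then have img: "f ` verts H = verts K" using c by (auto simp: vcol_def)
    then have le: "card (verts K) \<le> card (verts H)" using card_image_le[OF loopless_finite(1)[OF lH], of f] by simp
    show ?thesis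
    proof (cases "card (verts K) = card (verts H)")
      case True
      then have "bij_betw f (verts H) (verts K)"
        using img loopless_finite(1)[OF lH] by (simp add: bij_betw_def eq_card_imp_inj_on)
      then show ?thesis using bijective_vcol_isomorphic[OF H(1) K c] by blast
    next
      case False
      then show ?thesis using le K c colors_iff_vcol[OF lH] by (metis le_neq_implies_less)
    qed
  qed
qed

lemma loopless_other_end:
  assumes "loopless_graph G" "e \<in> edges G" "v \<in> ends G e"
  obtains u where "ends G e = {v, u}" "u \<in> verts G" "u \<noteq> v"
proof -
  obtain p q where "ends G e = {p, q}" "p \<noteq> q" "p \<in> verts G" "q \<in> verts G"
    by (rule loopless_ends[OF assms(1,2)])
  then show ?thesis using assms(3) that[of p] that[of q] by auto
qed

section \<open>Contracting one side of a 3-edge-cut\<close>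

text \<open>The contracted side is represented by a vertex \<open>b\<close> taken from that side.
  The result thus keeps the type of \<open>K\<close>, and the minimality assumption of
  \<open>minimal_class2\<close> applies to it.\<close>

definition contract :: "('v, 'e) mgraph \<Rightarrow> 'v set \<Rightarrow> 'v \<Rightarrow> ('v, 'e) mgraph" where
  "contract K A b = \<lparr>verts = insert b A, edges = {e \<in> edges K. ends K e \<inter> A \<noteq> {}},
     ends = \<lambda>e. if ends K e \<subseteq> A then ends K e else insert b (ends K e \<inter> A)\<rparr>"

lemma contract_sel [simp]:
  "verts (contract K A b) = insert b A"
  "edges (contract K A b) = {e \<in> edges K. ends K e \<inter> A \<noteq> {}}"
  "ends (contract K A b) e = (if ends K e \<subseteq> A then ends K e else insert b (ends K e \<inter> A))"
  by (simp_all add: contract_def)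

lemma contract_incident:
  assumes "v \<in> A" "b \<notin> A"
  shows "incident_edges (contract K A b) v = incident_edges K v"
  using assms by (auto simp: incident_edges_def)

lemma contract_incident_new:
  assumes K: "loopless_graph K" and "b \<notin> A"
  shows "incident_edges (contract K A b) b = edge_cut K A"
proof -
  have "ends K e \<subseteq> verts K" if "e \<in> edges K" for e using K that by (simp add: loopless_graph_def)
  then show ?thesis using assms(2) by (auto simp: incident_edges_def edge_cut_def split: if_splits)
qed

lemma contract_cut:
  assumes K: "loopless_graph K" and A: "A \<subseteq> verts K" and b: "b \<in> verts K" "b \<notin> A" and Y: "Y \<subseteq> A"
  shows "edge_cut (contract K A b) Y = edge_cut K Y"
proof (rule set_eqI)
  fix e
  show "e \<in> edge_cut (contract K A b) Y \<longleftrightarrow> e \<in> edge_cut K Y"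
  proof (cases "e \<in> edges K")
    case True
    then obtain p q where pq: "ends K e = {p, q}" "p \<noteq> q" "p \<in> verts K" "q \<in> verts K"
      using loopless_ends[OF K] by metis
    show ?thesis using True pq Y b A by (cases "p \<in> A"; cases "q \<in> A") (auto simp: edge_cut_def)
  qed (auto simp: edge_cut_def)
qed

lemma contract_conn3:
  assumes K: "conn3 K" and A: "A \<subseteq> verts K" and b: "b \<in> verts K" "b \<notin> A"
    and cut: "card (edge_cut K A) = 3"
  shows "conn3 (contract K A b)"
proof -
  note l = conn3_loopless[OF K]
  note fin = loopless_finite[OF l]
  let ?C = "contract K A b"
  have fA: "finite A" using A fin finite_subset by blast
  have two: "card (ends ?C e) = 2" if e: "e \<in> edges ?C" for e
  proof -
    have "e \<in> edges K" using e by simp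
    then obtain p q where "ends K e = {p, q}" "p \<noteq> q" "p \<in> verts K" "q \<in> verts K"
      by (rule loopless_ends[OF l])
    then show ?thesis using e b by (cases "p \<in> A"; cases "q \<in> A") (auto simp: card_insert_if)
  qed
  have lC: "loopless_graph ?C"
    unfolding loopless_graph_def using fA fin two by (auto split: if_splits)
  have "card (incident_edges ?C v) = 3" if v: "v \<in> verts ?C" for v
  proof (cases "v = b")
    case True
    then show ?thesis using contract_incident_new[OF l b(2)] cut by simp
  next
    case False
    then have vA: "v \<in> A" using v by simp
    then show ?thesis unfolding contract_incident[OF vA b(2)] using K A by (auto simp: conn3_def cubic_def)
  qed
  then have cC: "cubic ?C" using lC by (simp add: cubic_def)
  have small: "2 \<le> card (edge_cut ?C Y)" if Y: "Y \<subseteq> A" "Y \<noteq> {}" for Y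
    using contract_cut[OF l A b Y(1)] conn3_cut[OF K, of Y] Y A b by auto
  have "2 \<le> card (edge_cut ?C Y)" if Y: "Y \<subseteq> verts ?C" "Y \<noteq> {}" "Y \<noteq> verts ?C" for Y
  proof (cases "b \<in> Y")
    case False
    then show ?thesis using small[of Y] Y by auto
  next
    case True
    have "verts ?C - Y \<subseteq> A" "verts ?C - Y \<noteq> {}" using True Y by auto
    then show ?thesis using small edge_cut_compl[OF Y(1)] by metis
  qed
  then show ?thesis using cC by (simp add: conn3_def)
qed

lemma bij_betw_3:
  assumes "card S = 3" "f ` S = {0, 1, 2 :: nat}"
  shows "bij_betw f S {0, 1, 2}"
proof -
  have "finite S" using assms(1) by (metis card.infinite zero_neq_numeral)
  moreover have "card (f ` S) = card S" using assms by simp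
  ultimately show ?thesis using assms(2) by (simp add: bij_betw_def eq_card_imp_inj_on)
qed

text \<open>The three cut edges form a star in both contractions and so carry all three colours in
  each; a permutation of the colours makes the two colourings agree on them.\<close>

lemma three_cut_class1:
  assumes K: "conn3 K" and A: "A \<subseteq> verts K" and cut: "card (edge_cut K A) = 3"
    and b: "b \<in> verts K" "b \<notin> A" and a: "a \<in> A"
    and one: "class1 (contract K A b)" "class1 (contract K (verts K - A) a)"
  shows "class1 K"
proof -
  note l = conn3_loopless[OF K]
  let ?S = "{0, 1, 2 :: nat}"
  obtain c where c: "\<And>v. v \<in> insert b A \<Longrightarrow> bij_betw c (incident_edges (contract K A b) v) ?S"
    using one(1) by (auto simp: class1_def)
  obtain d where d: "\<And>v. v \<in> insert a (verts K - A) \<Longrightarrow> bij_betw d (incident_edges (contract K (verts K - A) a) v) ?S"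
    using one(2) by (auto simp: class1_def)
  have cb: "bij_betw c (edge_cut K A) ?S" using c[of b] unfolding contract_incident_new[OF l b(2)] by blast
  have aB: "a \<notin> verts K - A" using a by blast
  have da: "bij_betw d (edge_cut K A) ?S"
    using d[of a] unfolding contract_incident_new[OF l aB] edge_cut_compl[OF A] by blast
  let ?p = "c \<circ> inv_into (edge_cut K A) d"
  have p: "bij_betw ?p ?S ?S" by (rule bij_betw_trans[OF bij_betw_inv_into[OF da] cb])
  have pd: "?p (d e) = c e" if "e \<in> edge_cut K A" for e
    using da that by (simp add: bij_betw_def)
  let ?k = "\<lambda>e. if ends K e \<inter> A \<noteq> {} then c e else ?p (d e)"
  have "bij_betw ?k (incident_edges K v) ?S" if v: "v \<in> verts K" for v
  proof (cases "v \<in> A")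
    case True
    have "bij_betw c (incident_edges (contract K A b) v) ?S" using True by (intro c) simp
    then have "bij_betw c (incident_edges K v) ?S" by (simp only: contract_incident[OF True b(2)])
    moreover have "c e = ?k e" if "e \<in> incident_edges K v" for e
      using that True by (auto simp: incident_edges_def)
    ultimately show ?thesis by (rule bij_betw_eqI)
  next
    case False
    have vB: "v \<in> verts K - A" using False v by simp
    then have "bij_betw d (incident_edges (contract K (verts K - A) a) v) ?S" by (intro d) simp
    then have "bij_betw d (incident_edges K v) ?S" by (simp only: contract_incident[OF vB aB])
    then have "bij_betw (?p \<circ> d) (incident_edges K v) ?S" by (rule bij_betw_trans[OF _ p])
    moreover have "(?p \<circ> d) e = ?k e" if e: "e \<in> incident_edges K v" for e
    proof (cases "ends K e \<inter> A \<noteq> {}")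
      case True
      then have "e \<in> edge_cut K A" using e False v by (auto simp: edge_cut_def incident_edges_def)
      then show ?thesis using pd True by simp
    qed simp
    ultimately show ?thesis by (rule bij_betw_eqI)
  qed
  then show ?thesis unfolding class1_def by blast
qed

section \<open>The smallest graphs of class 2\<close>

locale minimal_class2 =
  fixes N :: "('v, 'e) mgraph"
  assumes N: "conn3 N" and two: "\<not> class1 N"
    and smaller: "\<And>G :: ('v, 'e) mgraph. conn3 G \<Longrightarrow> card (verts G) < card (verts N) \<Longrightarrow> class1 G"
begin

lemma l: "loopless_graph N" using conn3_loopless[OF N] .
lemma fin: "finite (verts N)" using loopless_finite(1)[OF l] .

text \<open>Both closed sides of a 2-edge-cut would be smaller than \<open>N\<close>, hence of class
  1. By \<open>two_cut_colors\<close> one of them would colour \<open>N\<close> and pass its class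
  on.\<close>

lemma cut_ge_3:
  assumes X: "X \<subseteq> verts N" "X \<noteq> {}" "X \<noteq> verts N"
  shows "3 \<le> card (edge_cut N X)"
proof (rule ccontr)
  assume "\<not> 3 \<le> card (edge_cut N X)"
  then have "card (edge_cut N X) = 2" using conn3_cut[OF N X] by simp
  then obtain c d where cd: "edge_cut N X = {c, d}" "c \<noteq> d" by (metis card_2_iff)
  obtain x y s t where "two_cut N X c d x y s t" and "two_cut N (verts N - X) c d s t x y"
    by (rule two_cutI[OF N X(1) cd])
  then have "conn3 (reduct N X (merge c d))" "conn3 (reduct N (verts N - X) (merge c d))"
    by (auto intro: two_cut.conn3_R)
  moreover have "card X < card (verts N)" "card (verts N - X) < card (verts N)"
    using X fin by (auto intro!: psubset_card_mono)
  ultimately have "class1 (reduct N X (merge c d))" "class1 (reduct N (verts N - X) (merge c d))"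
    using smaller by auto
  then show False using two two_cut_colors[OF N X(1) cd] colors_class1 by blast
qed

text \<open>With two vertices on each side, both contractions of a 3-edge-cut are smaller than
  \<open>N\<close>, so \<open>three_cut_class1\<close> would give \<open>N\<close> class 1.\<close>

lemma cut_ge_4:
  assumes X: "X \<subseteq> verts N" "2 \<le> card X" "2 \<le> card (verts N - X)"
  shows "4 \<le> card (edge_cut N X)"
proof (rule ccontr)
  assume "\<not> 4 \<le> card (edge_cut N X)"
  moreover have ne: "X \<noteq> {}" "verts N - X \<noteq> {}" using X by auto
  ultimately have three: "card (edge_cut N X) = 3" using cut_ge_3[of X] X by fastforce
  obtain a b where ab: "a \<in> X" "b \<in> verts N" "b \<notin> X" using ne by blast
  have aX: "a \<in> verts N" "a \<notin> verts N - X" using ab X by auto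
  have "card X + card (verts N - X) = card (verts N)"
    using X(1) fin by (metis card_Diff_subset card_mono finite_subset le_add_diff_inverse)
  then have "card (insert b X) < card (verts N)" "card (insert a (verts N - X)) < card (verts N)"
    using X ab fin by (auto simp: card_insert_if finite_subset)
  then have "class1 (contract N X b)" "class1 (contract N (verts N - X) a)"
    using smaller contract_conn3[OF N X(1) ab(2,3) three]
      contract_conn3[OF N Diff_subset aX] edge_cut_compl[OF X(1)] three by auto
  then show False using two three_cut_class1[OF N X(1) three ab(2,3,1)] by blast
qed

lemma order_ge_4: "4 \<le> card (verts N)"
proof (rule ccontr)
  assume "\<not> 4 \<le> card (verts N)"
  moreover have "even (card (verts N))" using cubic_even_verts[OF conn3_cubic[OF N]] .
  moreover have "card (verts N) \<noteq> 0" using N fin by (simp add: conn3_def)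
  ultimately have "card (verts N) = 2" by presburger
  then obtain p q where pq: "verts N = {p, q}" "p \<noteq> q" by (metis card_2_iff)
  have "ends N e = {p, q}" if e: "e \<in> edges N" for e
  proof -
    obtain r s where "ends N e = {r, s}" "r \<noteq> s" "r \<in> verts N" "s \<in> verts N"
      by (rule loopless_ends[OF l e])
    then show ?thesis using pq by auto
  qed
  then have inc: "incident_edges N v = edges N" if "v \<in> verts N" for v
    using that pq by (auto simp: incident_edges_def)
  obtain g where g: "bij_betw g {0, 1, 2 :: nat} (incident_edges N p)"
    by (rule cubic_star_enum[OF conn3_cubic[OF N]]) (use pq in auto)
  then have "\<forall>v\<in>verts N. bij_betw (inv_into {0, 1, 2} g) (incident_edges N v) {0, 1, 2}"
    using inc pq bij_betw_inv_into[OF g] by simp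
  then show False using two unfolding class1_def by blast
qed

lemma card_diff_ge:
  assumes "X \<subseteq> verts N"
  shows "card (verts N - X) = card (verts N) - card X"
  using assms fin by (meson card_Diff_subset finite_subset)

text \<open>At most two edges leave the common ends of two parallel edges, too few for
  \<open>cut_ge_4\<close>.\<close>

lemma no_parallel:
  assumes "d \<in> edges N" "e \<in> edges N" "ends N d = ends N e"
  shows "d = e"
proof (rule ccontr)
  assume ne: "d \<noteq> e"
  obtain u v where uv: "ends N e = {u, v}" "u \<noteq> v" "u \<in> verts N" "v \<in> verts N"
    by (rule loopless_ends[OF l assms(2)])
  have "{d, e} \<subseteq> inner_edges N {u, v}" using assms uv by (auto simp: inner_edges_def)
  then have "2 \<le> card (inner_edges N {u, v})" using ne l by (metis card_2_iff card_mono finite_inner_edges)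
  then have "card (edge_cut N {u, v}) \<le> 2"
    using degree_sum[OF conn3_cubic[OF N], of "{u, v}"] uv by simp
  moreover have "2 \<le> card (verts N - {u, v})" using card_diff_ge[of "{u, v}"] uv order_ge_4 by simp
  ultimately show False using cut_ge_4[of "{u, v}"] uv by simp
qed

lemma order_ge_6: "6 \<le> card (verts N)"
proof (rule ccontr)
  assume "\<not> 6 \<le> card (verts N)"
  moreover have "even (card (verts N))" using cubic_even_verts[OF conn3_cubic[OF N]] .
  ultimately have "card (verts N) = 4" using order_ge_4 by presburger
  then obtain p q r s where V: "verts N = {p, q, r, s}" and dist: "distinct [p, q, r, s]"
  proof -
    assume a: "\<And>p q r s. verts N = {p, q, r, s} \<Longrightarrow> distinct [p, q, r, s] \<Longrightarrow> thesis"
    obtain xs where "set xs = verts N" "distinct xs" using finite_distinct_list[OF fin] by blast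
    moreover then have "length xs = 4" using \<open>card (verts N) = 4\<close> distinct_card by fastforce
    ultimately obtain p q r s where "xs = [p, q, r, s]"
      by (auto simp: length_Suc_conv numeral_eq_Suc)
    then show thesis using a[of p q r s] \<open>set xs = verts N\<close> \<open>distinct xs\<close> by simp
  qed
  have pairs: "ends N e \<in> {{p, q}, {r, s}, {p, r}, {q, s}, {p, s}, {q, r}}" if e: "e \<in> edges N" for e
  proof -
    obtain x y where "ends N e = {x, y}" "x \<noteq> y" "x \<in> verts N" "y \<in> verts N"
      by (rule loopless_ends[OF l e])
    then show ?thesis using V by (auto simp: doubleton_eq_iff)
  qed
  \<comment> \<open>The colour classes are the three perfect matchings of the complete graph on four
    vertices.\<close>
  define col where "col = (\<lambda>e. if ends N e \<in> {{p, q}, {r, s}} then 0 else if ends N e \<in> {{p, r}, {q, s}} then 1 else (2 :: nat))"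
  have "bij_betw col (incident_edges N v) {0, 1, 2}" if v: "v \<in> verts N" for v
  proof -
    have "inj_on col (incident_edges N v)"
    proof (rule inj_onI)
      fix d e assume de: "d \<in> incident_edges N v" "e \<in> incident_edges N v" "col d = col e"
      then have E: "d \<in> edges N" "e \<in> edges N" "v \<in> ends N d" "v \<in> ends N e" by (auto simp: incident_edges_def)
      have disj: "{p, q} \<inter> {r, s} = {}" "{p, r} \<inter> {q, s} = {}" "{p, s} \<inter> {q, r} = {}" using dist by auto
      have same: "D = F" if "A \<inter> A' = {}" "D \<in> {A, A'}" "F \<in> {A, A'}" "v \<in> D" "v \<in> F" for A A' D F :: "'v set"
        using that by blast
      have "ends N d = ends N e"
      proof (cases "ends N d \<in> {{p, q}, {r, s}}")
        case True
        then have "ends N e \<in> {{p, q}, {r, s}}" using de(3) by (simp add: col_def split: if_splits)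
        then show ?thesis using same[OF disj(1) True] E by blast
      next
        case n: False
        show ?thesis
        proof (cases "ends N d \<in> {{p, r}, {q, s}}")
          case True
          then have "ends N e \<in> {{p, r}, {q, s}}" using de(3) n by (simp add: col_def split: if_splits)
          then show ?thesis using same[OF disj(2) True] E by blast
        next
          case False
          have d: "ends N d \<in> {{p, s}, {q, r}}" using pairs[OF E(1)] False n by blast
          have "ends N e \<notin> {{p, q}, {r, s}}" "ends N e \<notin> {{p, r}, {q, s}}"
            using de(3) n False by (simp_all add: col_def split: if_splits)
          then have "ends N e \<in> {{p, s}, {q, r}}" using pairs[OF E(2)] by blast
          then show ?thesis using same[OF disj(3) d] E by blast
        qed
      qed
      then show "d = e" using no_parallel[OF E(1,2)] by simp
    qed
    moreover have "card (incident_edges N v) = 3" using N v by (simp add: conn3_def cubic_def)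
    ultimately have "card (col ` incident_edges N v) = 3" by (simp add: card_image)
    moreover have "col ` incident_edges N v \<subseteq> {0, 1, 2}" by (auto simp: col_def)
    ultimately have "col ` incident_edges N v = {0, 1, 2}" by (intro card_subset_eq) auto
    then show ?thesis using \<open>inj_on col (incident_edges N v)\<close> by (simp add: bij_betw_def)
  qed
  then show False using two unfolding class1_def by blast
qed

section \<open>Girth five and the Moore bound\<close>

definition nb :: "'v \<Rightarrow> 'v set" where
  "nb v = {u. \<exists>e\<in>edges N. ends N e = {v, u}}"

lemma nb_sym: "u \<in> nb v \<Longrightarrow> v \<in> nb u"
  by (auto simp: nb_def insert_commute)

lemma nb_verts: "u \<in> nb v \<Longrightarrow> u \<in> verts N \<and> v \<in> verts N \<and> u \<noteq> v"
  using l by (fastforce simp: nb_def loopless_graph_def)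

lemma card_nb:
  assumes v: "v \<in> verts N"
  shows "card (nb v) = 3"
proof -
  have ex: "\<exists>u. ends N e = {v, u}" if "e \<in> incident_edges N v" for e
  proof -
    have "e \<in> edges N" "v \<in> ends N e" using that by (auto simp: incident_edges_def)
    then show ?thesis using loopless_other_end[OF l] by blast
  qed
  define h where "h e = (SOME u. ends N e = {v, u})" for e
  have h: "ends N e = {v, h e}" if "e \<in> incident_edges N v" for e
    unfolding h_def by (rule someI_ex[OF ex[OF that]])
  have "inj_on h (incident_edges N v)"
    using h no_parallel by (intro inj_onI) (metis (no_types, lifting) incident_edges_def mem_Collect_eq)
  moreover have "h ` incident_edges N v = nb v"
  proof
    show "h ` incident_edges N v \<subseteq> nb v" using h by (auto simp: nb_def incident_edges_def)
    show "nb v \<subseteq> h ` incident_edges N v"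
    proof
      fix u assume u: "u \<in> nb v"
      then obtain e where e: "e \<in> edges N" "ends N e = {v, u}" by (auto simp: nb_def)
      then have ei: "e \<in> incident_edges N v" by (simp add: incident_edges_def)
      then have "h e = u" using h[OF ei] e(2) nb_verts[OF u] by (auto simp: doubleton_eq_iff)
      then show "u \<in> h ` incident_edges N v" using ei by blast
    qed
  qed
  moreover have "card (incident_edges N v) = 3" using N v by (simp add: conn3_def cubic_def)
  ultimately show ?thesis by (metis card_image)
qed

text \<open>At most three edges leave a triangle, and by \<open>order_ge_6\<close> the rest is large
  enough for \<open>cut_ge_4\<close>.\<close>

lemma no_triangle:
  assumes "u \<in> nb v" "w \<in> nb v"
  shows "w \<notin> nb u"
proof
  assume w: "w \<in> nb u"
  note n = nb_verts[OF assms(1)] nb_verts[OF assms(2)] nb_verts[OF w]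
  let ?X = "{u, v, w}"
  have c3: "card ?X = 3" using n by auto
  obtain e1 e2 e3 where e: "e1 \<in> edges N" "ends N e1 = {v, u}" "e2 \<in> edges N" "ends N e2 = {v, w}"
    "e3 \<in> edges N" "ends N e3 = {u, w}" using assms w by (auto simp: nb_def)
  then have "{e1, e2, e3} \<subseteq> inner_edges N ?X" by (auto simp: inner_edges_def)
  moreover have "card {e1, e2, e3} = 3" using e n by (auto simp: doubleton_eq_iff card_insert_if)
  ultimately have "3 \<le> card (inner_edges N ?X)" using l by (metis card_mono finite_inner_edges)
  then have "card (edge_cut N ?X) \<le> 3"
    using degree_sum[OF conn3_cubic[OF N], of ?X] n c3 by simp
  moreover have "2 \<le> card (verts N - ?X)" using card_diff_ge[of ?X] n order_ge_6 c3 by simp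
  ultimately show False using cut_ge_4[of ?X] n c3 by simp
qed

text \<open>Two opposite edges of a 4-cycle \<open>a b c d\<close> are deleted and the vertices of degree 2 are
  suppressed; every 3-edge-coloring of the result extends to the cycle.\<close>

lemma no_four_cycle:
  assumes ab: "b \<in> nb a" and bc: "c \<in> nb b" and cd: "d \<in> nb c" and da: "a \<in> nb d"
    and ne: "a \<noteq> c" "b \<noteq> d"
  shows False
proof -
  note n = nb_verts[OF ab] nb_verts[OF bc] nb_verts[OF cd] nb_verts[OF da]
  have chord: "a \<notin> nb c" "b \<notin> nb d"
    using no_triangle[OF nb_sym[OF ab] bc] no_triangle[OF nb_sym[OF bc] cd] nb_sym by blast+
  obtain e1 e2 e3 e4 where e: "e1 \<in> edges N" "ends N e1 = {a, b}" "e2 \<in> edges N" "ends N e2 = {b, c}"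
    "e3 \<in> edges N" "ends N e3 = {c, d}" "e4 \<in> edges N" "ends N e4 = {d, a}"
    using ab bc cd da by (auto simp: nb_def)
  let ?T = "{a, b, c, d}"
  let ?W = "verts N - ?T"
  have out: "\<exists>f x. incident_edges N p = {h, k, f} \<and> f \<noteq> h \<and> f \<noteq> k \<and> ends N f = {p, x} \<and> x \<in> ?W \<and> x \<in> nb p"
    if h: "h \<in> edges N" "ends N h = {p, q}" and k: "k \<in> edges N" "ends N k = {p, r}" and hk: "h \<noteq> k"
      and p: "p \<in> verts N" and T: "?T = {p, q, r, z}" and z: "z \<notin> nb p" for h k p q r z
  proof -
    have i: "h \<in> incident_edges N p" "k \<in> incident_edges N p" using h k by (auto simp: incident_edges_def)
    have "card (incident_edges N p) = 3" using N p by (simp add: conn3_def cubic_def)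
    then have "card (incident_edges N p - {h, k}) = 1" using i hk l by (simp add: card_Diff_subset)
    then obtain f where f: "incident_edges N p - {h, k} = {f}" by (metis card_1_singletonE)
    then have inc: "incident_edges N p = {h, k, f}" and fhk: "f \<noteq> h" "f \<noteq> k" using i by auto
    have fE: "f \<in> edges N" "p \<in> ends N f" using f by (auto simp: incident_edges_def)
    obtain x where x: "ends N f = {p, x}" "x \<in> verts N" "x \<noteq> p"
      by (rule loopless_other_end[OF l fE])
    have "x \<noteq> q" using no_parallel[OF fE(1) h(1)] x h fhk by auto
    moreover have "x \<noteq> r" using no_parallel[OF fE(1) k(1)] x k fhk by auto
    moreover have xn: "x \<in> nb p" using x fE by (auto simp: nb_def)
    moreover have "x \<noteq> z" using xn z by blast
    ultimately show ?thesis using inc fhk x T by blast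
  qed
  have eq: "e1 \<noteq> e4" "e1 \<noteq> e2" "e3 \<noteq> e2" "e3 \<noteq> e4" "e2 \<noteq> e4" "e1 \<noteq> e3"
    using e n ne by (auto simp: doubleton_eq_iff)
  have sw: "ends N e1 = {b, a}" "ends N e2 = {c, b}" "ends N e3 = {d, c}" "ends N e4 = {a, d}" using e by auto
  have chord': "c \<notin> nb a" "d \<notin> nb b" using chord nb_sym by blast+
  obtain fa a' where fa: "incident_edges N a = {e1, e4, fa}" "fa \<noteq> e1" "fa \<noteq> e4" "ends N fa = {a, a'}" "a' \<in> ?W" "a' \<in> nb a"
    using out[OF e(1,2) e(7) sw(4) eq(1), of c] n chord' by auto
  obtain fb b' where fb: "incident_edges N b = {e1, e2, fb}" "fb \<noteq> e1" "fb \<noteq> e2" "ends N fb = {b, b'}" "b' \<in> ?W" "b' \<in> nb b"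
    using out[OF e(1) sw(1) e(3,4) eq(2), of d] n chord' by auto
  obtain fc c' where fc: "incident_edges N c = {e3, e2, fc}" "fc \<noteq> e3" "fc \<noteq> e2" "ends N fc = {c, c'}" "c' \<in> ?W" "c' \<in> nb c"
    using out[OF e(5,6) e(3) sw(2) eq(3), of a] n chord by auto
  obtain fd d' where fd: "incident_edges N d = {e3, e4, fd}" "fd \<noteq> e3" "fd \<noteq> e4" "ends N fd = {d, d'}" "d' \<in> ?W" "d' \<in> nb d"
    using out[OF e(5) sw(3) e(7,8) eq(4), of b] n chord by auto
  have ad': "a' \<noteq> d'" using no_triangle[OF nb_sym[OF da] fa(6)] fd(6) by blast
  have bc': "b' \<noteq> c'" using no_triangle[OF bc fb(6)] fc(6) by blast
  have fE: "fa \<in> edges N" "fb \<in> edges N" "fc \<in> edges N" "fd \<in> edges N"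
    using fa(1) fb(1) fc(1) fd(1) unfolding incident_edges_def by blast+
  have T4: "a \<noteq> b" "b \<noteq> c" "c \<noteq> d" "d \<noteq> a" using n by auto
  have out4: "a' \<notin> ?T" "b' \<notin> ?T" "c' \<notin> ?T" "d' \<notin> ?T" using fa fb fc fd by auto
  have fdist: "fa \<noteq> fb" "fa \<noteq> fc" "fa \<noteq> fd" "fb \<noteq> fc" "fb \<noteq> fd" "fc \<noteq> fd"
    using fa(4) fb(4) fc(4) fd(4) out4 T4 ne by (auto simp: doubleton_eq_iff)
  \<comment> \<open>The deleted edges are \<open>e1\<close> and \<open>e3\<close>; the path through
    \<open>a\<close> and \<open>d\<close> becomes the edge \<open>fa\<close>, and the path through
    \<open>b\<close> and \<open>c\<close> becomes the edge \<open>fb\<close>.\<close>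
  define \<rho> where "\<rho> = (\<lambda>e. if e = fd then fa else if e = fc then fb else e)"
  let ?R = "reduct N ?W \<rho>"
  have WV: "?W \<subseteq> verts N" by auto
  have inside: "ends N g \<subseteq> ?W" if g: "g \<in> edges N" "g \<notin> {e1, e2, e3, e4, fa, fb, fc, fd}" for g
  proof -
    have "g \<notin> incident_edges N a" "g \<notin> incident_edges N b" "g \<notin> incident_edges N c" "g \<notin> incident_edges N d"
      using g(2) fa(1) fb(1) fc(1) fd(1) by auto
    then show ?thesis using g(1) l by (auto simp: incident_edges_def loopless_graph_def)
  qed
  have notin: "ends N e1 \<inter> ?W = {}" "ends N e2 \<inter> ?W = {}" "ends N e3 \<inter> ?W = {}" "ends N e4 \<inter> ?W = {}"
    using e by auto
  have Rends: "ends ?R (\<rho> g) = (if g \<in> {fa, fd} then {a', d'} else if g \<in> {fb, fc} then {b', c'} else ends N g)"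
    if g: "g \<in> edges N" "ends N g \<inter> ?W \<noteq> {}" for g
  proof -
    have *: "ends ?R (\<rho> g) = ?W \<inter> \<Union> (ends N ` {h \<in> edges N. \<rho> h = \<rho> g})" by (simp add: reduct_ends)
    consider "g \<in> {fa, fd}" | "g \<in> {fb, fc}" | "g \<notin> {fa, fb, fc, fd}" by blast
    then show ?thesis
    proof cases
      case 1
      then have "{h \<in> edges N. \<rho> h = \<rho> g} = {fa, fd}" using fE fdist by (auto simp: \<rho>_def)
      then have "ends ?R (\<rho> g) = ?W \<inter> ({a, a'} \<union> {d, d'})" unfolding * using fa fd by auto
      also have "\<dots> = {a', d'}" using fa(5) fd(5) by auto
      finally show ?thesis using 1 by simp
    next
      case 2
      then have "{h \<in> edges N. \<rho> h = \<rho> g} = {fb, fc}" using fE fdist by (auto simp: \<rho>_def)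
      then have "ends ?R (\<rho> g) = ?W \<inter> ({b, b'} \<union> {c, c'})" unfolding * using fb fc by auto
      also have "\<dots> = {b', c'}" using fb(5) fc(5) by auto
      finally show ?thesis using 2 fdist by auto
    next
      case 3
      then have "{h \<in> edges N. \<rho> h = \<rho> g} = {g}" using g by (auto simp: \<rho>_def)
      then have "ends ?R (\<rho> g) = ?W \<inter> ends N g" unfolding * by simp
      moreover have "g \<notin> {e1, e2, e3, e4}" using g(2) notin by auto
      then have "ends N g \<subseteq> ?W" using inside[OF g(1)] 3 by blast
      ultimately show ?thesis using 3 by auto
    qed
  qed
  have fends: "fa \<in> incident_edges N w \<longleftrightarrow> w = a'" "fb \<in> incident_edges N w \<longleftrightarrow> w = b'"
    "fc \<in> incident_edges N w \<longleftrightarrow> w = c'" "fd \<in> incident_edges N w \<longleftrightarrow> w = d'" if "w \<in> ?W" for w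
    using that fE fa(4) fb(4) fc(4) fd(4) by (auto simp: incident_edges_def)
  have inj: "inj_on \<rho> (incident_edges N w)" if w: "w \<in> ?W" for w
  proof -
    have "\<not> (fa \<in> incident_edges N w \<and> fd \<in> incident_edges N w)" "\<not> (fb \<in> incident_edges N w \<and> fc \<in> incident_edges N w)"
      using fends[OF w] ad' bc' by auto
    then show ?thesis using fdist unfolding inj_on_def \<rho>_def by metis
  qed
  have cubR: "cubic ?R"
  proof (rule reduct_cubic[OF conn3_cubic[OF N] WV inj])
    fix g assume g: "g \<in> edges N" "ends N g \<inter> ?W \<noteq> {}"
    show "card (ends ?R (\<rho> g)) = 2"
      using Rends[OF g] ad' bc' l g(1) by (auto simp: loopless_graph_def)
  qed
  have finR: "finite (edge_cut ?R Y)" for Y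
    using loopless_finite(2)[OF l] by (auto simp: edge_cut_def reduct_edges)
  have cutR: "2 \<le> card (edge_cut ?R Y)" if Y: "Y \<subseteq> ?W" "Y \<noteq> {}" "Y \<noteq> ?W" for Y
  proof -
    \<comment> \<open>A suppressed path is added to \<open>Y\<close> only if both its outer ends lie
      there. Then \<open>e2\<close> and \<open>e4\<close> never cross, and each path contributes as
      many crossing edges as its merged edge, so only \<open>e1\<close> and \<open>e3\<close> can
      get lost.\<close>
    define Z where "Z = Y \<union> (if a' \<in> Y \<and> d' \<in> Y then {a, d} else {}) \<union> (if b' \<in> Y \<and> c' \<in> Y then {b, c} else {})"
    have ZV: "Z \<subseteq> verts N" using Y n by (auto simp: Z_def)
    have YZ: "w \<in> Z \<longleftrightarrow> w \<in> Y" if "w \<in> ?W" for w using that by (auto simp: Z_def)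
    have Zne: "Z \<noteq> {}" "Z \<noteq> verts N" using Y YZ by blast+
    have aZ: "a \<in> Z \<longleftrightarrow> a' \<in> Y \<and> d' \<in> Y" "d \<in> Z \<longleftrightarrow> a' \<in> Y \<and> d' \<in> Y"
      "b \<in> Z \<longleftrightarrow> b' \<in> Y \<and> c' \<in> Y" "c \<in> Z \<longleftrightarrow> b' \<in> Y \<and> c' \<in> Y"
      using Y T4 ne by (auto simp: Z_def)
    let ?C = "edge_cut N Z - {e1, e3}"
    have cutmem: "g \<in> edge_cut N Z \<longleftrightarrow> (p \<in> Z \<longleftrightarrow> q \<notin> Z)" if "g \<in> edges N" "ends N g = {p, q}" "p \<in> verts N" "q \<in> verts N" for g p q
      using that by (auto simp: edge_cut_def)
    have V4: "a \<in> verts N" "b \<in> verts N" "c \<in> verts N" "d \<in> verts N" using n by auto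
    have V4': "a' \<in> verts N" "b' \<in> verts N" "c' \<in> verts N" "d' \<in> verts N" using fa fb fc fd by auto
    have "fa \<in> edge_cut N Z \<longleftrightarrow> a' \<in> Y \<and> d' \<notin> Y"
      using cutmem[OF fE(1) fa(4) V4(1) V4'(1)] aZ(1) YZ[OF fa(5)] by blast
    moreover have "fd \<in> edge_cut N Z \<longleftrightarrow> a' \<notin> Y \<and> d' \<in> Y"
      using cutmem[OF fE(4) fd(4) V4(4) V4'(4)] aZ(2) YZ[OF fd(5)] by blast
    moreover have "fb \<in> edge_cut N Z \<longleftrightarrow> b' \<in> Y \<and> c' \<notin> Y"
      using cutmem[OF fE(2) fb(4) V4(2) V4'(2)] aZ(3) YZ[OF fb(5)] by blast
    moreover have "fc \<in> edge_cut N Z \<longleftrightarrow> b' \<notin> Y \<and> c' \<in> Y"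
      using cutmem[OF fE(3) fc(4) V4(3) V4'(3)] aZ(4) YZ[OF fc(5)] by blast
    moreover have "e2 \<notin> edge_cut N Z" using cutmem[OF e(3,4) V4(2,3)] aZ(3,4) by blast
    moreover have "e4 \<notin> edge_cut N Z" using cutmem[OF e(7,8) V4(4,1)] aZ(1,2) by blast
    ultimately have fcut: "fa \<in> edge_cut N Z \<longleftrightarrow> a' \<in> Y \<and> d' \<notin> Y" "fd \<in> edge_cut N Z \<longleftrightarrow> a' \<notin> Y \<and> d' \<in> Y"
      "fb \<in> edge_cut N Z \<longleftrightarrow> b' \<in> Y \<and> c' \<notin> Y" "fc \<in> edge_cut N Z \<longleftrightarrow> b' \<notin> Y \<and> c' \<in> Y"
      "e2 \<notin> edge_cut N Z" "e4 \<notin> edge_cut N Z" by simp_all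
    have sub: "\<rho> ` ?C \<subseteq> edge_cut ?R Y"
    proof
      fix h assume "h \<in> \<rho> ` ?C"
      then obtain g where g: "g \<in> edge_cut N Z" "g \<noteq> e1" "g \<noteq> e3" "h = \<rho> g" by blast
      have gE: "g \<in> edges N" using g(1) by (simp add: edge_cut_def)
      have g24: "g \<noteq> e2" "g \<noteq> e4" using fcut g(1) by auto
      have meet: "ends N g \<inter> ?W \<noteq> {}"
      proof (cases "g \<in> {fa, fb, fc, fd}")
        case True
        then show ?thesis using fa fb fc fd by auto
      next
        case False
        then have "ends N g \<subseteq> ?W" using inside[OF gE] g g24 by blast
        moreover have "ends N g \<noteq> {}" using loopless_ends[OF l gE] by (metis insert_not_empty)
        ultimately show ?thesis by blast
      qed
      have hE: "h \<in> edges ?R" unfolding reduct_edges g(4) using gE meet by blast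
      have "\<exists>p q. p \<in> ends ?R h \<and> p \<in> Y \<and> q \<in> ends ?R h \<and> q \<in> ?W \<and> q \<notin> Y"
      proof -
        consider "g \<in> {fa, fd}" | "g \<in> {fb, fc}" | "g \<notin> {fa, fb, fc, fd}" by blast
        then show ?thesis
        proof cases
          case 1
          then have "ends ?R h = {a', d'}" using Rends[OF gE meet] g(4) by simp
          then show ?thesis using 1 g(1) fcut fa(5) fd(5) by auto
        next
          case 2
          then have "ends ?R h = {b', c'}" using Rends[OF gE meet] g(4) fdist by auto
          then show ?thesis using 2 g(1) fcut fb(5) fc(5) by auto
        next
          case 3
          then have "ends ?R h = ends N g" using Rends[OF gE meet] g(4) by simp
          moreover have gW: "ends N g \<subseteq> ?W" using inside[OF gE] 3 g g24 by blast
          moreover obtain p q where "p \<in> ends N g" "p \<in> Z" "q \<in> ends N g" "q \<notin> Z"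
            using g(1) unfolding edge_cut_def by blast
          ultimately show ?thesis using YZ by blast
        qed
      qed
      then show "h \<in> edge_cut ?R Y" using hE by (auto simp: edge_cut_def)
    qed
    have "inj_on \<rho> ?C"
      using fcut fdist unfolding inj_on_def \<rho>_def by (metis DiffD1)
    then have le: "card ?C \<le> card (edge_cut ?R Y)"
      using sub finR[of Y] by (metis card_image card_mono)
    show ?thesis
    proof (cases "a \<in> Z \<longleftrightarrow> b \<in> Z")
      case True
      then have "e1 \<notin> edge_cut N Z" "e3 \<notin> edge_cut N Z"
        using cutmem[OF e(1,2) V4(1,2)] cutmem[OF e(5,6) V4(3,4)] aZ by auto
      then have "?C = edge_cut N Z" by blast
      then show ?thesis using le conn3_cut[OF N ZV Zne] by simp
    next
      \<comment> \<open>Now both \<open>e1\<close> and \<open>e3\<close> cross and are lost, but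
        \<open>Z\<close> and its complement have at least two vertices each, so the cut started with
        four edges.\<close>
      case False
      have two: "2 \<le> card S" if "p \<in> S" "q \<in> S" "p \<noteq> q" "S \<subseteq> verts N" for S and p q :: 'v
        using that fin by (metis card_2_iff card_mono empty_subsetI finite_subset insert_subset)
      have "2 \<le> card Z" "2 \<le> card (verts N - Z)"
        using False aZ two[of a Z d] two[of b Z c] two[of a "verts N - Z" d] two[of b "verts N - Z" c] ZV V4 T4 by auto
      then have "4 \<le> card (edge_cut N Z)" by (rule cut_ge_4[OF ZV])
      moreover have "card (edge_cut N Z) - card {e1, e3} \<le> card ?C" by (rule diff_card_le_card_Diff) simp
      ultimately show ?thesis using le eq(6) by simp
    qed
  qed
  have "?W \<noteq> {}" using fa(5) by blast
  then have R: "conn3 ?R" using cubR cutR by (simp add: conn3_def)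
  have "card ?W < card (verts N)" using n fin by (intro psubset_card_mono) auto
  then have "class1 ?R" using smaller[OF R] by simp
  then obtain k where k: "\<And>w. w \<in> ?W \<Longrightarrow> bij_betw k (incident_edges ?R w) {0, 1, 2 :: nat}"
    unfolding class1_def reduct_verts by blast
  have kr: "bij_betw (k \<circ> \<rho>) (incident_edges N w) {0, 1, 2}" if w: "w \<in> ?W" for w
  proof -
    have "bij_betw \<rho> (incident_edges N w) (incident_edges ?R w)"
      unfolding bij_betw_def reduct_incident[OF w] using inj[OF w] by simp
    then show ?thesis using k[OF w] by (rule bij_betw_trans)
  qed
  define \<alpha> where "\<alpha> = k fa"
  define \<beta> where "\<beta> = k fb"
  have ab: "\<alpha> \<in> {0, 1, 2}" "\<beta> \<in> {0, 1, 2}"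
    using bij_betw_apply[OF kr[OF fa(5)], of fa] bij_betw_apply[OF kr[OF fb(5)], of fb] fends fa(5) fb(5) fdist
    by (simp_all add: \<alpha>_def \<beta>_def \<rho>_def)
  \<comment> \<open>A colour that differs from those of both merged edges goes to \<open>e1\<close>
    and \<open>e3\<close>; then \<open>e4\<close> and \<open>e2\<close> each have one colour left,
    the same at both of their ends.\<close>
  have "\<exists>k1\<in>{0, 1, 2}. k1 \<noteq> \<alpha> \<and> k1 \<noteq> \<beta>"
    by (cases "\<alpha> = 0 \<or> \<beta> = 0"; cases "\<alpha> = 1 \<or> \<beta> = 1") auto
  then obtain k1 where k1: "k1 \<in> {0, 1, 2}" "k1 \<noteq> \<alpha>" "k1 \<noteq> \<beta>" by blast
  \<comment> \<open>The three colours sum to 3, so \<open>3 - x - y\<close> is the remaining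
    one.\<close>
  have rest: "{x, 3 - x - y, y} = {0, 1, 2}" if "x \<in> {0, 1, 2}" "y \<in> {0, 1, 2}" "x \<noteq> y" for x y :: nat
    using that by auto
  define k4 where "k4 = 3 - k1 - \<alpha>"
  define k2 where "k2 = 3 - k1 - \<beta>"
  have k124: "{k1, k4, \<alpha>} = {0, 1, 2}" "{k1, k2, \<beta>} = {0, 1, 2 :: nat}"
    using rest[OF k1(1) ab(1) k1(2)] rest[OF k1(1) ab(2) k1(3)] by (simp_all add: k4_def k2_def)
  define col where "col g = (if g = e1 \<or> g = e3 then k1 else if g = e2 then k2 else if g = e4 then k4 else k (\<rho> g))" for g
  have fe: "fa \<notin> {e1, e2, e3, e4}" "fb \<notin> {e1, e2, e3, e4}" "fc \<notin> {e1, e2, e3, e4}" "fd \<notin> {e1, e2, e3, e4}"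
  proof -
    have ne: "f \<notin> {e1, e2, e3, e4}" if "ends N f = {p, x}" "x \<in> ?W" for f p x
    proof -
      have "x \<in> ends N f \<inter> ?W" using that by simp
      then show ?thesis using notin by (metis empty_iff insertE)
    qed
    show "fa \<notin> {e1, e2, e3, e4}" "fb \<notin> {e1, e2, e3, e4}" "fc \<notin> {e1, e2, e3, e4}" "fd \<notin> {e1, e2, e3, e4}"
      by (rule ne[OF fa(4,5)], rule ne[OF fb(4,5)], rule ne[OF fc(4,5)], rule ne[OF fd(4,5)])
  qed
  have colf: "col fa = \<alpha>" "col fb = \<beta>" "col fc = \<beta>" "col fd = \<alpha>"
    using fe fdist by (auto simp: col_def \<rho>_def \<alpha>_def \<beta>_def)
  have cole: "col e1 = k1" "col e2 = k2" "col e3 = k1" "col e4 = k4"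
    using eq by (auto simp: col_def)
  have c3: "card (incident_edges N v) = 3" if "v \<in> verts N" for v
    using N that by (simp add: conn3_def cubic_def)
  have "bij_betw col (incident_edges N v) {0, 1, 2}" if v: "v \<in> verts N" for v
  proof (cases "v \<in> ?W")
    case True
    have "(k \<circ> \<rho>) g = col g" if "g \<in> incident_edges N v" for g
    proof -
      have "g \<notin> {e1, e2, e3, e4}" using that True notin by (auto simp: incident_edges_def)
      then show ?thesis by (simp add: col_def)
    qed
    then show ?thesis by (rule bij_betw_eqI[OF kr[OF True]])
  next
    case False
    have "col ` incident_edges N v = {0, 1, 2}"
    proof -
      consider "v = a" | "v = b" | "v = c" | "v = d" using False v by blast
      then show ?thesis
        by cases (simp_all only: fa(1) fb(1) fc(1) fd(1) image_insert image_empty colf cole k124)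
    qed
    then show ?thesis by (rule bij_betw_3[OF c3[OF v]])
  qed
  then show False using two unfolding class1_def by blast
qed

text \<open>The Moore bound for girth 5.\<close>

lemma order_ge_10: "10 \<le> card (verts N)"
proof -
  obtain v where v: "v \<in> verts N" using N by (auto simp: conn3_def)
  let ?B = "\<Union>x\<in>nb v. nb x - {v}"
  have sub: "nb u \<subseteq> verts N" for u using nb_verts by blast
  have fnb: "finite (nb u)" for u using sub fin finite_subset by blast
  have disj: "(nb x - {v}) \<inter> (nb y - {v}) = {}" if xy: "x \<in> nb v" "y \<in> nb v" "x \<noteq> y" for x y
  proof (rule ccontr)
    assume "(nb x - {v}) \<inter> (nb y - {v}) \<noteq> {}"
    then obtain z where z: "z \<in> nb x" "z \<in> nb y" "z \<noteq> v" by blast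
    show False using no_four_cycle[OF xy(1) z(1) nb_sym[OF z(2)] nb_sym[OF xy(2)]] z(3) xy(3) by blast
  qed
  have c2: "card (nb x - {v}) = 2" if "x \<in> nb v" for x
    using card_nb[of x] nb_verts[OF that] nb_sym[OF that] fnb by simp
  have "card ?B = (\<Sum>x\<in>nb v. card (nb x - {v}))"
    by (rule card_UN_disjoint) (use fnb disj in auto)
  also have "\<dots> = 6" using c2 card_nb[OF v] by simp
  finally have B: "card ?B = 6" .
  have "nb v \<inter> ?B = {}" using no_triangle by blast
  then have "card (nb v \<union> ?B) = 9" using B card_nb[OF v] fnb by (simp add: card_Un_disjoint)
  moreover have "v \<notin> nb v \<union> ?B" using nb_verts by blast
  ultimately have "card (insert v (nb v \<union> ?B)) = 10" using fnb by simp
  moreover have "insert v (nb v \<union> ?B) \<subseteq> verts N" using v sub by blast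
  ultimately show ?thesis using fin by (metis card_mono)
qed

end

theorem class2_order_ge_10:
  fixes G :: "('v, 'e) mgraph"
  assumes "conn3 G" "\<not> class1 G"
  shows "10 \<le> card (verts G)"
proof -
  let ?P = "\<lambda>G :: ('v, 'e) mgraph. conn3 G \<and> \<not> class1 G"
  obtain N where m: "?P N" "\<And>H. ?P H \<Longrightarrow> card (verts N) \<le> card (verts H)"
    using arg_min_nat_lemma[of ?P G "\<lambda>G. card (verts G)"] assms by blast
  interpret minimal_class2 N using m by unfold_locales (auto simp: not_le[symmetric])
  show ?thesis using order_ge_10 m(2)[of G] assms by simp
qed

section \<open>Graphs that are colored only by themselves\<close>

text \<open>Letting \<open>K\<close> range over \<open>nat_graph\<close> covers all types, since by
  \<open>nat_graph_exists\<close> every finite graph has an isomorphic copy there.\<close>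

definition rigid :: "('v, 'e) mgraph \<Rightarrow> bool" where
  "rigid G \<longleftrightarrow> conn3 G \<and> (\<forall>K :: nat_graph. conn3 K \<longrightarrow> colors K G \<longrightarrow> isomorphic G K)"

lemma rigidD: "rigid G \<Longrightarrow> conn3 (K :: nat_graph) \<Longrightarrow> colors K G \<Longrightarrow> isomorphic G K"
  by (simp add: rigid_def)

lemma rigid_conn3: "rigid G \<Longrightarrow> conn3 G"
  by (simp add: rigid_def)

lemma rigid_card: "rigid G \<Longrightarrow> conn3 (K :: nat_graph) \<Longrightarrow> colors K G \<Longrightarrow> card (verts K) = card (verts G)"
  using rigidD isomorphic_card by metis

lemma colors_iso_left:
  assumes "conn3 K" "isomorphic K K'" "colors K G"
  shows "colors K' G"
  using colors_trans[OF isomorphic_colors[OF conn3_loopless[OF assms(1)] assms(2)] assms(3)] .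

lemma colors_iso_sym:
  assumes "conn3 K" "isomorphic K K'"
  shows "colors K K'"
  using isomorphic_colors[OF isomorphic_loopless[OF conn3_loopless[OF assms(1)] assms(2)]
      isomorphic_sym[OF conn3_loopless[OF assms(1)] assms(2)]] .

lemma rigid_iso:
  assumes "rigid G" "isomorphic G H"
  shows "rigid H"
  unfolding rigid_def
proof (intro conjI allI impI)
  note G = rigid_conn3[OF assms(1)]
  show "conn3 H" using isomorphic_conn3[OF G assms(2)] .
  fix K :: nat_graph assume K: "conn3 K" "colors K H"
  have "colors K G"
    using colors_trans[OF K(2) isomorphic_colors[OF conn3_loopless[OF G] assms(2)]] .
  then have "isomorphic G K" using rigidD[OF assms(1) K(1)] by simp
  show "isomorphic H K"
    by (rule isomorphic_trans[OF isomorphic_sym[OF conn3_loopless[OF G] assms(2)] \<open>isomorphic G K\<close>])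
qed

lemma rigid_exists:
  assumes G: "conn3 G" "\<not> class1 G"
  obtains H :: nat_graph where "rigid H" "colors H G" "\<not> class1 H"
proof -
  let ?P = "\<lambda>H :: nat_graph. conn3 H \<and> colors H G"
  obtain G' :: nat_graph where G': "isomorphic G G'" using nat_graph_exists[OF conn3_loopless[OF G(1)]] by blast
  then have "?P G'" using isomorphic_conn3[OF G(1)] isomorphic_colors[OF conn3_loopless[OF G(1)]] by blast
  then obtain H where H: "?P H" "\<And>K. ?P K \<Longrightarrow> card (verts H) \<le> card (verts K)"
    using arg_min_nat_lemma[of ?P G' "\<lambda>H. card (verts H)"] by blast
  have n1: "\<not> class1 H" using H(1) G(2) colors_class1 by blast
  have "isomorphic H K" if K: "conn3 K" "colors K H" for K :: nat_graph
  proof -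
    have cH: "conn3 H" using H by simp
    obtain \<phi> f where "vcol K H \<phi> f" using K(2) colors_iff_vcol[OF conn3_loopless[OF cH]] by blast
    from coloring_iso_or_smaller[OF cH n1 K(1) this] show ?thesis
    proof
      assume "\<exists>K' :: nat_graph. conn3 K' \<and> colors K' H \<and> card (verts K') < card (verts H)"
      then obtain K' :: nat_graph where "conn3 K'" "colors K' H" "card (verts K') < card (verts H)" by blast
      then show ?thesis using H colors_trans by (metis not_le)
    qed simp
  qed
  then have "rigid H" using H by (simp add: rigid_def)
  then show ?thesis using that H n1 by blast
qed

text \<open>The choice depends only on the isomorphism class (\<open>rep_eq\<close>), so the image
  of \<open>rep\<close> has one graph per class. A minimal 3-complete set cannot afford two
  isomorphic members.\<close>

definition rep :: "nat_graph \<Rightarrow> nat_graph" where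
  "rep H = (SOME K. isomorphic H K)"

lemma rep: "isomorphic H (rep H)"
  unfolding rep_def by (rule someI[of _ H]) (rule isomorphic_refl)

lemma iso_class_eq:
  assumes "conn3 H" "isomorphic H K"
  shows "iso_class H = iso_class K"
  using isomorphic_trans[OF assms(2)] isomorphic_trans[OF isomorphic_sym[OF conn3_loopless[OF assms(1)] assms(2)]]
  unfolding iso_class_def by blast

lemma rep_eq: "conn3 H \<Longrightarrow> isomorphic H K \<Longrightarrow> rep H = rep K"
proof -
  assume "conn3 H" "isomorphic H K"
  then have "{X :: nat_graph. isomorphic H X} = {X. isomorphic K X}" using iso_class_eq[of H K] by (simp add: iso_class_def)
  then have "(isomorphic H :: nat_graph \<Rightarrow> bool) = isomorphic K" by (simp add: set_eq_iff fun_eq_iff)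
  then show ?thesis by (simp add: rep_def)
qed

lemma three_complete_iff:
  "three_complete S \<longleftrightarrow> (\<forall>H\<in>S. conn3 H) \<and> (\<forall>G :: nat_graph. conn3 G \<longrightarrow> (\<exists>H\<in>S. colors H G))"
  by (simp add: three_complete_def conn3_iff)

lemma infinite_card:
  assumes big: "\<And>n. \<exists>H\<in>A. n \<le> card (verts H)"
  shows "infinite (iso_class ` A)"
proof
  assume fin: "finite (iso_class ` A)"
  let ?c = "\<lambda>C. card (verts (SOME K :: nat_graph. K \<in> C))"
  have "?c (iso_class H) = card (verts H)" for H
  proof -
    define k where "k = (SOME K :: nat_graph. K \<in> iso_class H)"
    have "H \<in> iso_class H" by (simp add: iso_class_def isomorphic_refl)
    then have "k \<in> iso_class H" unfolding k_def by (rule someI)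
    then have "isomorphic H k" by (simp add: iso_class_def)
    then show ?thesis using isomorphic_card[of H k] by (simp add: k_def)
  qed
  then have "(\<lambda>H. card (verts H)) ` A = ?c ` iso_class ` A" by (simp add: image_image)
  then have "finite ((\<lambda>H. card (verts H)) ` A)" using fin by simp
  then obtain m where "\<forall>H\<in>A. card (verts H) \<le> m" by (auto simp: finite_nat_set_iff_bounded_le)
  then show False using big[of "Suc m"] by fastforce
qed

text \<open>A rigid graph is coloured only by its copies, so every 3-complete set contains one of
  them; conversely, rigid graphs colour everything of class 2 by \<open>rigid_exists\<close>. The
  graph \<open>C\<close> ensures that there is a rigid graph at all, and any such graph colours the
  graphs of class 1.\<close>

lemma H3_eq:
  assumes C: "conn3 (C :: nat_graph)" "\<not> class1 C"
  shows "H3 = iso_class ` {H :: nat_graph. rigid H}"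
proof -
  let ?R = "{H :: nat_graph. rigid H}"
  let ?S = "rep ` ?R"
  have Sr: "rigid H" if "H \<in> ?S" for H using that rigid_iso rep by blast
  have Sclass: "iso_class ` ?S = iso_class ` ?R"
    using iso_class_eq[OF rigid_conn3 rep] by (force simp: image_image)
  have Scomp: "three_complete ?S"
    unfolding three_complete_iff
  proof (intro conjI ballI allI impI)
    show "conn3 H" if "H \<in> ?S" for H using Sr[OF that] rigid_conn3 by blast
    fix G :: nat_graph assume G: "conn3 G"
    have "\<exists>H\<in>?R. colors H G"
    proof (cases "class1 G")
      case True
      obtain H :: nat_graph where "rigid H" using rigid_exists[OF C] by metis
      then show ?thesis using class1_colors[OF conn3_loopless[OF G] True, of H] rigid_conn3[of H]
        by (auto simp: conn3_def)
    next
      case False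
      then show ?thesis using rigid_exists[OF G] by blast
    qed
    then show "\<exists>H\<in>?S. colors H G" using colors_iso_left[OF rigid_conn3 rep] by blast
  qed
  have "minimal_three_complete ?S"
    unfolding minimal_three_complete_def
  proof (intro conjI allI impI notI)
    fix T assume T: "T \<subset> ?S" "three_complete T"
    then obtain H where H: "rigid H" "rep H \<notin> T" by blast
    have rr: "rigid (rep H)" using Sr H by blast
    obtain K where K: "K \<in> T" "colors K (rep H)" using T(2) rigid_conn3[OF rr] unfolding three_complete_iff by blast
    have cK: "conn3 K" using T(2) K(1) unfolding three_complete_iff by blast
    have "isomorphic (rep H) K" using rigidD[OF rr cK K(2)] .
    then have "isomorphic H K" using isomorphic_trans[OF rep] by blast
    obtain K' where K': "rigid K'" "K = rep K'" using K(1) T(1) by blast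
    have "rep H = rep K" using rep_eq[OF rigid_conn3[OF H(1)] \<open>isomorphic H K\<close>] .
    also have "\<dots> = K" using rep_eq[OF rigid_conn3[OF K'(1)] rep] K'(2) by simp
    finally show False using K(1) H(2) by simp
  qed (rule Scomp)
  moreover have "iso_class ` S = iso_class ` ?R" if S: "minimal_three_complete S" for S
  proof -
    have Sc: "three_complete S" and min: "\<And>T. T \<subset> S \<Longrightarrow> \<not> three_complete T"
      using S by (auto simp: minimal_three_complete_def)
    have hit: "\<exists>K\<in>S. isomorphic H K \<and> colors K H" if H: "rigid H" for H :: nat_graph
      using Sc rigidD[OF H] rigid_conn3[OF H] unfolding three_complete_iff by blast
    \<comment> \<open>The rigid members alone are already 3-complete, so minimality leaves no
      others.\<close>
    have "three_complete {K \<in> S. rigid K}"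
      unfolding three_complete_iff
    proof (intro conjI ballI allI impI)
      show "conn3 K" if "K \<in> {K \<in> S. rigid K}" for K using that rigid_conn3 by blast
      fix G :: nat_graph assume "conn3 G"
      then have "\<exists>H\<in>?S. colors H G" using Scomp unfolding three_complete_iff by blast
      then obtain H where H: "H \<in> ?S" "colors H G" by (elim bexE)
      have rH: "rigid H" using Sr[OF H(1)] .
      obtain K where K: "K \<in> S" "isomorphic H K" "colors K H" using hit[OF rH] by (elim bexE conjE)
      have "rigid K" "colors K G" using rigid_iso[OF rH K(2)] colors_trans[OF K(3) H(2)] by simp_all
      then show "\<exists>K\<in>{K \<in> S. rigid K}. colors K G" using K(1) by blast
    qed
    then have "{K \<in> S. rigid K} = S" using min[of "{K \<in> S. rigid K}"] by blast
    then have all: "\<And>K. K \<in> S \<Longrightarrow> rigid K" by blast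
    show ?thesis
    proof
      show "iso_class ` S \<subseteq> iso_class ` ?R" using all by blast
      show "iso_class ` ?R \<subseteq> iso_class ` S"
      proof
        fix C assume "C \<in> iso_class ` ?R"
        then obtain H where H: "rigid H" "C = iso_class H" by blast
        obtain K where "K \<in> S" "isomorphic H K" using hit[OF H(1)] by (elim bexE conjE)
        then show "C \<in> iso_class ` S" using H(2) iso_class_eq[OF rigid_conn3[OF H(1)]] by simp
      qed
    qed
  qed
  ultimately show ?thesis unfolding H3_def
    using Sclass by (intro the_equality) (blast intro: sym, blast)
qed

section \<open>Inserting a graph into every edge\<close>

text \<open>The end \<open>s e\<close> orients \<open>e\<close>: the copy of \<open>x\<close> is
  attached to \<open>s e\<close> and the copy of \<open>y\<close> to the other end. Each edge
  \<open>e\<close> thereby falls into two half-edges \<open>Inl (e, v)\<close> with a copy of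
  \<open>M\<close> minus \<open>m\<close> between them.\<close>

locale insertion =
  fixes K :: "('v, 'e) mgraph" and M :: "('w, 'f) mgraph" and m :: 'f and x y :: 'w and s :: "'e \<Rightarrow> 'v"
  assumes K: "conn3 K" and M: "conn3 M" and m: "m \<in> edges M" "ends M m = {x, y}" "x \<noteq> y"
    and s: "\<And>e. e \<in> edges K \<Longrightarrow> s e \<in> ends K e"
begin

definition attach :: "'e \<Rightarrow> 'v \<Rightarrow> 'w" where
  "attach e v = (if v = s e then x else y)"

definition B :: "('v + 'e \<times> 'w, 'e \<times> 'v + 'e \<times> 'f) mgraph" where
  "B = \<lparr>verts = Inl ` verts K \<union> Inr ` (edges K \<times> verts M),
    edges = Inl ` {(e, v). e \<in> edges K \<and> v \<in> ends K e} \<union> Inr ` (edges K \<times> (edges M - {m})),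
    ends = (\<lambda>d. case d of Inl (e, v) \<Rightarrow> {Inl v, Inr (e, attach e v)} | Inr (e, h) \<Rightarrow> (\<lambda>w. Inr (e, w)) ` ends M h)\<rparr>"

lemma B_sel:
  "verts B = Inl ` verts K \<union> Inr ` (edges K \<times> verts M)"
  "edges B = Inl ` {(e, v). e \<in> edges K \<and> v \<in> ends K e} \<union> Inr ` (edges K \<times> (edges M - {m}))"
  "ends B (Inl (e, v)) = {Inl v, Inr (e, attach e v)}"
  "ends B (Inr (e, h)) = (\<lambda>w. Inr (e, w)) ` ends M h"
  by (simp_all add: B_def)

lemma B_edge_cases:
  "d \<in> edges B \<Longrightarrow> (\<exists>e v. d = Inl (e, v) \<and> e \<in> edges K \<and> v \<in> ends K e) \<or>
    (\<exists>e h. d = Inr (e, h) \<and> e \<in> edges K \<and> h \<in> edges M \<and> h \<noteq> m)"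
  by (auto simp: B_sel)

lemma lK: "loopless_graph K" and lM: "loopless_graph M"
  using K M conn3_loopless by auto

lemma xyV: "x \<in> verts M" "y \<in> verts M"
  using m lM by (auto simp: loopless_graph_def)

lemma attach_V: "attach e v \<in> verts M"
  using xyV by (simp add: attach_def)

lemma other:
  assumes "e \<in> edges K"
  obtains t where "ends K e = {s e, t}" "t \<noteq> s e" "t \<in> verts K" "s e \<in> verts K" "attach e (s e) = x" "attach e t = y"
proof -
  obtain t where "ends K e = {s e, t}" "t \<in> verts K" "t \<noteq> s e"
    by (rule loopless_other_end[OF lK assms s[OF assms]])
  moreover have "s e \<in> verts K" using s[OF assms] lK assms by (auto simp: loopless_graph_def)
  ultimately show ?thesis using that by (simp add: attach_def)
qed

lemma attach_surj:
  assumes e: "e \<in> edges K" and w: "w \<in> ends M m"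
  obtains v where "v \<in> ends K e" "w = attach e v"
proof -
  obtain t where t: "ends K e = {s e, t}" "attach e (s e) = x" "attach e t = y" by (rule other[OF e])
  show ?thesis using that[of "s e"] that[of t] t w m(2) by auto
qed

lemma B_loopless: "loopless_graph B"
proof -
  have "{(e, v). e \<in> edges K \<and> v \<in> ends K e} \<subseteq> edges K \<times> verts K"
    using lK by (auto simp: loopless_graph_def)
  then have fin: "finite {(e, v). e \<in> edges K \<and> v \<in> ends K e}"
    using loopless_finite[OF lK] finite_subset by blast
  have "ends B d \<subseteq> verts B \<and> card (ends B d) = 2" if d: "d \<in> edges B" for d
  proof (cases d)
    case (Inl p)
    then obtain e v where ev: "d = Inl (e, v)" "e \<in> edges K" "v \<in> ends K e" using d by (auto simp: B_sel)
    then have "v \<in> verts K" using lK by (auto simp: loopless_graph_def)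
    then show ?thesis using ev attach_V by (auto simp: B_sel)
  next
    case (Inr p)
    then obtain e h where eh: "d = Inr (e, h)" "e \<in> edges K" "h \<in> edges M" using d by (auto simp: B_sel)
    have "ends M h \<subseteq> verts M" "card (ends M h) = 2" using eh lM by (auto simp: loopless_graph_def)
    then show ?thesis using eh by (auto simp: B_sel card_image inj_on_def)
  qed
  then show ?thesis using fin loopless_finite[OF lK] loopless_finite[OF lM]
    unfolding loopless_graph_def by (auto simp: B_sel)
qed

lemma incident_Inl:
  assumes "v \<in> verts K"
  shows "incident_edges B (Inl v) = (\<lambda>e. Inl (e, v)) ` incident_edges K v"
  using assms by (auto simp: incident_edges_def B_sel)

text \<open>The star of a copy of \<open>w\<close>, where the edge \<open>m\<close> stands for the edge leaving the copy at \<open>w\<close>.\<close>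

definition copy_edge :: "'e \<Rightarrow> 'w \<Rightarrow> 'f \<Rightarrow> 'e \<times> 'v + 'e \<times> 'f" where
  "copy_edge e w h = (if h = m then Inl (e, THE v. v \<in> ends K e \<and> attach e v = w) else Inr (e, h))"

lemma copy_edge_m:
  assumes "e \<in> edges K" "v \<in> ends K e"
  shows "copy_edge e (attach e v) m = Inl (e, v)"
proof -
  obtain t where t: "ends K e = {s e, t}" "t \<noteq> s e" "attach e (s e) = x" "attach e t = y" by (rule other[OF assms(1)])
  have "(THE u. u \<in> ends K e \<and> attach e u = attach e v) = v"
    using assms(2) t m(3) by (intro the_equality) auto
  then show ?thesis by (simp add: copy_edge_def)
qed

lemma incident_Inr:
  assumes e: "e \<in> edges K" and w: "w \<in> verts M"
  shows "bij_betw (copy_edge e w) (incident_edges M w) (incident_edges B (Inr (e, w)))"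
proof -
  obtain t where t: "ends K e = {s e, t}" "t \<noteq> s e" "attach e (s e) = x" "attach e t = y" by (rule other[OF e])
  have inj: "inj_on (copy_edge e w) (incident_edges M w)"
    by (auto simp: inj_on_def copy_edge_def)
  have "copy_edge e w ` incident_edges M w = incident_edges B (Inr (e, w))"
  proof (rule set_eqI, rule iffI)
    fix d assume "d \<in> copy_edge e w ` incident_edges M w"
    then obtain h where h: "h \<in> edges M" "w \<in> ends M h" "d = copy_edge e w h" by (auto simp: incident_edges_def)
    show "d \<in> incident_edges B (Inr (e, w))"
    proof (cases "h = m")
      case True
      obtain v where v: "v \<in> ends K e" "w = attach e v"
        by (rule attach_surj[OF e]) (use h(2) True in auto)
      then show ?thesis using copy_edge_m[OF e v(1)] h True e by (auto simp: incident_edges_def B_sel)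
    next
      case False
      then show ?thesis using h e by (auto simp: incident_edges_def B_sel copy_edge_def)
    qed
  next
    fix d assume d: "d \<in> incident_edges B (Inr (e, w))"
    show "d \<in> copy_edge e w ` incident_edges M w"
    proof (cases d)
      case (Inl p)
      then obtain v where v: "d = Inl (e, v)" "v \<in> ends K e" "w = attach e v"
        using d by (auto simp: incident_edges_def B_sel)
      have "m \<in> incident_edges M w" using v(3) m by (auto simp: incident_edges_def attach_def)
      then show ?thesis using copy_edge_m[OF e v(2)] v by force
    next
      case (Inr p)
      then obtain e' h where h': "d = Inr (e', h)" "h \<in> edges M" "h \<noteq> m"
        using d B_edge_cases[of d] by (auto simp: incident_edges_def)
      then have h: "d = Inr (e, h)" "h \<in> edges M" "h \<noteq> m" "w \<in> ends M h"
        using d by (auto simp: incident_edges_def B_sel)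
      then have "h \<in> incident_edges M w" "copy_edge e w h = d" by (auto simp: incident_edges_def copy_edge_def)
      then show ?thesis by blast
    qed
  qed
  then show ?thesis using inj by (simp add: bij_betw_def)
qed

lemma B_cubic: "cubic B"
proof -
  have "card (incident_edges B z) = 3" if z: "z \<in> verts B" for z
  proof (cases z)
    case (Inl v)
    then have v: "v \<in> verts K" using z by (auto simp: B_sel)
    have "card ((\<lambda>e. Inl (e, v)) ` incident_edges K v) = card (incident_edges K v)"
      by (rule card_image) (auto simp: inj_on_def)
    then show ?thesis using incident_Inl[OF v] Inl v K by (simp add: conn3_def cubic_def)
  next
    case (Inr p)
    then obtain e w where ew: "z = Inr (e, w)" "e \<in> edges K" "w \<in> verts M" using z by (auto simp: B_sel)
    then show ?thesis using bij_betw_same_card[OF incident_Inr[OF ew(2,3)]] M by (simp add: conn3_def cubic_def)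
  qed
  then show ?thesis using B_loopless by (simp add: cubic_def)
qed

lemma B_card: "card (verts K) < card (verts B)"
proof -
  have fin: "finite (verts B)" using loopless_finite[OF B_loopless] by blast
  obtain v where v: "v \<in> verts K" using K by (auto simp: conn3_def)
  then have "incident_edges K v \<noteq> {}" using K by (auto simp: conn3_def cubic_def)
  then obtain e where "e \<in> edges K" by (auto simp: incident_edges_def)
  then have "Inr (e, x) \<in> verts B - Inl ` verts K" using xyV by (auto simp: B_sel)
  then have "Inl ` verts K \<subset> verts B" by (auto simp: B_sel)
  then have "card (Inl ` verts K :: ('v + 'e \<times> 'w) set) < card (verts B)" using fin by (rule psubset_card_mono[rotated])
  then show ?thesis by (simp add: card_image)
qed

text \<open>Every proper cut of \<open>M\<close> has two edges, so a set that splits the copy is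
  crossed by an edge other than \<open>m\<close>. If \<open>x\<close> and \<open>y\<close> are on
  the same side, \<open>m\<close> does not cross and all crossing edges of \<open>M\<close>
  survive.\<close>

lemma cut_in_copy:
  assumes e: "e \<in> edges K" and X: "X \<subseteq> verts B" and w: "w \<in> verts M" "w' \<in> verts M"
    and wX: "Inr (e, w) \<in> X" "Inr (e, w') \<notin> X"
  shows "\<exists>h \<in> edges M - {m}. Inr (e, h) \<in> edge_cut B X"
    and "(Inr (e, x) \<in> X \<longleftrightarrow> Inr (e, y) \<in> X) \<Longrightarrow> 2 \<le> card {d \<in> edge_cut B X. d \<in> Inr ` ({e} \<times> (edges M - {m}))}"
proof -
  let ?Y = "{w \<in> verts M. Inr (e, w) \<in> X}"
  have Y: "?Y \<subseteq> verts M" "?Y \<noteq> {}" "?Y \<noteq> verts M" using w wX by auto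
  have sub: "Inr (e, h) \<in> edge_cut B X" if h: "h \<in> edge_cut M ?Y" "h \<noteq> m" for h
  proof -
    obtain p q where pq: "h \<in> edges M" "ends M h = {p, q}" "p \<in> ?Y" "q \<in> verts M" "q \<notin> ?Y"
      by (rule edge_cutE[OF lM Y(1) h(1)])
    show ?thesis
      by (rule edge_cutI[where x = "Inr (e, p)" and y = "Inr (e, q)"]) (use pq e h in \<open>auto simp: B_sel\<close>)
  qed
  have ge: "2 \<le> card (edge_cut M ?Y)" using conn3_cut[OF M Y] .
  have "\<not> edge_cut M ?Y \<subseteq> {m}"
  proof
    assume "edge_cut M ?Y \<subseteq> {m}"
    then have "card (edge_cut M ?Y) \<le> card {m}" by (intro card_mono) auto
    then show False using ge by simp
  qed
  then obtain h where "h \<in> edge_cut M ?Y" "h \<noteq> m" by blast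
  then show "\<exists>h \<in> edges M - {m}. Inr (e, h) \<in> edge_cut B X"
    using sub by (auto simp: edge_cut_def)
  assume "Inr (e, x) \<in> X \<longleftrightarrow> Inr (e, y) \<in> X"
  then have "m \<notin> edge_cut M ?Y" using m xyV by (auto simp: edge_cut_def)
  then have "(\<lambda>h. Inr (e, h)) ` edge_cut M ?Y \<subseteq> {d \<in> edge_cut B X. d \<in> Inr ` ({e} \<times> (edges M - {m}))}"
    using sub by (auto simp: edge_cut_def)
  moreover have "finite {d \<in> edge_cut B X. d \<in> Inr ` ({e} \<times> (edges M - {m}))}"
    using B_loopless by simp
  ultimately have "card ((\<lambda>h. Inr (e, h) :: 'e \<times> 'v + 'e \<times> 'f) ` edge_cut M ?Y) \<le> card {d \<in> edge_cut B X. d \<in> Inr ` ({e} \<times> (edges M - {m}))}"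
    by (rule card_mono[rotated])
  moreover have "card ((\<lambda>h. Inr (e, h) :: 'e \<times> 'v + 'e \<times> 'f) ` edge_cut M ?Y) = card (edge_cut M ?Y)"
    by (rule card_image) (auto simp: inj_on_def)
  ultimately show "2 \<le> card {d \<in> edge_cut B X. d \<in> Inr ` ({e} \<times> (edges M - {m}))}" using ge by simp
qed

lemma B_cut_no_K:
  assumes X: "X \<subseteq> verts B" "X \<noteq> {}" and none: "\<And>v. v \<in> verts K \<Longrightarrow> Inl v \<notin> X"
  shows "2 \<le> card (edge_cut B X)"
proof -
  have finc: "finite (edge_cut B X)" using B_loopless by simp
  obtain z where z: "z \<in> X" using X by blast
  then obtain e w where ew: "z = Inr (e, w)" "e \<in> edges K" "w \<in> verts M" using X none by (auto simp: B_sel)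
  obtain t where t: "ends K e = {s e, t}" "t \<noteq> s e" "t \<in> verts K" "s e \<in> verts K" "attach e (s e) = x" "attach e t = y"
    by (rule other[OF ew(2)])
  have bx: "Inl (e, s e) \<in> edge_cut B X" if "Inr (e, x) \<in> X"
    by (rule edge_cutI[where x = "Inr (e, x)" and y = "Inl (s e)"]) (use that t ew none in \<open>auto simp: B_sel\<close>)
  have yx: "Inl (e, t) \<in> edge_cut B X" if "Inr (e, y) \<in> X"
    by (rule edge_cutI[where x = "Inr (e, y)" and y = "Inl t"]) (use that t ew none in \<open>auto simp: B_sel\<close>)
  have two: "2 \<le> card (edge_cut B X)" if "a \<in> edge_cut B X" "b \<in> edge_cut B X" "a \<noteq> b" for a b
    using that finc by (metis card_2_iff card_mono empty_subsetI insert_subset)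
  show ?thesis
  proof (cases "\<forall>w'\<in>verts M. Inr (e, w') \<in> X")
    case True
    then show ?thesis using two[OF bx yx] xyV t by auto
  next
    case False
    then obtain w' where w': "w' \<in> verts M" "Inr (e, w') \<notin> X" by blast
    note c = cut_in_copy[OF ew(2) X(1) ew(3) w'(1) _ w'(2)]
    obtain h where h: "Inr (e, h) \<in> edge_cut B X" using c(1) z ew by blast
    show ?thesis
    proof (cases "Inr (e, x) \<in> X \<longleftrightarrow> Inr (e, y) \<in> X")
      case True
      then have "2 \<le> card {d \<in> edge_cut B X. d \<in> Inr ` ({e} \<times> (edges M - {m}))}" using c(2) z ew by blast
      also have "\<dots> \<le> card (edge_cut B X)" using finc by (intro card_mono) auto
      finally show ?thesis .
    next
      case False
      then show ?thesis using two[OF h bx] two[OF h yx] by blast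
    qed
  qed
qed

lemma B_conn3: "conn3 B"
proof -
  have "2 \<le> card (edge_cut B X)" if X: "X \<subseteq> verts B" "X \<noteq> {}" "X \<noteq> verts B" for X
  proof -
    let ?Y = "{v \<in> verts K. Inl v \<in> X}"
    consider "?Y = {}" | "?Y = verts K" | "?Y \<noteq> {}" "?Y \<noteq> verts K" by blast
    then show ?thesis
    proof cases
      case 1
      then show ?thesis using B_cut_no_K[OF X(1,2)] by blast
    next
      case 2
      have "2 \<le> card (edge_cut B (verts B - X))"
        by (rule B_cut_no_K) (use 2 X in auto)
      then show ?thesis using edge_cut_compl[OF X(1)] by simp
    next
      case 3
      \<comment> \<open>An edge \<open>e\<close> of \<open>K\<close> across \<open>?Y\<close> has
        become two half-edges with a copy between them, and \<open>X\<close> must be crossed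
        somewhere along the way. The crossing edge found there still names \<open>e\<close>, which
        makes the choice injective.\<close>
      define pick where "pick e = (SOME d. d \<in> edge_cut B X \<and> (d \<in> Inl ` ({e} \<times> UNIV) \<or> d \<in> Inr ` ({e} \<times> UNIV)))" for e
      have pick: "pick e \<in> edge_cut B X \<and> (pick e \<in> Inl ` ({e} \<times> UNIV) \<or> pick e \<in> Inr ` ({e} \<times> UNIV))"
        if e: "e \<in> edge_cut K ?Y" for e
        unfolding pick_def
      proof (rule someI_ex)
        obtain u v where uv: "e \<in> edges K" "ends K e = {u, v}" "u \<in> ?Y" "v \<in> verts K" "v \<notin> ?Y"
          by (rule edge_cutE[OF lK _ e]) auto
        show "\<exists>d. d \<in> edge_cut B X \<and> (d \<in> Inl ` ({e} \<times> UNIV) \<or> d \<in> Inr ` ({e} \<times> UNIV))"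
        proof (cases "Inr (e, attach e u) \<in> X \<and> Inr (e, attach e v) \<notin> X")
          case True
          then obtain h where "Inr (e, h) \<in> edge_cut B X"
            using cut_in_copy(1)[OF uv(1) X(1) attach_V attach_V] by blast
          then show ?thesis by blast
        next
          case False
          then consider "Inr (e, attach e u) \<notin> X" | "Inr (e, attach e v) \<in> X" by blast
          then show ?thesis
          proof cases
            case 1
            have "Inl (e, u) \<in> edge_cut B X"
              by (rule edge_cutI[where x = "Inl u" and y = "Inr (e, attach e u)"])
                (use 1 uv attach_V in \<open>auto simp: B_sel\<close>)
            then show ?thesis by blast
          next
            case 2
            have "Inl (e, v) \<in> edge_cut B X"
              by (rule edge_cutI[where x = "Inr (e, attach e v)" and y = "Inl v"])
                (use 2 uv attach_V in \<open>auto simp: B_sel\<close>)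
            then show ?thesis by blast
          qed
        qed
      qed
      have "(case pick e of Inl p \<Rightarrow> fst p | Inr p \<Rightarrow> fst p) = e" if "e \<in> edge_cut K ?Y" for e
        using pick[OF that] by auto
      then have "inj_on pick (edge_cut K ?Y)" by (rule inj_on_inverseI)
      moreover have "pick ` edge_cut K ?Y \<subseteq> edge_cut B X" using pick by (intro image_subsetI) simp
      ultimately have "card (edge_cut K ?Y) \<le> card (edge_cut B X)"
        using finite_edge_cut[OF B_loopless] by (rule card_inj_on_le)
      moreover have "2 \<le> card (edge_cut K ?Y)" by (rule conn3_cut[OF K _ 3]) simp
      ultimately show ?thesis by simp
    qed
  qed
  moreover have "verts B \<noteq> {}" using K by (auto simp: conn3_def B_sel)
  ultimately show ?thesis using B_cubic by (simp add: conn3_def)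
qed

lemma B_simple:
  assumes "simple_graph M"
  shows "simple_graph B"
proof -
  have "inj_on (ends B) (edges B)"
  proof (rule inj_onI)
    fix c d assume cd: "c \<in> edges B" "d \<in> edges B" "ends B c = ends B d"
    consider e v f u where "c = Inl (e, v)" "d = Inl (f, u)" | e v f h where "c = Inl (e, v)" "d = Inr (f, h)"
      | e h f u where "c = Inr (e, h)" "d = Inl (f, u)"
      | e h f k where "c = Inr (e, h)" "d = Inr (f, k)" "e \<in> edges K" "h \<in> edges M" "k \<in> edges M"
      using B_edge_cases[OF cd(1)] B_edge_cases[OF cd(2)] by blast
    then show "c = d"
    proof cases
      case 1
      then show ?thesis using cd(3) by (auto simp: B_sel doubleton_eq_iff)
    next
      case 2
      then have "Inl v \<in> (\<lambda>w. Inr (f, w)) ` ends M h" using cd(3) by (auto simp: B_sel)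
      then show ?thesis by blast
    next
      case 3
      then have "Inl u \<in> (\<lambda>w. Inr (e, w)) ` ends M h" using cd(3) by (auto simp: B_sel)
      then show ?thesis by blast
    next
      case 4
      have eq: "(\<lambda>w. Inr (e, w) :: 'v + 'e \<times> 'w) ` ends M h = (\<lambda>w. Inr (f, w)) ` ends M k"
        using cd(3) 4 by (simp add: B_sel)
      have "ends M h \<noteq> {}" using lM 4(4) by (auto simp: loopless_graph_def)
      then have ef: "e = f" using eq by blast
      then have "ends M h = ends M k" using eq by (auto simp: inj_image_eq_iff inj_def)
      then show ?thesis using assms 4 ef by (auto simp: simple_graph_def inj_on_def)
    qed
  qed
  then show ?thesis using B_loopless by (simp add: simple_graph_def)
qed

definition "copy e = (\<lambda>w. Inr (e, w) :: 'v + 'e \<times> 'w) ` verts M"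

section \<open>Colourings of the graph with insertions\<close>

context
  fixes L :: "('z, 'g) mgraph" and \<phi> and f
  assumes L: "conn3 L" and c: "vcol L B \<phi> f"
begin

text \<open>A common colour of the two half-edges can be given to \<open>m\<close>, which completes
  the colouring of the copy to one of \<open>M\<close>.\<close>

lemma equal_colors_M:
  assumes e: "e \<in> edges K" and eq: "\<And>u v. u \<in> ends K e \<Longrightarrow> v \<in> ends K e \<Longrightarrow> \<phi> (Inl (e, u)) = \<phi> (Inl (e, v))"
  shows "colors L M"
proof -
  let ?p = "\<lambda>h. if h = m then \<phi> (Inl (e, s e)) else \<phi> (Inr (e, h))"
  obtain t where t: "ends K e = {s e, t}" "attach e (s e) = x" "attach e t = y" by (rule other[OF e])
  have "vcol L M ?p (\<lambda>w. f (Inr (e, w)))"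
    unfolding vcol_def
  proof (intro ballI)
    fix w assume w: "w \<in> verts M"
    then have wB: "Inr (e, w) \<in> verts B" using e by (auto simp: B_sel)
    then have *: "f (Inr (e, w)) \<in> verts L" "bij_betw \<phi> (incident_edges B (Inr (e, w))) (incident_edges L (f (Inr (e, w))))"
      using c by (auto simp: vcol_def)
    have "(\<phi> \<circ> copy_edge e w) h = ?p h" if h: "h \<in> incident_edges M w" for h
    proof (cases "h = m")
      case True
      obtain v where v: "v \<in> ends K e" "w = attach e v"
        by (rule attach_surj[OF e]) (use h True in \<open>auto simp: incident_edges_def\<close>)
      then show ?thesis using True copy_edge_m[OF e v(1)] eq[OF v(1) s[OF e]] by simp
    qed (simp add: copy_edge_def)
    then have "bij_betw ?p (incident_edges M w) (incident_edges L (f (Inr (e, w))))"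
      by (rule bij_betw_eqI[OF bij_betw_trans[OF incident_Inr[OF e w] *(2)]])
    then show "f (Inr (e, w)) \<in> verts L \<and> bij_betw ?p (incident_edges M w) (incident_edges L (f (Inr (e, w))))"
      using *(1) by blast
  qed
  then show ?thesis using colors_iff_vcol[OF lM] by blast
qed

lemma star_Inl:
  assumes v: "v \<in> verts K"
  shows "f (Inl v) \<in> verts L" "bij_betw (\<lambda>e. \<phi> (Inl (e, v))) (incident_edges K v) (incident_edges L (f (Inl v)))"
proof -
  have "Inl v \<in> verts B" using v by (simp add: B_sel)
  then have *: "f (Inl v) \<in> verts L" "bij_betw \<phi> (incident_edges B (Inl v)) (incident_edges L (f (Inl v)))"
    using c by (auto simp: vcol_def)
  show "f (Inl v) \<in> verts L" by (fact *(1))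
  have "bij_betw (\<lambda>e. Inl (e, v)) (incident_edges K v) (incident_edges B (Inl v))"
    unfolding incident_Inl[OF v] bij_betw_def by (simp add: inj_on_def)
  from bij_betw_trans[OF this *(2)]
  show "bij_betw (\<lambda>e. \<phi> (Inl (e, v))) (incident_edges K v) (incident_edges L (f (Inl v)))"
    by (simp add: comp_def)
qed

lemma copy_cut:
  assumes e: "e \<in> edges K" and uv: "ends K e = {u, v}"
  shows "edge_cut B (copy e) = {Inl (e, u), Inl (e, v)}"
proof -
  have sub: "ends M h \<subseteq> verts M" if "h \<in> edges M" for h using lM that by (simp add: loopless_graph_def)
  have V: "u \<in> verts K" "v \<in> verts K" using lK e uv by (auto simp: loopless_graph_def)
  show ?thesis
  proof (rule set_eqI, rule iffI)
    fix d assume "d \<in> edge_cut B (copy e)"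
    then show "d \<in> {Inl (e, u), Inl (e, v)}"
      using sub uv unfolding edge_cut_def copy_def by (auto simp: B_sel)
  next
    fix d :: "'e \<times> 'v + 'e \<times> 'f" assume "d \<in> {Inl (e, u), Inl (e, v)}"
    then obtain w where w: "d = Inl (e, w)" "w \<in> {u, v}" by blast
    show "d \<in> edge_cut B (copy e)" unfolding w(1)
      by (rule edge_cutI[where x = "Inr (e, attach e w)" and y = "Inl w"])
        (use w(2) e uv V attach_V in \<open>auto simp: B_sel copy_def\<close>)
  qed
qed

text \<open>The cut of the copy consists of the two half-edges. Different colours occur once each,
  hence an odd number of times, and \<open>odd_set_cut\<close> transfers exactly these two.\<close>

lemma copy_odd_cut:
  assumes e: "e \<in> edges K" and uv: "ends K e = {u, v}" and ne: "\<phi> (Inl (e, u)) \<noteq> \<phi> (Inl (e, v))"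
  shows "edge_cut L (odd_set L f (copy e)) = {\<phi> (Inl (e, u)), \<phi> (Inl (e, v))}"
proof -
  have cV: "copy e \<subseteq> verts B" using e by (auto simp: copy_def B_sel)
  have "d \<in> edge_cut L (odd_set L f (copy e)) \<longleftrightarrow> d = \<phi> (Inl (e, u)) \<or> d = \<phi> (Inl (e, v))"
    if d: "d \<in> edges L" for d
  proof -
    have "d \<in> edge_cut L (odd_set L f (copy e)) \<longleftrightarrow> odd (card {i \<in> edge_cut B (copy e). \<phi> i = d})"
      by (rule odd_set_cut[OF conn3_loopless[OF L] B_loopless c cV d])
    also have "{i \<in> edge_cut B (copy e). \<phi> i = d} =
      (if d = \<phi> (Inl (e, u)) then {Inl (e, u)} else if d = \<phi> (Inl (e, v)) then {Inl (e, v)} else {})"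
      unfolding copy_cut[OF e uv] using ne by auto
    finally show ?thesis using ne by auto
  qed
  moreover have "\<phi> (Inl (e, u)) \<in> edges L" "\<phi> (Inl (e, v)) \<in> edges L"
  proof -
    have "\<phi> (Inl (e, w)) \<in> edges L" if w: "w \<in> ends K e" for w
    proof -
      have "w \<in> verts K" using w e lK by (auto simp: loopless_graph_def)
      then show ?thesis by (intro vcol_edge(1)[OF c, where v = "Inl w"]) (use w e in \<open>auto simp: B_sel\<close>)
    qed
    then show "\<phi> (Inl (e, u)) \<in> edges L" "\<phi> (Inl (e, v)) \<in> edges L" using uv by auto
  qed
  moreover have "edge_cut L (odd_set L f (copy e)) \<subseteq> edges L" by (auto simp: edge_cut_def)
  ultimately show ?thesis by blast
qed

end

end

section \<open>Blocks\<close>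

context two_cut
begin

lemma R_cut_sub:
  assumes I: "I \<subseteq> W"
  shows "edge_cut R I \<subseteq> merge c d ` edge_cut K I"
proof
  fix h assume h: "h \<in> edge_cut R I"
  then obtain e where e: "h = merge c d e" "e \<in> edges K" "ends K e \<inter> W \<noteq> {}"
    by (auto simp: edge_cut_def reduct_edges)
  have cr: "ends R h \<inter> I \<noteq> {}" "ends R h \<inter> (W - I) \<noteq> {}" using h by (auto simp: edge_cut_def)
  show "h \<in> merge c d ` edge_cut K I"
  proof (cases "e = c \<or> e = d")
    case True
    then have hc: "h = c" using e(1) by (auto simp: merge_def)
    have "ends R h = {x, y}" using R_ends[OF e(2,3)] True e(1) by simp
    then consider "x \<in> I" | "y \<in> I" using cr by auto
    then show ?thesis
    proof cases
      case 1
      have "c \<in> edge_cut K I" by (rule edge_cutI[where x = x and y = s]) (use 1 c cE I in auto)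
      moreover have "merge c d c = h" using hc by (simp add: merge_def)
      ultimately show ?thesis by blast
    next
      case 2
      have "d \<in> edge_cut K I" by (rule edge_cutI[where x = y and y = t]) (use 2 d dE I in auto)
      moreover have "merge c d d = h" using hc by (simp add: merge_def)
      ultimately show ?thesis by blast
    qed
  next
    case False
    then have "ends R h = ends K e" using R_ends[OF e(2,3)] e(1) by simp
    then have "e \<in> edge_cut K I" using cr e(2) W by (auto simp: edge_cut_def)
    then show ?thesis using e(1) by blast
  qed
qed

end

text \<open>Posimodularity of the cut function; it holds edge by edge, by the position of the two
  ends.\<close>

lemma edge_cut_posimodular:
  assumes G: "loopless_graph G" and X: "X \<subseteq> verts G" "Y \<subseteq> verts G"
  shows "card (edge_cut G (X - Y)) + card (edge_cut G (Y - X)) \<le> card (edge_cut G X) + card (edge_cut G Y)"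
proof -
  have fE: "finite (edges G)" using loopless_finite[OF G] by blast
  have cnt: "card (edge_cut G Z) = (\<Sum>e\<in>edges G. of_bool (e \<in> edge_cut G Z))" for Z
  proof -
    have "edge_cut G Z = edges G \<inter> {e. e \<in> edge_cut G Z}" by (auto simp: edge_cut_def)
    then show ?thesis using fE by (simp add: sum_of_bool_eq)
  qed
  have "(\<Sum>e\<in>edges G. of_bool (e \<in> edge_cut G (X - Y)) + of_bool (e \<in> edge_cut G (Y - X)) :: nat)
      \<le> (\<Sum>e\<in>edges G. of_bool (e \<in> edge_cut G X) + of_bool (e \<in> edge_cut G Y))"
  proof (rule sum_mono)
    fix e assume e: "e \<in> edges G"
    obtain p q where pq: "ends G e = {p, q}" "p \<noteq> q" "p \<in> verts G" "q \<in> verts G"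
      by (rule loopless_ends[OF G e])
    have "e \<in> edge_cut G Z \<longleftrightarrow> (p \<in> Z \<longleftrightarrow> q \<notin> Z)" for Z using pq e by (auto simp: edge_cut_def)
    then show "of_bool (e \<in> edge_cut G (X - Y)) + of_bool (e \<in> edge_cut G (Y - X)) \<le>
        of_bool (e \<in> edge_cut G X) + (of_bool (e \<in> edge_cut G Y) :: nat)"
      by (cases "p \<in> X"; cases "q \<in> X"; cases "p \<in> Y"; cases "q \<in> Y") simp_all
  qed
  then show ?thesis unfolding cnt by (simp add: sum.distrib)
qed

text \<open>Ten is the least order of a class 2 graph. The closed side is therefore a smallest such
  graph, so its proper cuts have at least three edges, and \<open>block_cut_ge_3\<close> carries
  this over to \<open>L\<close>.\<close>

definition block :: "('v, 'e) mgraph \<Rightarrow> 'v set \<Rightarrow> bool" where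
  "block L S \<longleftrightarrow> S \<subseteq> verts L \<and> card S = 10 \<and>
     (\<exists>c d. c \<noteq> d \<and> edge_cut L S = {c, d} \<and> \<not> class1 (reduct L S (merge c d)))"

lemma minimal_class2_10:
  assumes "conn3 N" "\<not> class1 N" "card (verts N) = 10"
  shows "minimal_class2 N"
proof (unfold_locales)
  fix G :: "('a, 'b) mgraph" assume "conn3 G" "card (verts G) < card (verts N)"
  then show "class1 G" using class2_order_ge_10[of G] assms(3) by linarith
qed (use assms in auto)

lemma block_cut_ge_3:
  assumes L: "conn3 L" and S: "block L S" and I: "I \<subseteq> S" "I \<noteq> {}" "I \<noteq> S"
  shows "3 \<le> card (edge_cut L I)"
proof -
  obtain c d where b: "S \<subseteq> verts L" "card S = 10" "c \<noteq> d" "edge_cut L S = {c, d}" "\<not> class1 (reduct L S (merge c d))"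
    using S by (auto simp: block_def)
  obtain x y s t where "two_cut L S c d x y s t" by (rule two_cutI[OF L b(1,4,3)])
  then interpret two_cut L S c d x y s t .
  have "minimal_class2 R" by (rule minimal_class2_10[OF conn3_R b(5)]) (use b in simp)
  then have "3 \<le> card (edge_cut R I)" using I by (intro minimal_class2.cut_ge_3) auto
  also have "\<dots> \<le> card (merge c d ` edge_cut L I)"
    by (rule card_mono[OF _ R_cut_sub[OF I(1)]]) (use conn3_loopless[OF L] in simp)
  also have "\<dots> \<le> card (edge_cut L I)"
    by (rule card_image_le) (use conn3_loopless[OF L] in simp)
  finally show ?thesis .
qed

text \<open>If two blocks met, each difference would be a proper nonempty part of a block and have
  at least three cut edges, while posimodularity allows 2 + 2 in total.\<close>

lemma blocks_disjoint:
  assumes L: "conn3 L" and S: "block L S" "block L S'" "S \<noteq> S'"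
  shows "S \<inter> S' = {}"
proof (rule ccontr)
  assume ne: "S \<inter> S' \<noteq> {}"
  note l = conn3_loopless[OF L]
  have V: "S \<subseteq> verts L" "S' \<subseteq> verts L" "card S = 10" "card S' = 10" using S by (auto simp: block_def)
  have fin: "finite S" "finite S'" using V loopless_finite(1)[OF l] finite_subset by blast+
  have "\<not> S \<subseteq> S'" "\<not> S' \<subseteq> S" using card_subset_eq[OF fin(2), of S] card_subset_eq[OF fin(1), of S'] V S(3) by auto
  then have "3 \<le> card (edge_cut L (S - S'))" "3 \<le> card (edge_cut L (S' - S))"
    using block_cut_ge_3[OF L S(1), of "S - S'"] block_cut_ge_3[OF L S(2), of "S' - S"] ne by auto
  moreover have "card (edge_cut L S) = 2" "card (edge_cut L S') = 2" using S by (auto simp: block_def)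
  ultimately show False using edge_cut_posimodular[OF l V(1,2)] by linarith
qed

text \<open>A coloring of \<open>K\<close> in which the two ends of an edge may see the two edges around a deleted set.\<close>

lemma remove_sets:
  fixes L :: "('z, 'g) mgraph" and K :: "('v, 'e) mgraph"
  assumes fin: "finite A" and K: "loopless_graph K" "verts K \<noteq> {}" and L: "conn3 L"
    and A: "\<And>S. S \<in> A \<Longrightarrow> S \<subseteq> verts L \<and> card S = 10 \<and> card (edge_cut L S) = 2"
    and disj: "\<And>S T. S \<in> A \<Longrightarrow> T \<in> A \<Longrightarrow> S \<noteq> T \<Longrightarrow> S \<inter> T = {}"
    and f: "\<And>v. v \<in> verts K \<Longrightarrow> f v \<in> verts L - \<Union> A"
    and star: "\<And>v. v \<in> verts K \<Longrightarrow> bij_betw (\<lambda>e. k e v) (incident_edges K v) (incident_edges L (f v))"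
    and pair: "\<And>e u v. e \<in> edges K \<Longrightarrow> ends K e = {u, v} \<Longrightarrow> k e u = k e v \<or> (\<exists>S\<in>A. {k e u, k e v} = edge_cut L S)"
  shows "\<exists>L' :: ('z, 'g) mgraph. conn3 L' \<and> colors L' K \<and> card (verts L') + 10 * card A = card (verts L)"
  using fin L A disj f star pair
proof (induction A arbitrary: L k rule: finite_induct)
  case empty
  define p where "p e = k e (SOME v. v \<in> ends K e)" for e
  have "p e = k e v" if e: "e \<in> incident_edges K v" for e v
  proof -
    have eE: "e \<in> edges K" "v \<in> ends K e" using e by (auto simp: incident_edges_def)
    obtain u where u: "ends K e = {v, u}" by (rule loopless_other_end[OF K(1) eE])
    have "(SOME v. v \<in> ends K e) \<in> ends K e" using eE(2) by (rule someI)
    then show ?thesis using empty.prems(6)[OF eE(1) u] u by (auto simp: p_def)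
  qed
  then have "vcol L K p f"
    using empty.prems(4,5) bij_betw_eqI[of "\<lambda>e. k e v" "incident_edges K v" "incident_edges L (f v)" p for v]
    unfolding vcol_def by (metis Diff_iff)
  then show ?case using empty.prems(1) colors_iff_vcol[OF K(1)] by (intro exI[of _ L]) auto
next
  case (insert S A)
  have S: "S \<subseteq> verts L" "card S = 10" "card (edge_cut L S) = 2" using insert.prems(2)[of S] by auto
  note l = conn3_loopless[OF insert.prems(1)]
  let ?W = "verts L - S"
  have "card (edge_cut L ?W) = 2" using S edge_cut_compl[OF S(1)] by simp
  then obtain c d where cd: "edge_cut L ?W = {c, d}" "c \<noteq> d" by (metis card_2_iff)
  obtain x y s t where "two_cut L ?W c d x y s t" by (rule two_cutI[OF insert.prems(1) Diff_subset cd])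
  then interpret T: two_cut L ?W c d x y s t .
  have SA: "T \<inter> S = {}" if "T \<in> A" for T using insert.prems(3)[of T S] that insert.hyps(2) by auto
  have cutS: "edge_cut L S = {c, d}" using cd edge_cut_compl[OF S(1)] by simp
  obtain v0 where v0: "v0 \<in> verts K" using K(2) by blast
  \<comment> \<open>Merging \<open>c\<close> and \<open>d\<close> must not collapse the cut of
    another set \<open>T\<close>: its image has at most two edges, and the closed graph being
    \<open>conn3\<close> forces two.\<close>
  have cut: "edge_cut T.R T = merge c d ` edge_cut L T \<and> card (edge_cut T.R T) = 2" if T: "T \<in> A" for T
  proof -
    have TW: "T \<subseteq> ?W" using insert.prems(2)[of T] SA[OF T] T by auto
    have c2: "card (edge_cut L T) = 2" using insert.prems(2)[of T] T by auto
    have fin: "finite (edge_cut L T)" using l by simp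
    have "T \<noteq> {}" using insert.prems(2)[of T] T by auto
    moreover have "T \<noteq> ?W" using insert.prems(4)[OF v0] T by auto
    ultimately have "2 \<le> card (edge_cut T.R T)" using conn3_cut[OF T.conn3_R] TW by simp
    moreover have "card (merge c d ` edge_cut L T) \<le> 2" using card_image_le[OF fin, of "merge c d"] c2 by simp
    moreover have "card (edge_cut T.R T) \<le> card (merge c d ` edge_cut L T)"
      by (rule card_mono[OF _ T.R_cut_sub[OF TW]]) (use fin in simp)
    ultimately have "card (edge_cut T.R T) = 2" "card (merge c d ` edge_cut L T) = card (edge_cut T.R T)" by linarith+
    then show ?thesis using card_subset_eq[OF _ T.R_cut_sub[OF TW]] fin by simp
  qed
  have "\<exists>L' :: ('z, 'g) mgraph. conn3 L' \<and> colors L' K \<and> card (verts L') + 10 * card A = card (verts T.R)"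
  proof (rule insert.IH[OF T.conn3_R, where k = "\<lambda>e v. merge c d (k e v)"])
    fix T assume T: "T \<in> A"
    show "T \<subseteq> verts T.R \<and> card T = 10 \<and> card (edge_cut T.R T) = 2"
      using insert.prems(2)[of T] SA[OF T] T cut[OF T] by auto
  next
    fix T T' assume "T \<in> A" "T' \<in> A" "T \<noteq> T'"
    then show "T \<inter> T' = {}" using insert.prems(3) by blast
  next
    fix v assume v: "v \<in> verts K"
    then have fv: "f v \<in> ?W" "f v \<in> verts T.R - \<Union> A" using insert.prems(4)[OF v] by auto
    then show "f v \<in> verts T.R - \<Union> A" by blast
    have "bij_betw (merge c d) (incident_edges L (f v)) (incident_edges T.R (f v))"
      unfolding bij_betw_def reduct_incident[OF fv(1)] using T.inj_inc[OF fv(1)] by simp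
    from bij_betw_trans[OF insert.prems(5)[OF v] this]
    show "bij_betw (\<lambda>e. merge c d (k e v)) (incident_edges K v) (incident_edges T.R (f v))"
      by (simp add: comp_def)
  next
    fix e u v assume e: "e \<in> edges K" "ends K e = {u, v}"
    from insert.prems(6)[OF e]
    show "merge c d (k e u) = merge c d (k e v) \<or> (\<exists>T\<in>A. {merge c d (k e u), merge c d (k e v)} = edge_cut T.R T)"
    proof
      assume "\<exists>T\<in>insert S A. {k e u, k e v} = edge_cut L T"
      then obtain T where T: "T \<in> insert S A" "{k e u, k e v} = edge_cut L T" by blast
      show ?thesis
      proof (cases "T = S")
        case True
        \<comment> \<open>The two ends of \<open>e\<close> see \<open>c\<close> and
          \<open>d\<close>, which are now one edge.\<close>
        then have "{k e u, k e v} = {c, d}" using T cutS by simp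
        then show ?thesis by (auto simp: doubleton_eq_iff merge_def)
      next
        case False
        then have TA: "T \<in> A" using T by blast
        have "merge c d ` {k e u, k e v} = edge_cut T.R T" unfolding T(2) using cut[OF TA] by simp
        then show ?thesis using TA by auto
      qed
    qed simp
  qed
  moreover have "card (verts T.R) + 10 = card (verts L)"
    using S loopless_finite(1)[OF l] by (metis card_Diff_subset card_mono finite_subset le_add_diff_inverse2 reduct_verts)
  ultimately show ?case using insert.hyps by auto
qed

section \<open>Rigid graphs of unbounded order\<close>

context insertion
begin

lemma equal_colors_K:
  assumes L: "conn3 L" and c: "vcol L B \<phi> f"
    and eq: "\<And>e u v. e \<in> edges K \<Longrightarrow> ends K e = {u, v} \<Longrightarrow> \<phi> (Inl (e, u)) = \<phi> (Inl (e, v))"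
  shows "colors L K"
proof -
  have "vcol L K (\<lambda>e. \<phi> (Inl (e, s e))) (\<lambda>v. f (Inl v))"
    unfolding vcol_def
  proof (intro ballI conjI)
    fix v assume v: "v \<in> verts K"
    show "f (Inl v) \<in> verts L" using star_Inl(1)[OF L c v] .
    have "\<phi> (Inl (e, v)) = \<phi> (Inl (e, s e))" if e: "e \<in> incident_edges K v" for e
    proof -
      have eE: "e \<in> edges K" "v \<in> ends K e" using e by (auto simp: incident_edges_def)
      obtain u where u: "ends K e = {v, u}" by (rule loopless_other_end[OF lK eE])
      then show ?thesis using eq[OF eE(1) u] s[OF eE(1)] by auto
    qed
    then show "bij_betw (\<lambda>e. \<phi> (Inl (e, s e))) (incident_edges K v) (incident_edges L (f (Inl v)))"
      by (rule bij_betw_eqI[OF star_Inl(2)[OF L c v]])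
  qed
  then show ?thesis using colors_iff_vcol[OF lK] by blast
qed

lemma colors_K_of_no_two_cut:
  assumes L: "conn3 L" and c: "colors L B"
    and cut: "\<And>X. X \<subseteq> verts L \<Longrightarrow> X \<noteq> {} \<Longrightarrow> X \<noteq> verts L \<Longrightarrow> 3 \<le> card (edge_cut L X)"
  shows "colors L K"
proof -
  note l = conn3_loopless[OF L]
  obtain \<phi> f where v: "vcol L B \<phi> f" using c colors_iff_vcol[OF B_loopless] by blast
  show ?thesis
  proof (rule equal_colors_K[OF L v])
    fix e u w assume e: "e \<in> edges K" "ends K e = {u, w}"
    show "\<phi> (Inl (e, u)) = \<phi> (Inl (e, w))"
    proof (rule ccontr)
      assume ne: "\<phi> (Inl (e, u)) \<noteq> \<phi> (Inl (e, w))"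
      let ?S = "odd_set L f (copy e)"
      have S: "edge_cut L ?S = {\<phi> (Inl (e, u)), \<phi> (Inl (e, w))}" by (rule copy_odd_cut[OF L v e ne])
      then have "?S \<noteq> {}" "?S \<noteq> verts L" using edge_cut_trivial[OF l] by auto
      then have "3 \<le> card (edge_cut L ?S)" by (intro cut) (auto simp: odd_set_def)
      then show False unfolding S using ne by simp
    qed
  qed
qed

lemma rigid_larger:
  fixes L :: nat_graph
  assumes rK: "rigid K" and L: "rigid L" "\<not> class1 L" and v: "vcol L B \<phi> f"
    and ten: "card (verts M) = 10" and nM: "\<not> colors L M"
  shows "card (verts K) < card (verts L)"
proof -
  note cL = rigid_conn3[OF L(1)]
  note l = conn3_loopless[OF cL]
  let ?S = "\<lambda>e. odd_set L f (copy e)"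
  have ne: "\<phi> (Inl (e, u)) \<noteq> \<phi> (Inl (e, w))" if e: "e \<in> edges K" "ends K e = {u, w}" for e u w
  proof
    assume eq: "\<phi> (Inl (e, u)) = \<phi> (Inl (e, w))"
    have "colors L M" by (rule equal_colors_M[OF cL v e(1)]) (use e(2) eq in auto)
    then show False using nM by simp
  qed
  have cut: "edge_cut L (?S e) = {\<phi> (Inl (e, u)), \<phi> (Inl (e, w))}" if "e \<in> edges K" "ends K e = {u, w}" for e u w
    by (rule copy_odd_cut[OF cL v that ne[OF that]])
  have bl: "block L (?S e)" if e: "e \<in> edges K" for e
  proof -
    obtain u w where uw: "ends K e = {u, w}" by (rule loopless_ends[OF lK e])
    let ?c = "\<phi> (Inl (e, u))" and ?d = "\<phi> (Inl (e, w))"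
    note cS = cut[OF e uw] and cd = ne[OF e uw]
    have SV: "?S e \<subseteq> verts L" by (auto simp: odd_set_def)
    have Sne: "?S e \<noteq> {}" using cS edge_cut_trivial[OF l] by auto
    obtain x' y' s' t' where T: "two_cut L (?S e) ?c ?d x' y' s' t'" "two_cut L (verts L - ?S e) ?c ?d s' t' x' y'"
      by (rule two_cutI[OF cL SV cS cd])
    \<comment> \<open>If this side were of class 1, the other closed side would be a smaller graph
      colouring \<open>L\<close>, against rigidity.\<close>
    have n1: "\<not> class1 (reduct L (?S e) (merge ?c ?d))"
    proof
      assume "class1 (reduct L (?S e) (merge ?c ?d))"
      then have "colors (reduct L (verts L - ?S e) (merge ?c ?d)) L"
        by (rule two_cut_colors[OF cL SV cS cd])
      then have "card (verts L - ?S e) = card (verts L)"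
        using rigid_card[OF L(1) two_cut.conn3_R[OF T(2)]] by simp
      then have "verts L - ?S e = verts L"
        using card_subset_eq[OF loopless_finite(1)[OF l] Diff_subset] by simp
      then show False using Sne SV by auto
    qed
    \<comment> \<open>The lower bound is the least order of a class 2 graph. For the upper bound, an
      odd fibre is nonempty, so the side lies in the image of a ten-vertex copy.\<close>
    have "10 \<le> card (?S e)" using class2_order_ge_10[OF two_cut.conn3_R[OF T(1)] n1] by simp
    moreover have "card (?S e) \<le> 10"
    proof -
      have "?S e \<subseteq> f ` copy e"
      proof
        fix z assume "z \<in> ?S e"
        then have "odd (card {v \<in> copy e. f v = z})" by (simp add: odd_set_def)
        then have "{v \<in> copy e. f v = z} \<noteq> {}" by (metis card.empty even_zero)
        then show "z \<in> f ` copy e" by blast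
      qed
      moreover have "finite (copy e)" unfolding copy_def using loopless_finite(1)[OF lM] by blast
      moreover have "card (copy e) = 10"
        unfolding copy_def using ten by (subst card_image) (simp_all add: inj_on_def)
      ultimately show ?thesis by (metis card_image_le card_mono finite_imageI le_trans)
    qed
    ultimately have ten10: "card (?S e) = 10" by simp
    show ?thesis unfolding block_def using SV ten10 cd cS n1 by blast
  qed
  have cut2: "card (edge_cut L (?S e)) = 2" if "e \<in> edges K" for e
    using bl[OF that] by (auto simp: block_def)
  let ?A = "?S ` edges K"
  have finA: "finite ?A" using loopless_finite(2)[OF lK] by simp
  \<comment> \<open>One of the three edges at \<open>?z\<close> is not in the 2-edge-cut of the
    block of \<open>e0\<close>. If \<open>?z\<close> were in that block, this edge would lie inside
    it; but it is the colour of a half-edge, hence in the cut of another block, which would then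
    meet this one.\<close>
  have outside: "f (Inl v) \<in> verts L - \<Union> ?A" if v': "v \<in> verts K" for v
  proof -
    let ?z = "f (Inl v)"
    note st = star_Inl[OF cL v v']
    have "?z \<notin> ?S e0" if e0: "e0 \<in> edges K" for e0
    proof
      assume z: "?z \<in> ?S e0"
      have "card (incident_edges L ?z) = 3" using st(1) cL by (simp add: conn3_def cubic_def)
      then have "\<not> incident_edges L ?z \<subseteq> edge_cut L (?S e0)"
        using cut2[OF e0] card_mono[OF finite_edge_cut[OF l], of "incident_edges L ?z" "?S e0"] by auto
      then obtain i where i: "i \<in> incident_edges L ?z" "i \<notin> edge_cut L (?S e0)" by blast
      obtain e where e: "e \<in> incident_edges K v" "i = \<phi> (Inl (e, v))" by (rule bij_betw_preimage[OF st(2) i(1)])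
      have eE: "e \<in> edges K" "v \<in> ends K e" using e(1) by (auto simp: incident_edges_def)
      obtain u where u: "ends K e = {v, u}" by (rule loopless_other_end[OF lK eE])
      have ic: "i \<in> edge_cut L (?S e)" using cut[OF eE(1) u] e(2) by simp
      then have "?S e \<noteq> ?S e0" using i(2) by auto
      then have dj: "?S e \<inter> ?S e0 = {}" using blocks_disjoint[OF cL bl[OF eE(1)] bl[OF e0]] by blast
      have iE: "i \<in> edges L" "?z \<in> ends L i" using i(1) by (auto simp: incident_edges_def)
      then have "ends L i \<subseteq> ?S e0" using i(2) z l by (auto simp: edge_cut_def loopless_graph_def)
      then show False using ic dj by (auto simp: edge_cut_def)
    qed
    then show ?thesis using st(1) by blast
  qed
  have "\<exists>L' :: nat_graph. conn3 L' \<and> colors L' K \<and> card (verts L') + 10 * card ?A = card (verts L)"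
  proof (rule remove_sets[OF finA lK _ cL, where k = "\<lambda>e v. \<phi> (Inl (e, v))" and f = "\<lambda>v. f (Inl v)"])
    show "verts K \<noteq> {}" using K by (simp add: conn3_def)
    show "S \<subseteq> verts L \<and> card S = 10 \<and> card (edge_cut L S) = 2" if "S \<in> ?A" for S
      using that bl cut2 by (auto simp: block_def)
    show "S \<inter> T = {}" if "S \<in> ?A" "T \<in> ?A" "S \<noteq> T" for S T
      using that bl blocks_disjoint[OF cL] by blast
    show "f (Inl v) \<in> verts L - \<Union> ?A" if "v \<in> verts K" for v using outside[OF that] .
    show "bij_betw (\<lambda>e. \<phi> (Inl (e, v))) (incident_edges K v) (incident_edges L (f (Inl v)))" if "v \<in> verts K" for v
      using star_Inl(2)[OF cL v that] .
    show "\<phi> (Inl (e, u)) = \<phi> (Inl (e, w)) \<or> (\<exists>S\<in>?A. {\<phi> (Inl (e, u)), \<phi> (Inl (e, w))} = edge_cut L S)"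
      if "e \<in> edges K" "ends K e = {u, w}" for e u w
      using cut[OF that] that(1) by blast
  qed
  then obtain L' :: nat_graph where L': "conn3 L'" "colors L' K" "card (verts L') + 10 * card ?A = card (verts L)" by blast
  \<comment> \<open>As \<open>L'\<close> colours the rigid \<open>K\<close>, it has the order of
    \<open>K\<close>; at least one block of ten vertices was removed to obtain it.\<close>
  have "card (verts L') = card (verts K)" using rigid_card[OF rK L'(1,2)] .
  moreover obtain v where "v \<in> verts K" using K by (auto simp: conn3_def)
  then have "incident_edges K v \<noteq> {}" using K by (auto simp: conn3_def cubic_def)
  then have "?A \<noteq> {}" by (auto simp: incident_edges_def)
  then have "0 < card ?A" using finA by (simp add: card_gt_0_iff)
  ultimately show ?thesis using L'(3) by linarith
qed

end

lemma insertion_exists: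
  assumes K: "conn3 K" and M: "conn3 M"
  obtains m x y s where "insertion K M m x y s"
proof -
  obtain w where "w \<in> verts M" using M by (auto simp: conn3_def)
  then have "incident_edges M w \<noteq> {}" using M by (auto simp: conn3_def cubic_def)
  then obtain m where m: "m \<in> edges M" by (auto simp: incident_edges_def)
  obtain x y where xy: "ends M m = {x, y}" "x \<noteq> y" by (rule loopless_ends[OF conn3_loopless[OF M] m])
  have ne: "\<exists>v. v \<in> ends K e" if e: "e \<in> edges K" for e
    by (rule loopless_ends[OF conn3_loopless[OF K] e]) blast
  have "insertion K M m x y (\<lambda>e. SOME v. v \<in> ends K e)"
    using K M m xy someI_ex[OF ne] by unfold_locales auto
  then show ?thesis using that by blast
qed

text \<open>If \<open>M\<close> coloured \<open>L\<close>, it would colour the graph with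
  insertions, so uncolourability passes to \<open>L\<close>. Nor does \<open>L\<close> colour
  \<open>M\<close>: as \<open>M\<close> is rigid, the two would be isomorphic, and \<open>M\<close>
  would colour \<open>L\<close> after all.\<close>

lemma rigid_grow:
  fixes K :: nat_graph and M :: "('w, 'f) mgraph"
  assumes rK: "rigid K" and rM: "rigid M" "\<not> class1 M" "card (verts M) = 10" and nc: "\<not> colors M K"
  shows "\<exists>L :: nat_graph. rigid L \<and> card (verts K) < card (verts L) \<and> \<not> colors M L"
proof -
  note cK = rigid_conn3[OF rK] and cM = rigid_conn3[OF rM(1)]
  have cut3M: "3 \<le> card (edge_cut M X)" if "X \<subseteq> verts M" "X \<noteq> {}" "X \<noteq> verts M" for X
    using minimal_class2.cut_ge_3[OF minimal_class2_10[OF cM rM(2,3)] that] .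
  have cubM: "cubic M" "verts M \<noteq> {}" using cM by (auto simp: conn3_def)
  have K2: "\<not> class1 K" using class1_colors[OF conn3_loopless[OF cK] _ cubM] nc by blast
  obtain m x y s where "insertion K M m x y s" by (rule insertion_exists[OF cK cM])
  then interpret insertion K M m x y s .
  have nB: "\<not> colors M B" using colors_K_of_no_two_cut[OF cM _ cut3M] nc by blast
  then have B2: "\<not> class1 B" using class1_colors[OF B_loopless _ cubM] by blast
  obtain L :: nat_graph where L: "rigid L" "colors L B" "\<not> class1 L" by (rule rigid_exists[OF B_conn3 B2])
  note cL = rigid_conn3[OF L(1)]
  obtain \<phi> f where v: "vcol L B \<phi> f" using L(2) colors_iff_vcol[OF B_loopless] by blast
  have "\<not> colors L M"
  proof
    assume "colors L M"
    then have "isomorphic M L" by (rule rigidD[OF rM(1) cL])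
    then have "colors M L" by (rule colors_iso_sym[OF cM])
    then show False using colors_trans[OF _ L(2)] nB by blast
  qed
  then have lt: "card (verts K) < card (verts L)" using rigid_larger[OF rK L(1,3) v rM(3)] by blast
  have "\<not> colors M L"
  proof
    assume c: "colors M L"
    show False using colors_trans[OF c L(2)] nB by blast
  qed
  then show ?thesis using L(1) lt by blast
qed

theorem infinite_H3:
  fixes G :: nat_graph and M :: "('w, 'f) mgraph"
  assumes G: "conn3 G" "\<not> colors M G" and M: "rigid M" "\<not> class1 M" "card (verts M) = 10"
  shows "infinite H3"
proof -
  have cubM: "cubic M" "verts M \<noteq> {}" using rigid_conn3[OF M(1)] by (auto simp: conn3_def)
  have G2: "\<not> class1 G" using class1_colors[OF conn3_loopless[OF G(1)] _ cubM] G(2) by blast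
  obtain K0 :: nat_graph where K0: "rigid K0" "colors K0 G" by (rule rigid_exists[OF G(1) G2])
  have "\<exists>H :: nat_graph. rigid H \<and> \<not> colors M H \<and> n \<le> card (verts H)" for n
  proof (induction n)
    case 0
    then show ?case using K0 colors_trans[OF _ K0(2)] G(2) by blast
  next
    case (Suc n)
    then obtain H :: nat_graph where "rigid H" "\<not> colors M H" "n \<le> card (verts H)" by blast
    then show ?case using rigid_grow[OF _ M, of H] by (metis Suc_leI le_less_trans)
  qed
  then have "infinite (iso_class ` {H :: nat_graph. rigid H})" by (intro infinite_card) blast
  then show ?thesis using H3_eq[OF G(1) G2] by simp
qed

lemma rigid_of_order_10:
  assumes M: "conn3 M" "\<not> class1 M" "card (verts M) = 10"
  shows "rigid M"
  unfolding rigid_def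
proof (intro conjI allI impI)
  fix K :: nat_graph assume K: "conn3 K" "colors K M"
  obtain \<phi> f where "vcol K M \<phi> f" using K(2) colors_iff_vcol[OF conn3_loopless[OF M(1)]] by blast
  from coloring_iso_or_smaller[OF M(1,2) K(1) this] show "isomorphic M K"
  proof
    assume "\<exists>K' :: nat_graph. conn3 K' \<and> colors K' M \<and> card (verts K') < card (verts M)"
    then obtain K' :: nat_graph where "conn3 K'" "colors K' M" "card (verts K') < 10" using M(3) by auto
    then show ?thesis using class2_order_ge_10[of K'] colors_class1[of K' M] M(2) by linarith
  qed simp
qed (fact M(1))

theorem infinite_uncolorable:
  fixes G :: nat_graph and M :: "('w, 'f) mgraph"
  assumes G: "conn3 G" "simple_graph G" "\<not> colors M G"
    and hM: "conn3 M" "simple_graph M" "\<not> class1 M" "card (verts M) = 10"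
  shows "infinite (iso_class ` {G :: nat_graph. conn3 G \<and> simple_graph G \<and> \<not> colors M G})"
proof (rule infinite_card)
  have cut3M: "3 \<le> card (edge_cut M X)" if "X \<subseteq> verts M" "X \<noteq> {}" "X \<noteq> verts M" for X
    using minimal_class2.cut_ge_3[OF minimal_class2_10[OF hM(1,3,4)] that] .
  fix n show "\<exists>H\<in>{G :: nat_graph. conn3 G \<and> simple_graph G \<and> \<not> colors M G}. n \<le> card (verts H)"
  proof (induction n)
    case 0
    then show ?case using G by blast
  next
    case (Suc n)
    then obtain K :: nat_graph where hK: "conn3 K" "simple_graph K" "\<not> colors M K" "n \<le> card (verts K)" by blast
    obtain m x y s where "insertion K M m x y s" by (rule insertion_exists[OF hK(1) hM(1)])
    then interpret insertion K M m x y s .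
    obtain H :: nat_graph where H: "isomorphic B H" using nat_graph_exists[OF B_loopless] by blast
    have "\<not> colors M B" using colors_K_of_no_two_cut[OF hM(1) _ cut3M] hK(3) by blast
    then have "\<not> colors M H" using colors_trans[OF _ isomorphic_colors[OF B_loopless H]] by blast
    moreover have "conn3 H" "simple_graph H"
      using isomorphic_conn3[OF B_conn3 H] isomorphic_simple[OF B_simple[OF hM(2)] H] .
    moreover have "Suc n \<le> card (verts H)" using B_card hK(4) isomorphic_card[OF H] by simp
    ultimately show ?case by blast
  qed
qed

section \<open>Graphs given by lists\<close>

definition list_graph :: "nat \<Rightarrow> (nat \<times> nat) list \<Rightarrow> nat_graph" where
  "list_graph n E = \<lparr>verts = {..<n}, edges = {..<length E}, ends = \<lambda>i. {fst (E ! i), snd (E ! i)}\<rparr>"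

lemma list_graph_sel [simp]:
  "verts (list_graph n E) = {..<n}" "edges (list_graph n E) = {..<length E}"
  "ends (list_graph n E) i = {fst (E ! i), snd (E ! i)}"
  by (simp_all add: list_graph_def)

text \<open>\<open>T\<close> lists the edges at every vertex, and \<open>Ms\<close> is a list of perfect matchings without a
  common edge.\<close>

definition edge_cert :: "nat \<Rightarrow> (nat \<times> nat) list \<Rightarrow> nat list list \<Rightarrow> nat list list \<Rightarrow> nat \<Rightarrow> bool" where
  "edge_cert n E T Ms i \<longleftrightarrow> (let u = fst (E ! i); v = snd (E ! i) in
     u \<noteq> v \<and> u < n \<and> v < n \<and> i \<in> set (T ! u) \<and> i \<in> set (T ! v) \<and> (\<exists>M\<in>set Ms. i \<notin> set M))"

text \<open>A neighbour with a smaller number at every vertex but 0 certifies connectedness; exactly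
  one edge of \<open>M\<close> at every vertex makes \<open>M\<close> a perfect matching.\<close>

definition vertex_cert :: "(nat \<times> nat) list \<Rightarrow> nat list list \<Rightarrow> nat list list \<Rightarrow> nat \<Rightarrow> bool" where
  "vertex_cert E T Ms v \<longleftrightarrow> distinct (T ! v) \<and> length (T ! v) = 3 \<and>
     (\<forall>i\<in>set (T ! v). i < length E \<and> (fst (E ! i) = v \<or> snd (E ! i) = v)) \<and>
     (v = 0 \<or> (\<exists>i\<in>set (T ! v). fst (E ! i) < v \<or> snd (E ! i) < v)) \<and>
     (\<forall>M\<in>set Ms. length (filter (\<lambda>i. i \<in> set M) (T ! v)) = 1)"

text \<open>The sorted end pairs are distinct exactly when there are no parallel edges.\<close>

definition graph_cert :: "nat \<Rightarrow> (nat \<times> nat) list \<Rightarrow> nat list list \<Rightarrow> nat list list \<Rightarrow> bool" where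
  "graph_cert n E T Ms \<longleftrightarrow> 0 < n \<and> list_all (edge_cert n E T Ms) [0..<length E] \<and>
     list_all (vertex_cert E T Ms) [0..<n] \<and> distinct (map (\<lambda>(u, v). (min u v, max u v)) E)"

lemma graph_certD:
  assumes "graph_cert n E T Ms"
  shows "0 < n"
    "i < length E \<Longrightarrow> fst (E ! i) \<noteq> snd (E ! i) \<and> fst (E ! i) < n \<and> snd (E ! i) < n"
    "i < length E \<Longrightarrow> i \<in> set (T ! fst (E ! i)) \<and> i \<in> set (T ! snd (E ! i))"
    "i < length E \<Longrightarrow> \<exists>M\<in>set Ms. i \<notin> set M"
    "v < n \<Longrightarrow> distinct (T ! v) \<and> length (T ! v) = 3"
    "v < n \<Longrightarrow> i \<in> set (T ! v) \<Longrightarrow> i < length E \<and> (fst (E ! i) = v \<or> snd (E ! i) = v)"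
    "v < n \<Longrightarrow> v \<noteq> 0 \<Longrightarrow> \<exists>i\<in>set (T ! v). fst (E ! i) < v \<or> snd (E ! i) < v"
    "v < n \<Longrightarrow> M \<in> set Ms \<Longrightarrow> length (filter (\<lambda>i. i \<in> set M) (T ! v)) = 1"
    "distinct (map (\<lambda>(u, v). (min u v, max u v)) E)"
proof -
  show "0 < n" "distinct (map (\<lambda>(u, v). (min u v, max u v)) E)" using assms by (simp_all add: graph_cert_def)
  have e: "i < length E \<Longrightarrow> edge_cert n E T Ms i" using assms by (simp add: graph_cert_def list_all_iff)
  show "i < length E \<Longrightarrow> fst (E ! i) \<noteq> snd (E ! i) \<and> fst (E ! i) < n \<and> snd (E ! i) < n"
    "i < length E \<Longrightarrow> i \<in> set (T ! fst (E ! i)) \<and> i \<in> set (T ! snd (E ! i))"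
    "i < length E \<Longrightarrow> \<exists>M\<in>set Ms. i \<notin> set M"
    using e unfolding edge_cert_def Let_def by blast+
  have vc: "vertex_cert E T Ms v" if "v < n" using assms that by (simp add: graph_cert_def list_all_iff)
  note vc = vc[unfolded vertex_cert_def]
  show "distinct (T ! v) \<and> length (T ! v) = 3" if "v < n"
    using vc[OF that] by blast
  show "i < length E \<and> (fst (E ! i) = v \<or> snd (E ! i) = v)" if "v < n" "i \<in> set (T ! v)"
    using vc[OF that(1), THEN conjunct2, THEN conjunct2, THEN conjunct1] that(2) by blast
  show "\<exists>i\<in>set (T ! v). fst (E ! i) < v \<or> snd (E ! i) < v" if "v < n" "v \<noteq> 0"
    using vc[OF that(1), THEN conjunct2, THEN conjunct2, THEN conjunct2, THEN conjunct1] that(2) by blast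
  show "length (filter (\<lambda>i. i \<in> set M) (T ! v)) = 1" if "v < n" "M \<in> set Ms"
    using vc[OF that(1), THEN conjunct2, THEN conjunct2, THEN conjunct2, THEN conjunct2] that(2) by blast
qed

context
  fixes n E T Ms assumes cert: "graph_cert n E T Ms"
begin

lemma incident_list_graph:
  assumes "v < n"
  shows "incident_edges (list_graph n E) v = set (T ! v)"
  using graph_certD(3)[OF cert] graph_certD(6)[OF cert assms] by (auto simp: incident_edges_def)

lemma cubic_list_graph: "cubic (list_graph n E)"
proof -
  have "loopless_graph (list_graph n E)"
    unfolding loopless_graph_def using graph_certD(2)[OF cert] by (simp add: card_2_iff)
  moreover have "card (incident_edges (list_graph n E) v) = 3" if "v < n" for v
    unfolding incident_list_graph[OF that] using graph_certD(5)[OF cert that] by (simp add: distinct_card)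
  ultimately show ?thesis by (simp add: cubic_def)
qed

lemma simple_list_graph: "simple_graph (list_graph n E)"
proof -
  have "i = j" if ij: "i < length E" "j < length E" and eq: "{fst (E ! i), snd (E ! i)} = {fst (E ! j), snd (E ! j)}" for i j
  proof -
    have "(\<lambda>(u, v). (min u v, max u v)) (E ! i) = (\<lambda>(u, v). (min u v, max u v)) (E ! j)"
      using eq by (auto simp: case_prod_unfold doubleton_eq_iff min.commute max.commute)
    then have "map (\<lambda>(u, v). (min u v, max u v)) E ! i = map (\<lambda>(u, v). (min u v, max u v)) E ! j"
      using ij by simp
    then show "i = j" using nth_eq_iff_index_eq[OF graph_certD(9)[OF cert]] ij by simp
  qed
  then show ?thesis using cubic_list_graph by (auto simp: simple_graph_def cubic_def inj_on_def)
qed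

text \<open>If an edge \<open>e\<close> is the only edge of a cut, then a perfect matching avoiding \<open>e\<close> has no edge
  in the cut, and its complement, in which all degrees are 2, has exactly one.\<close>

lemma conn3_list_graph: "conn3 (list_graph n E)"
proof -
  let ?G = "list_graph n E"
  have l: "loopless_graph ?G" using cubic_list_graph by (simp add: cubic_def)
  have "2 \<le> card (edge_cut ?G X)" if X: "X \<subseteq> {..<n}" "X \<noteq> {}" "X \<noteq> {..<n}" for X
  proof -
    have fin: "finite (edge_cut ?G X)" by (simp add: edge_cut_def)
    have cutI: "i \<in> edge_cut ?G X" if "i < length E" "fst (E ! i) \<in> X \<longleftrightarrow> snd (E ! i) \<notin> X" for i
      using that graph_certD(2)[OF cert that(1)] by (auto simp: edge_cut_def)
    have "edge_cut ?G X \<noteq> {}"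
    proof
      assume none: "edge_cut ?G X = {}"
      have "v \<in> X \<longleftrightarrow> 0 \<in> X" if "v < n" for v using that
      proof (induction v rule: less_induct)
        case (less v)
        show ?case
        proof (cases "v = 0")
          case False
          obtain i where i: "i \<in> set (T ! v)" "fst (E ! i) < v \<or> snd (E ! i) < v"
            using graph_certD(7)[OF cert less.prems False] by blast
          have j: "i < length E" "fst (E ! i) = v \<or> snd (E ! i) = v" using graph_certD(6)[OF cert less.prems i(1)] by auto
          have "fst (E ! i) \<in> X \<longleftrightarrow> snd (E ! i) \<in> X" using cutI[OF j(1)] none by blast
          then show ?thesis using j(2) i(2) less.IH less.prems by (metis less_trans)
        qed simp
      qed
      then show False using X by auto
    qed
    moreover have "edge_cut ?G X \<noteq> {i}" for i
    proof
      assume one: "edge_cut ?G X = {i}"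
      then have "i < length E" by (auto simp: edge_cut_def)
      then obtain M where M: "M \<in> set Ms" "i \<notin> set M" using graph_certD(4)[OF cert] by blast
      have "card {j \<in> incident_edges ?G v. j \<notin> set M} = 2" if v: "v < n" for v
      proof -
        note d = graph_certD(5)[OF cert v]
        have "card {j \<in> incident_edges ?G v. j \<notin> set M} = length (filter (\<lambda>j. j \<notin> set M) (T ! v))"
          unfolding incident_list_graph[OF v] using d distinct_card[of "filter (\<lambda>j. j \<notin> set M) (T ! v)"]
          by (simp add: Collect_conj_eq Int_commute)
        then show ?thesis using sum_length_filter_compl[of "\<lambda>j. j \<in> set M" "T ! v"] graph_certD(8)[OF cert v M(1)] d
          by simp
      qed
      then have "(\<Sum>v\<in>X. card {j \<in> incident_edges ?G v. j \<notin> set M}) = 2 * card X"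
        using X(1) by (simp add: subset_iff)
      moreover have "{j \<in> edge_cut ?G X. j \<notin> set M} = {i}" using one M(2) by auto
      ultimately have "2 * card X = 2 * card {j \<in> inner_edges ?G X. j \<notin> set M} + 1"
        using handshake[OF l, of X "\<lambda>j. j \<notin> set M"] X(1) by simp
      then have "even (2 * card {j \<in> inner_edges ?G X. j \<notin> set M} + 1)" by (metis dvd_triv_left)
      then show False by simp
    qed
    ultimately have "card (edge_cut ?G X) \<noteq> 0" "card (edge_cut ?G X) \<noteq> 1"
      using fin by (auto simp: card_1_singleton_iff)
    then show ?thesis by linarith
  qed
  then show ?thesis unfolding conn3_def using cubic_list_graph graph_certD(1)[OF cert] by auto
qed

end

section \<open>Certificates for the Petersen graph and for the graph on 60 vertices\<close>

definition pet_edges :: "(nat \<times> nat) list" where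
  "pet_edges = [(0, 1), (0, 8), (0, 9), (6, 5), (6, 7), (6, 9), (4, 3), (4, 7), (4, 8), (2, 3), (2, 5), (2, 1),
     (3, 9), (5, 8), (7, 1)]"

definition pet_stars :: "nat list list" where
  "pet_stars = [[0, 1, 2], [0, 11, 14], [9, 10, 11], [6, 9, 12], [6, 7, 8], [3, 10, 13], [3, 4, 5], [4, 7, 14],
     [1, 8, 13], [2, 5, 12]]"

lemma pet_cert: "graph_cert 10 pet_edges pet_stars
    [[0, 5, 7, 9, 13], [2, 4, 6, 11, 13], [2, 3, 8, 9, 14]]"
  by code_simp

text \<open>The numbers 3, 11, 19, 28, 36, 44, 52 are the first vertices of the seven copies. In
  each copy the local vertices 0 and 5 are former neighbours of one deleted vertex, 2 and 7 of the
  other. The copies use the edges 0 to 69, so the joining edges start at 70.\<close>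

definition jaeger_edges :: "(nat \<times> nat) list" where
  "jaeger_edges = concat (map (\<lambda>n. map (\<lambda>(i, j). (n + i, n + j))
     [(0, 1), (1, 2), (3, 4), (2, 3), (0, 4), (5, 6), (6, 7), (1, 6), (3, 5), (4, 7)]) [3, 11, 19, 28, 36, 44, 52]) @
     [(0, 1), (0, 3), (0, 11), (1, 2), (1, 19), (2, 51), (2, 57), (27, 24), (27, 28), (27, 36), (44,
     33), (49, 54), (46, 10), (41, 59), (43, 30), (38, 21), (52, 13), (35, 8), (5, 18), (26, 16)]"

text \<open>The order within and between the lists matters: the eight stars of each copy appear
  exactly in the form and sequence of the hypotheses of \<open>dpair_block\<close>.\<close>

definition jaeger_stars :: "nat list list" where
  "jaeger_stars = [[70, 71, 72], [70, 73, 74], [73, 75, 76], [71, 0, 4], [0, 1, 7], [1, 3, 88], [2, 3, 8], [4, 2, 9],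
     [5, 8, 87], [7, 5, 6], [6, 9, 82], [72, 10, 14], [10, 11, 17], [11, 13, 86], [12, 13, 18],
     [14, 12, 19], [15, 18, 89], [17, 15, 16], [16, 19, 88], [74, 20, 24], [20, 21, 27], [21, 23,
     85], [22, 23, 28], [24, 22, 29], [25, 28, 77], [27, 25, 26], [26, 29, 89], [77, 78, 79], [78,
     30, 34], [30, 31, 37], [31, 33, 84], [32, 33, 38], [34, 32, 39], [35, 38, 80], [37, 35, 36],
     [36, 39, 87], [79, 40, 44], [40, 41, 47], [41, 43, 85], [42, 43, 48], [44, 42, 49], [45, 48,
     83], [47, 45, 46], [46, 49, 84], [80, 50, 54], [50, 51, 57], [51, 53, 82], [52, 53, 58], [54,
     52, 59], [55, 58, 81], [57, 55, 56], [56, 59, 75], [86, 60, 64], [60, 61, 67], [61, 63, 81],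
     [62, 63, 68], [64, 62, 69], [65, 68, 76], [67, 65, 66], [66, 69, 83]]"

lemma jaeger_cert: "graph_cert 60 jaeger_edges jaeger_stars
    [[3, 7, 9, 11, 14, 16, 18, 21, 24, 26, 28, 31, 32, 35, 40, 43, 45, 49, 50, 53, 55, 59, 61, 64, 66,
     68, 71, 73, 78, 87], [0, 2, 6, 10, 12, 15, 20, 22, 26, 33, 34, 37, 40, 42, 46, 51, 52, 55, 61,
     62, 65, 70, 75, 77, 80, 83, 85, 86, 87, 88], [0, 3, 5, 9, 11, 12, 16, 21, 22, 25, 30, 32, 36,
     41, 42, 45, 51, 52, 56, 60, 62, 66, 72, 74, 76, 79, 80, 81, 84, 89]]"
  by code_simp

definition pet_verts :: "nat set list" where
  "pet_verts = [{0, 1}, {2, 3}, {0, 4}, {1, 2}, {0, 3}, {1, 3}, {0, 2}, {1, 4}, {2, 4}, {3, 4}]"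

lemma pairs_less_5: "{A. A \<subseteq> {..<5 :: nat} \<and> card A = 2} = set pet_verts"
proof -
  have "{A. A \<subseteq> {..<5 :: nat} \<and> card A = 2} = (\<lambda>(x, y). {x, y}) ` {(x, y) \<in> {..<5} \<times> {..<5}. x < y}"
  proof (rule set_eqI, rule iffI)
    fix A :: "nat set" assume "A \<in> {A. A \<subseteq> {..<5} \<and> card A = 2}"
    then obtain x y where A: "A = {x, y}" "x \<noteq> y" "x < 5" "y < 5" by (auto simp: card_2_iff)
    have "A = {min x y, max x y}" "min x y < max x y" "min x y < 5" "max x y < 5" using A by (auto simp: min_def max_def)
    then show "A \<in> (\<lambda>(x, y). {x, y}) ` {(x, y) \<in> {..<5} \<times> {..<5}. x < y}" by auto
  qed auto
  also have "{(x, y) \<in> {..<5 :: nat} \<times> {..<5}. x < y} = set (filter (\<lambda>(x, y). x < y) (List.product [0..<5] [0..<5]))"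
    by auto
  also have "filter (\<lambda>(x, y). x < y) (List.product [0..<5] [0..<5]) =
      [(0, 1), (0, 2), (0, 3), (0, 4), (1, 2), (1, 3), (1, 4), (2, 3), (2, 4), (3, 4 :: nat)]" by code_simp
  finally show ?thesis by (auto simp: pet_verts_def)
qed

section \<open>The Petersen graph and the uncolourable graph\<close>

lemma petersen_verts: "verts petersen = set pet_verts"
  by (simp add: petersen_def pairs_less_5)

lemma petersen_edges: "edges petersen = set (map (\<lambda>(i, j). {pet_verts ! i, pet_verts ! j}) pet_edges)"
proof -
  have "edges petersen = {{A, B} | A B. A \<in> set pet_verts \<and> B \<in> set pet_verts \<and> A \<inter> B = {}}"
    unfolding petersen_def pairs_less_5[symmetric] by auto
  also have "\<dots> = (\<lambda>(A, B). {A, B}) ` set (filter (\<lambda>(A, B). A \<inter> B = {}) (List.product pet_verts pet_verts))"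
    by auto
  also have "\<dots> = set (map (\<lambda>(i, j). {pet_verts ! i, pet_verts ! j}) pet_edges)"
    by (simp add: pet_verts_def pet_edges_def insert_commute)
  finally show ?thesis .
qed

lemma isomorphic_petersen: "isomorphic (list_graph 10 pet_edges) petersen"
proof (rule isomorphicI)
  have l: "length pet_verts = 10" "length pet_edges = 15" by (simp_all add: pet_verts_def pet_edges_def)
  have d: "distinct pet_verts" by (simp add: pet_verts_def doubleton_eq_iff)
  show "bij_betw ((!) pet_verts) (verts (list_graph 10 pet_edges)) (verts petersen)"
    using bij_betw_nth[OF d, of "{..<10}"] l by (simp add: petersen_verts)
  let ?g = "(!) (map (\<lambda>(i, j). {pet_verts ! i, pet_verts ! j}) pet_edges)"
  have "distinct (map (\<lambda>(i, j). {pet_verts ! i, pet_verts ! j}) pet_edges)"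
    by (simp add: pet_verts_def pet_edges_def doubleton_eq_iff)
  then show "bij_betw ?g (edges (list_graph 10 pet_edges)) (edges petersen)"
    unfolding petersen_edges using l by (intro bij_betw_nth) simp_all
  fix e assume "e \<in> edges (list_graph 10 pet_edges)"
  then show "ends petersen (?g e) = (!) pet_verts ` ends (list_graph 10 pet_edges) e"
    using l by (simp add: petersen_def case_prod_unfold)
qed

text \<open>Each new edge is adjacent to an earlier one, and each inequality stands directly behind
  the later of its two edges, so that failing branches are cut early.\<close>

lemma petersen_search:
  "(\<forall>c0\<in>{0, 1, 2 :: nat}. (\<forall>c1\<in>{0, 1, 2}. c1 \<noteq> c0 \<longrightarrow>
   (\<forall>c2\<in>{0, 1, 2}. c2 \<noteq> c0 \<longrightarrow> c2 \<noteq> c1 \<longrightarrow>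
   (\<forall>c5\<in>{0, 1, 2}. c5 \<noteq> c2 \<longrightarrow> (\<forall>c12\<in>{0, 1, 2}. c12
   \<noteq> c2 \<longrightarrow> c12 \<noteq> c5 \<longrightarrow> (\<forall>c3\<in>{0, 1, 2}. c3
   \<noteq> c5 \<longrightarrow> (\<forall>c4\<in>{0, 1, 2}. c4 \<noteq> c5 \<longrightarrow> c4
   \<noteq> c3 \<longrightarrow> (\<forall>c13\<in>{0, 1, 2}. c13 \<noteq> c1 \<longrightarrow>
   c13 \<noteq> c3 \<longrightarrow> (\<forall>c8\<in>{0, 1, 2}. c8 \<noteq> c1 \<longrightarrow>
   c8 \<noteq> c13 \<longrightarrow> (\<forall>c6\<in>{0, 1, 2}. c6 \<noteq> c12 \<longrightarrow>
   c6 \<noteq> c8 \<longrightarrow> (\<forall>c7\<in>{0, 1, 2}. c7 \<noteq> c4 \<longrightarrow>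
   c7 \<noteq> c8 \<longrightarrow> c7 \<noteq> c6 \<longrightarrow> (\<forall>c14\<in>{0, 1, 2}.
   c14 \<noteq> c0 \<longrightarrow> c14 \<noteq> c4 \<longrightarrow> c14 \<noteq> c7
   \<longrightarrow> (\<forall>c9\<in>{0, 1, 2}. c9 \<noteq> c12 \<longrightarrow> c9 \<noteq> c6
   \<longrightarrow> (\<forall>c10\<in>{0, 1, 2}. c10 \<noteq> c3 \<longrightarrow> c10 \<noteq>
   c13 \<longrightarrow> c10 \<noteq> c9 \<longrightarrow> (\<forall>c11\<in>{0, 1, 2}. c11
   \<noteq> c0 \<longrightarrow> c11 \<noteq> c14 \<longrightarrow> c11 \<noteq> c9
   \<longrightarrow> c11 \<noteq> c10 \<longrightarrow> False)))))))))))))))"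
  by simp

lemma petersen_class2: "\<not> class1 (list_graph 10 pet_edges)"
proof
  assume "class1 (list_graph 10 pet_edges)"
  then obtain c :: "nat \<Rightarrow> nat" where
    c: "\<And>v. v < 10 \<Longrightarrow> bij_betw c (incident_edges (list_graph 10 pet_edges) v) {0, 1, 2}"
    by (auto simp: class1_def)
  have s: "list_all (\<lambda>v. inj_on c (set (pet_stars ! v)) \<and> c ` set (pet_stars ! v) = {0, 1, 2}) [0..<10]"
    using c incident_list_graph[OF pet_cert] by (simp add: list_all_iff bij_betw_def)
  have r: "c i \<in> {0, 1, 2}" if "i < 15" for i
  proof -
    have "\<exists>v\<in>set [0..<10]. i \<in> set (pet_stars ! v)" using graph_certD(2,3)[OF pet_cert, of i] that
      by (intro bexI[of _ "fst (pet_edges ! i)"]) (simp_all add: pet_edges_def)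
    then show ?thesis using s unfolding list_all_iff by blast
  qed
  have n: "c 1 \<noteq> c 0" "c 2 \<noteq> c 0" "c 2 \<noteq> c 1" "c 5 \<noteq> c 2" "c 12 \<noteq> c
    2" "c 12 \<noteq> c 5" "c 3 \<noteq> c 5" "c 4 \<noteq> c 5" "c 4 \<noteq> c 3" "c 13 \<noteq>
    c 1" "c 13 \<noteq> c 3" "c 8 \<noteq> c 1" "c 8 \<noteq> c 13" "c 6 \<noteq> c 12" "c 6
    \<noteq> c 8" "c 7 \<noteq> c 4" "c 7 \<noteq> c 8" "c 7 \<noteq> c 6" "c 14 \<noteq> c 0" "c
    14 \<noteq> c 4" "c 14 \<noteq> c 7" "c 9 \<noteq> c 12" "c 9 \<noteq> c 6" "c 10 \<noteq> c
    3" "c 10 \<noteq> c 13" "c 10 \<noteq> c 9" "c 11 \<noteq> c 0" "c 11 \<noteq> c 14" "c 11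
    \<noteq> c 9" "c 11 \<noteq> c 10"
    using s by (simp_all add: pet_stars_def upt_rec inj_on_def)
  show False
    by (rule petersen_search[rule_format, OF r[of 0] r[of 1] n(1) r[of 2] n(2) n(3) r[of 5] n(4) r[of 12] n(5) n(6) r[of 3] n(7) r[of 4]
      n(8) n(9) r[of 13] n(10) n(11) r[of 8] n(12) n(13) r[of 6] n(14) n(15) r[of 7] n(16) n(17)
      n(18) r[of 14] n(19) n(20) n(21) r[of 9] n(22) n(23) r[of 10] n(24) n(25) n(26) r[of 11]
      n(27) n(28) n(29) n(30)]) simp_all
qed

text \<open>The edge \<open>i\<close> of \<^const>\<open>pet_edges\<close> is called \<open>Pi\<close>, and \<open>ext x\<close> lists the pairs \<open>(y, z)\<close> such
  that \<open>x, y, z\<close> are the edges at an end of \<open>x\<close>.\<close>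

datatype pedge = P0 | P1 | P2 | P3 | P4 | P5 | P6 | P7 | P8 | P9 | P10 | P11 | P12 | P13 | P14

fun ext :: "pedge \<Rightarrow> (pedge \<times> pedge) list" where
  "ext P0 = [(P1, P2), (P2, P1), (P11, P14), (P14, P11)]"
| "ext P1 = [(P0, P2), (P2, P0), (P8, P13), (P13, P8)]"
| "ext P2 = [(P0, P1), (P1, P0), (P5, P12), (P12, P5)]"
| "ext P3 = [(P4, P5), (P5, P4), (P10, P13), (P13, P10)]"
| "ext P4 = [(P3, P5), (P5, P3), (P7, P14), (P14, P7)]"
| "ext P5 = [(P3, P4), (P4, P3), (P2, P12), (P12, P2)]"
| "ext P6 = [(P7, P8), (P8, P7), (P9, P12), (P12, P9)]"
| "ext P7 = [(P6, P8), (P8, P6), (P4, P14), (P14, P4)]"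
| "ext P8 = [(P6, P7), (P7, P6), (P1, P13), (P13, P1)]"
| "ext P9 = [(P10, P11), (P11, P10), (P6, P12), (P12, P6)]"
| "ext P10 = [(P9, P11), (P11, P9), (P3, P13), (P13, P3)]"
| "ext P11 = [(P9, P10), (P10, P9), (P0, P14), (P14, P0)]"
| "ext P12 = [(P6, P9), (P9, P6), (P2, P5), (P5, P2)]"
| "ext P13 = [(P3, P10), (P10, P3), (P1, P8), (P8, P1)]"
| "ext P14 = [(P4, P7), (P7, P4), (P0, P11), (P11, P0)]"

text \<open>An edge joins two disjoint 2-subsets of a 5-element set and thus misses one element; edges that
  miss the same element are farthest apart.\<close>

fun missing :: "pedge \<Rightarrow> nat" where
  "missing P0 = 4"
| "missing P1 = 3"
| "missing P2 = 2"
| "missing P3 = 4"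
| "missing P4 = 3"
| "missing P5 = 1"
| "missing P6 = 4"
| "missing P7 = 2"
| "missing P8 = 1"
| "missing P9 = 3"
| "missing P10 = 2"
| "missing P11 = 1"
| "missing P12 = 0"
| "missing P13 = 0"
| "missing P14 = 0"

definition star :: "pedge \<Rightarrow> pedge \<Rightarrow> pedge \<Rightarrow> bool" where
  "star x y z \<longleftrightarrow> (y, z) \<in> set (ext x)"

definition third :: "pedge \<Rightarrow> pedge \<Rightarrow> pedge list" where
  "third x y = map snd (filter (\<lambda>p. fst p = y) (ext x))"

definition opp :: "pedge \<Rightarrow> pedge \<Rightarrow> bool" where
  "opp x y \<longleftrightarrow> missing x = missing y \<and> x \<noteq> y"

text \<open>In the order of the indices, so that \<open>all_pedge ! i\<close> turns an edge number
  of \<open>pet_edges\<close> into its name.\<close>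

definition all_pedge :: "pedge list" where
  "all_pedge = [P0, P1, P2, P3, P4, P5, P6, P7, P8, P9, P10, P11, P12, P13, P14]"

text \<open>A copy of the Petersen graph minus two adjacent vertices has outgoing edges \<open>x1\<close>, \<open>x2\<close> (former
  neighbours of one deleted vertex) and \<open>y1\<close>, \<open>y2\<close>; the lists contain the possible \<open>(y1, y2)\<close> and
  \<open>(x2, y1)\<close>, respectively.\<close>

definition dpair :: "pedge \<Rightarrow> pedge \<Rightarrow> (pedge \<times> pedge) list" where
  "dpair x1 x2 = (if x1 = x2 then map (\<lambda>y. (y, y)) (filter (\<lambda>y. \<not> opp x1 y) all_pedge)
     else concat (map (\<lambda>z. filter (\<lambda>(y1, y2). y1 \<noteq> x1 \<and> y1 \<noteq> x2) (ext z)) (third x1 x2)))"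

definition dcross :: "pedge \<Rightarrow> pedge \<Rightarrow> (pedge \<times> pedge) list" where
  "dcross x1 y2 = (if opp x1 y2 then [] else [(x1, y2)]) @
     concat (map (\<lambda>(x2, z). if y2 = x1 \<or> y2 = x2 then [] else map (\<lambda>y1. (x2, y1)) (third y2 z)) (ext x1))"

text \<open>The letters \<open>a\<close> to \<open>t\<close> are the colours of the edges 70 to 89 of \<^term>\<open>jaeger_edges\<close>, which join the
  seven copies and the vertices 0, 1, 2 and 27. The copy with the outgoing
  edges \<open>i, k, o', r\<close> closes the search.\<close>

definition nosol :: "pedge \<Rightarrow> pedge \<Rightarrow> pedge \<Rightarrow> bool" where
  "nosol a b c = list_all (\<lambda>r. list_all (\<lambda>(s, m). list_all (\<lambda>(t, q). list_all (\<lambda>(d, e).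
     list_all (\<lambda>(f, g). list_all (\<lambda>(k, l). list_all (\<lambda>n. list_all (\<lambda>(h, p). list_all (\<lambda>(j, o').
     list_all (\<lambda>(i, k'). k' \<noteq> k) (dpair o' r)) (dcross n p)) (dcross e t))
     (map snd (filter (\<lambda>(l', n). l' = l) (dpair q g)))) (dpair m f)) (ext d)) (ext a))
     (dcross c s)) (dpair b r)) (b # map fst (ext b))"

section \<open>The relation between the outgoing edges of a copy, and the search\<close>

lemma star_set [simp]: "z \<in> set (third x y) \<longleftrightarrow> star x y z"
  by (force simp: third_def star_def)

lemma all_pedge: "x \<in> set all_pedge"
  by (cases x) (simp_all add: all_pedge_def)

text \<open>Reflects the symmetry of a copy that exchanges the two deleted vertices; the search can
  then enter a copy from either pair.\<close>

lemma dpair_swap_sides: "(y1, y2) \<in> set (dpair x1 x2) \<Longrightarrow> (x1, x2) \<in> set (dpair y1 y2)"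
proof -
  have "list_all (\<lambda>x1. list_all (\<lambda>x2. list_all (\<lambda>(y1, y2). (x1, x2) \<in> set (dpair y1 y2)) (dpair x1 x2)) all_pedge) all_pedge"
    by code_simp
  then show "(y1, y2) \<in> set (dpair x1 x2) \<Longrightarrow> (x1, x2) \<in> set (dpair y1 y2)"
    using all_pedge unfolding list_all_iff by blast
qed

lemma dpair_reflect: "(y1, y2) \<in> set (dpair x1 x2) \<Longrightarrow> (y2, y1) \<in> set (dpair x2 x1)"
proof -
  have "list_all (\<lambda>x1. list_all (\<lambda>x2. list_all (\<lambda>(y1, y2). (y2, y1) \<in> set (dpair x2 x1)) (dpair x1 x2)) all_pedge) all_pedge"
    by code_simp
  then show "(y1, y2) \<in> set (dpair x1 x2) \<Longrightarrow> (y2, y1) \<in> set (dpair x2 x1)"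
    using all_pedge unfolding list_all_iff by blast
qed

text \<open>For copies at which the search already knows one outgoing edge of each pair.\<close>

lemma dpair_dcross: "(y1, y2) \<in> set (dpair x1 x2) \<Longrightarrow> (x2, y1) \<in> set (dcross x1 y2)"
proof -
  have "list_all (\<lambda>x1. list_all (\<lambda>x2. list_all (\<lambda>(y1, y2). (x2, y1) \<in> set (dcross x1 y2)) (dpair x1 x2)) all_pedge) all_pedge"
    by code_simp
  then show "(y1, y2) \<in> set (dpair x1 x2) \<Longrightarrow> (x2, y1) \<in> set (dcross x1 y2)"
    using all_pedge unfolding list_all_iff by blast
qed

text \<open>It restricts the first free choice of the search to five colours.\<close>

lemma dpair_domain:
  assumes "(y1, y2) \<in> set (dpair x1 x2)"
  shows "x2 \<in> set (x1 # map fst (ext x1))"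
proof (cases "x1 = x2")
  case False
  then obtain z where "z \<in> set (third x1 x2)" using assms by (auto simp: dpair_def)
  then show ?thesis by (force simp: star_def)
qed simp

text \<open>Exhaustion over the colourings of a copy, walking along adjacent edges so that each new
  colour comes from \<open>ext\<close> or \<open>third\<close>. Either \<open>x1 = x2\<close> and
  \<open>y1 = y2\<close>, not opposite to each other; or \<open>x1\<close>, \<open>x2\<close> meet
  at one end of an edge \<open>z\<close> and \<open>y1\<close>, \<open>y2\<close> at its other end,
  as if the deleted vertices were still there.\<close>

lemma dpair_block:
  assumes "star x1 e01 e04" "star e01 e12 e16" "star e12 e23 y1" "star e34 e23 e35"
    "star e04 e34 e47" "star e56 e35 x2" "star e16 e56 e67" "star e67 e47 y2"
  shows "(y1, y2) \<in> set (dpair x1 x2)"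
proof -
  have "\<forall>x1\<in>set all_pedge. \<forall>(e01, e04)\<in>set (ext x1). \<forall>(e12, e16)\<in>set (ext e01). \<forall>(e34, e47)\<in>set (ext e04).
    \<forall>(e23, e35)\<in>set (ext e34). \<forall>y1\<in>set (third e12 e23). \<forall>(e56, e67)\<in>set (ext e16).
    \<forall>x2\<in>set (third e56 e35). \<forall>y2\<in>set (third e67 e47). (y1, y2) \<in> set (dpair x1 x2)"
    by code_simp
  note n = bspec[OF this all_pedge[of x1]]
  note n = bspec[OF n assms(1)[unfolded star_def], unfolded prod.case]
  note n = bspec[OF n assms(2)[unfolded star_def], unfolded prod.case]
  note n = bspec[OF n assms(5)[unfolded star_def], unfolded prod.case]
  note n = bspec[OF n assms(4)[unfolded star_def], unfolded prod.case]
  note n = bspec[OF n assms(3)[folded star_set]]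
  note n = bspec[OF n assms(7)[unfolded star_def], unfolded prod.case]
  note n = bspec[OF n assms(6)[folded star_set]]
  show ?thesis by (rule bspec[OF n assms(8)[folded star_set]])
qed

lemma no_solution: "\<forall>a\<in>set all_pedge. \<forall>(b, c)\<in>set (ext a). nosol a b c"
  by code_simp

lemma no_star_coloring:
  assumes "list_all (\<lambda>t. star (c (t ! 0)) (c (t ! 1)) (c (t ! 2))) jaeger_stars"
  shows False
proof -
  have st: "star (c 70) (c 71) (c 72)"
    "star (c 70) (c 73) (c 74)"
    "star (c 73) (c 75) (c 76)"
    "star (c 71) (c 0) (c 4)"
    "star (c 0) (c 1) (c 7)"
    "star (c 1) (c 3) (c 88)"
    "star (c 2) (c 3) (c 8)"
    "star (c 4) (c 2) (c 9)"
    "star (c 5) (c 8) (c 87)"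
    "star (c 7) (c 5) (c 6)"
    "star (c 6) (c 9) (c 82)"
    "star (c 72) (c 10) (c 14)"
    "star (c 10) (c 11) (c 17)"
    "star (c 11) (c 13) (c 86)"
    "star (c 12) (c 13) (c 18)"
    "star (c 14) (c 12) (c 19)"
    "star (c 15) (c 18) (c 89)"
    "star (c 17) (c 15) (c 16)"
    "star (c 16) (c 19) (c 88)"
    "star (c 74) (c 20) (c 24)"
    "star (c 20) (c 21) (c 27)"
    "star (c 21) (c 23) (c 85)"
    "star (c 22) (c 23) (c 28)"
    "star (c 24) (c 22) (c 29)"
    "star (c 25) (c 28) (c 77)"
    "star (c 27) (c 25) (c 26)"
    "star (c 26) (c 29) (c 89)"
    "star (c 77) (c 78) (c 79)"
    "star (c 78) (c 30) (c 34)"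
    "star (c 30) (c 31) (c 37)"
    "star (c 31) (c 33) (c 84)"
    "star (c 32) (c 33) (c 38)"
    "star (c 34) (c 32) (c 39)"
    "star (c 35) (c 38) (c 80)"
    "star (c 37) (c 35) (c 36)"
    "star (c 36) (c 39) (c 87)"
    "star (c 79) (c 40) (c 44)"
    "star (c 40) (c 41) (c 47)"
    "star (c 41) (c 43) (c 85)"
    "star (c 42) (c 43) (c 48)"
    "star (c 44) (c 42) (c 49)"
    "star (c 45) (c 48) (c 83)"
    "star (c 47) (c 45) (c 46)"
    "star (c 46) (c 49) (c 84)"
    "star (c 80) (c 50) (c 54)"
    "star (c 50) (c 51) (c 57)"
    "star (c 51) (c 53) (c 82)"
    "star (c 52) (c 53) (c 58)"
    "star (c 54) (c 52) (c 59)"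
    "star (c 55) (c 58) (c 81)"
    "star (c 57) (c 55) (c 56)"
    "star (c 56) (c 59) (c 75)"
    "star (c 86) (c 60) (c 64)"
    "star (c 60) (c 61) (c 67)"
    "star (c 61) (c 63) (c 81)"
    "star (c 62) (c 63) (c 68)"
    "star (c 64) (c 62) (c 69)"
    "star (c 65) (c 68) (c 76)"
    "star (c 67) (c 65) (c 66)"
    "star (c 66) (c 69) (c 83)"
    using assms by (simp_all add: jaeger_stars_def)
  have D4: "(c 88, c 82) \<in> set (dpair (c 71) (c 87))"
    by (rule dpair_block[OF st(4) st(5) st(6) st(7) st(8) st(9) st(10) st(11)])
  have D6: "(c 86, c 88) \<in> set (dpair (c 72) (c 89))"
    by (rule dpair_block[OF st(12) st(13) st(14) st(15) st(16) st(17) st(18) st(19)])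
  have D5: "(c 85, c 89) \<in> set (dpair (c 74) (c 77))"
    by (rule dpair_block[OF st(20) st(21) st(22) st(23) st(24) st(25) st(26) st(27)])
  have D3: "(c 84, c 87) \<in> set (dpair (c 78) (c 80))"
    by (rule dpair_block[OF st(29) st(30) st(31) st(32) st(33) st(34) st(35) st(36)])
  have D1: "(c 85, c 84) \<in> set (dpair (c 79) (c 83))"
    by (rule dpair_block[OF st(37) st(38) st(39) st(40) st(41) st(42) st(43) st(44)])
  have D0: "(c 82, c 75) \<in> set (dpair (c 80) (c 81))"
    by (rule dpair_block[OF st(45) st(46) st(47) st(48) st(49) st(50) st(51) st(52)])
  have D2: "(c 81, c 83) \<in> set (dpair (c 86) (c 76))"
    by (rule dpair_block[OF st(53) st(54) st(55) st(56) st(57) st(58) st(59) st(60)])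
  have "nosol (c 70) (c 71) (c 72)" using no_solution all_pedge st(1) unfolding star_def by blast
  note n = this[unfolded nosol_def list_all_iff]
  \<comment> \<open>Each \<open>bspec\<close> descends one loop of \<open>nosol\<close>; the fact
    about the copy is first turned by the symmetries so that the colours known at that point are the
    arguments.\<close>
  note n = bspec[OF n dpair_domain[OF D4]]
  note n = bspec[OF n D4, unfolded prod.case]
  note n = bspec[OF n dpair_dcross[OF D6], unfolded prod.case]
  note n = bspec[OF n st(2)[unfolded star_def], unfolded prod.case]
  note n = bspec[OF n st(3)[unfolded star_def], unfolded prod.case]
  note n = bspec[OF n dpair_swap_sides[OF D0], unfolded prod.case]
  have "c 83 \<in> set (map snd (filter (\<lambda>(l', n). l' = (c 81)) (dpair (c 86) (c 76))))" using D2 by force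
  note n = bspec[OF n this]
  note n = bspec[OF n dpair_dcross[OF D5], unfolded prod.case]
  note n = bspec[OF n dpair_dcross[OF dpair_reflect[OF D1]], unfolded prod.case]
  \<comment> \<open>The last copy offers \<open>c 80\<close> for an edge that already has this
    colour, whereas \<open>nosol\<close> says that the two always differ.\<close>
  note n = bspec[OF n dpair_swap_sides[OF D3], unfolded prod.case]
  then show False by simp
qed

lemma star_perm:
  assumes "bij_betw f {i, j, k} (set (pet_stars ! v))" "v < 10" "distinct [i, j, k]"
  shows "star (all_pedge ! f i) (all_pedge ! f j) (all_pedge ! f k)"
proof -
  have all: "\<forall>s\<in>set pet_stars. \<forall>x\<in>set s. \<forall>y\<in>set s. \<forall>z\<in>set s. x \<noteq> y \<longrightarrow> x \<noteq> z \<longrightarrow> y \<noteq> z \<longrightarrow>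
      star (all_pedge ! x) (all_pedge ! y) (all_pedge ! z)"
    by code_simp
  have "pet_stars ! v \<in> set pet_stars" using assms(2) by (intro nth_mem) (simp add: pet_stars_def)
  moreover have "f i \<in> set (pet_stars ! v)" "f j \<in> set (pet_stars ! v)" "f k \<in> set (pet_stars ! v)"
    using assms(1) by (auto simp: bij_betw_def)
  moreover have "f i \<noteq> f j" "f i \<noteq> f k" "f j \<noteq> f k" using assms(1,3) by (auto simp: bij_betw_def inj_on_def)
  ultimately show ?thesis using all by blast
qed

abbreviation "pet \<equiv> list_graph 10 pet_edges"
abbreviation "jaeger \<equiv> list_graph 60 jaeger_edges"

lemma jaeger_uncolorable: "\<not> colors pet jaeger"
proof
  assume "colors pet jaeger"
  then obtain \<phi> where p: "H_coloring pet jaeger \<phi>" by (auto simp: colors_def)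
  have star: "star (all_pedge ! \<phi> (t ! 0)) (all_pedge ! \<phi> (t ! 1)) (all_pedge ! \<phi> (t ! 2))" if t: "t \<in> set jaeger_stars" for t
  proof -
    have "length jaeger_stars = 60" by (simp add: jaeger_stars_def)
    then obtain v where v: "v < 60" "t = jaeger_stars ! v" using t by (auto simp: in_set_conv_nth)
    note d = graph_certD(5)[OF jaeger_cert v(1), folded v(2)]
    then obtain i j k where ijk: "t = [i, j, k]" by (auto simp: length_Suc_conv eval_nat_numeral)
    have "\<forall>v\<in>verts jaeger. \<exists>u\<in>verts pet. bij_betw \<phi> (incident_edges jaeger v) (incident_edges pet u)"
      using p unfolding H_coloring_def by (rule conjunct2)
    then obtain u where "u < 10" "bij_betw \<phi> (incident_edges jaeger v) (incident_edges pet u)"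
      using v(1) by auto
    then show ?thesis using star_perm[of \<phi> i j k u] d v(1)
      by (simp add: incident_list_graph[OF jaeger_cert] incident_list_graph[OF pet_cert] flip: v(2)) (simp add: ijk)
  qed
  show False using no_star_coloring[of "\<lambda>i. all_pedge ! \<phi> i"] star unfolding list_all_iff by blast
qed

lemma petersen_pet:
  fixes G :: nat_graph
  shows "colors petersen G \<longleftrightarrow> colors pet G"
proof -
  have l: "loopless_graph pet" using cubic_list_graph[OF pet_cert] by (simp add: cubic_def)
  have 1: "colors petersen pet" by (rule isomorphic_colors[OF l isomorphic_petersen])
  have 2: "colors pet petersen"
    by (rule isomorphic_colors[OF isomorphic_loopless[OF l isomorphic_petersen] isomorphic_sym[OF l isomorphic_petersen]])
  show ?thesis using colors_trans[OF 1] colors_trans[OF 2] by blast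
qed

theorem corollary5p1:
  shows "infinite (iso_class ` {G :: nat_graph. connected_graph G \<and> simple_graph G \<and>
           bridgeless G \<and> cubic G \<and> \<not> (\<exists>\<phi>. petersen_coloring G \<phi>)}) \<and>
         infinite H3"
proof
  note P = conn3_list_graph[OF pet_cert] and J = conn3_list_graph[OF jaeger_cert]
  have card: "card (verts pet) = 10" by simp
  have "infinite (iso_class ` {G :: nat_graph. conn3 G \<and> simple_graph G \<and> \<not> colors pet G})"
    by (rule infinite_uncolorable[OF J simple_list_graph[OF jaeger_cert] jaeger_uncolorable P
      simple_list_graph[OF pet_cert] petersen_class2 card])
  moreover have "{G :: nat_graph. conn3 G \<and> simple_graph G \<and> \<not> colors pet G} \<subseteq>
      {G. connected_graph G \<and> simple_graph G \<and> bridgeless G \<and> cubic G \<and> \<not> (\<exists>\<phi>. petersen_coloring G \<phi>)}"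
    using conn3_bridgeless petersen_pet by (auto simp: conn3_iff three_graph_def petersen_coloring_def colors_def)
  ultimately show "infinite (iso_class ` {G :: nat_graph. connected_graph G \<and> simple_graph G \<and>
           bridgeless G \<and> cubic G \<and> \<not> (\<exists>\<phi>. petersen_coloring G \<phi>)})"
    using infinite_super[OF image_mono] by blast
  show "infinite H3"
    by (rule infinite_H3[OF J jaeger_uncolorable rigid_of_order_10[OF P petersen_class2 card] petersen_class2 card])
qed

end
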